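(* For all quantum channels $\mathcal{N}$ and $\mathcal{M}$ and for $\star\in\{D,\mathrm{MI}\}$, $$\eta_\star(\mathcal{N}\otimes\mathcal{M})\leq\min\left\{\eta_\star(\mathcal{M})+\eta^\Delta_D(\mathcal{N})-\eta_\star(\mathcal{M})\,\eta^\Delta_D(\mathcal{N}),\ \ \eta^\Delta_D(\mathcal{M})+\eta_\star(\mathcal{N})-\eta^\Delta_D(\mathcal{M})\,\eta_\star(\mathcal{N})\right\}.$$
   Context: All systems are finite-dimensional. A channel acts as the identity on systems not in its input. $D(\rho\|\sigma)=\operatorname{Tr}[\rho(\log\rho-\log\sigma)]$ if $\operatorname{supp}(\rho)\subseteq\operatorname{supp}(\sigma)$, else $+\infty$; $I(A:B)=D(\rho_{AB}\|\rho_A\otimes\rho_B)$. All ratio optimizations are over states with strictly positive and finite denominator (value $0$ if there are none). For a channel $\mathcal{T}\colon A\to B$: $$\eta_D(\mathcal{T})=\sup_{\rho_A\neq\sigma_A}\frac{D(\mathcal{T}(\rho_A)\|\mathcal{T}(\sigma_A))}{D(\rho_A\|\sigma_A)},\qquad \eta_{\mathrm{MI}}(\mathcal{T})=\sup_{C,\ \rho_{CA}}\frac{I(C:B)_{\mathcal{T}(\rho)}}{I(C:A)_\rho},$$ $$\eta^\Delta_D(\mathcal{T})=\sup_{R,\ \rho_{RA},\sigma_{RA}}\frac{D(\mathcal{T}(\rho_{RA})\|\mathcal{T}(\sigma_{RA}))-D(\rho_R\|\sigma_R)}{D(\rho_{RA}\|\sigma_{RA})-D(\rho_R\|\sigma_R)},$$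 where $C$ and $R$ range over all finite-dimensional quantum systems. *)

theory Defs
  imports
    "HOL-Library.Extended_Real"
    "Jordan_Normal_Form.Matrix_Kernel"
    "Jordan_Normal_Form.Schur_Decomposition"
begin

text \<open>
  A finite-dimensional quantum system is given by its dimension, operators on it are
  square complex matrices of that size. The composite of systems of dimensions \<open>m\<close> and \<open>n\<close>
  has dimension \<open>m * n\<close>, the basis vector \<open>|i> |j>\<close> having index \<open>i * n + j\<close>.
\<close>

definition mtrace :: "complex mat \<Rightarrow> complex" where
  "mtrace A = (\<Sum>i<dim_row A. A $$ (i, i))"

definition kron :: "complex mat \<Rightarrow> complex mat \<Rightarrow> complex mat" where
  "kron A B = mat (dim_row A * dim_row B) (dim_col A * dim_col B)
     (\<lambda>(i, j). A $$ (i div dim_row B, j div dim_col B) * B $$ (i mod dim_row B, j mod dim_col B))"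

text \<open>Partial traces of an operator on a composite of systems of dimensions \<open>m\<close> and \<open>n\<close>:
  \<open>tr_snd\<close> traces out the second factor, \<open>tr_fst\<close> the first one.\<close>

definition tr_snd :: "nat \<Rightarrow> nat \<Rightarrow> complex mat \<Rightarrow> complex mat" where
  "tr_snd m n X = mat m m (\<lambda>(i, j). \<Sum>k<n. X $$ (i * n + k, j * n + k))"

definition tr_fst :: "nat \<Rightarrow> nat \<Rightarrow> complex mat \<Rightarrow> complex mat" where
  "tr_fst m n X = mat n n (\<lambda>(k, l). \<Sum>i<m. X $$ (i * n + k, i * n + l))"

text \<open>In the order on \<^typ>\<open>complex\<close>, \<open>0 \<le> z\<close> means that \<open>z\<close> is real and nonnegative.\<close>

definition psd :: "nat \<Rightarrow> complex mat \<Rightarrow> bool" where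
  "psd n A \<longleftrightarrow> A \<in> carrier_mat n n \<and> (\<forall>v \<in> carrier_vec n. 0 \<le> (A *\<^sub>v v) \<bullet>c v)"

definition state :: "nat \<Rightarrow> complex mat \<Rightarrow> bool" where
  "state n \<rho> \<longleftrightarrow> psd n \<rho> \<and> mtrace \<rho> = 1"

text \<open>Functional calculus for Hermitian matrices; the result does not depend on the chosen
  unitary diagonalisation (lemma \<open>spec_fun_eqI\<close> below).\<close>

definition spec_fun :: "(real \<Rightarrow> real) \<Rightarrow> complex mat \<Rightarrow> complex mat" where
  "spec_fun f A = (THE B. \<exists>U \<in> carrier_mat (dim_row A) (dim_row A). \<exists>d :: nat \<Rightarrow> real.
     mat_adjoint U * U = 1\<^sub>m (dim_row A) \<and> U * mat_adjoint U = 1\<^sub>m (dim_row A) \<and>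
     A = U * mat_diag (dim_row A) (\<lambda>i. complex_of_real (d i)) * mat_adjoint U \<and>
     B = U * mat_diag (dim_row A) (\<lambda>i. complex_of_real (f (d i))) * mat_adjoint U)"

lemma mat_adjoint_carrier: "A \<in> carrier_mat m n \<Longrightarrow> mat_adjoint A \<in> carrier_mat n m"
  by (auto simp: mat_adjoint_def mat_of_rows_def)

lemma spec_fun_eqI:
  assumes U: "U \<in> carrier_mat n n" "mat_adjoint U * U = 1\<^sub>m n" "U * mat_adjoint U = 1\<^sub>m n"
    and A: "A = U * mat_diag n (\<lambda>i. complex_of_real (d i)) * mat_adjoint U"
  shows "spec_fun f A = U * mat_diag n (\<lambda>i. complex_of_real (f (d i))) * mat_adjoint U"
proof -
  let ?D = "\<lambda>d. mat_diag n (\<lambda>i. complex_of_real (d i))"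
  have dim: "dim_row A = n" using U(1) A by auto
  have cU: "mat_adjoint U \<in> carrier_mat n n" by (rule mat_adjoint_carrier[OF U(1)])
  have uniq: "V * ?D (\<lambda>i. f (e i)) * mat_adjoint V = U * ?D (\<lambda>i. f (d i)) * mat_adjoint U"
    if V: "V \<in> carrier_mat n n" "mat_adjoint V * V = 1\<^sub>m n" "V * mat_adjoint V = 1\<^sub>m n"
      and A': "A = V * ?D e * mat_adjoint V" for V and e :: "nat \<Rightarrow> real"
  proof -
    have cV: "mat_adjoint V \<in> carrier_mat n n" by (rule mat_adjoint_carrier[OF V(1)])
    define W where "W = mat_adjoint V * U"
    have W: "W \<in> carrier_mat n n" using cV U(1) by (simp add: W_def)
    have VW: "V * W = U" unfolding W_def
      using assoc_mult_mat[OF V(1) cV U(1)] V(3) U(1) by simp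
    have WU: "W * mat_adjoint U = mat_adjoint V" unfolding W_def
      using assoc_mult_mat[OF cV U(1) cU] U(3) cV by simp
    note assoc = assoc_mult_mat[of _ n n _ n _ n]
    note car = mult_carrier_mat[of _ n n _ n] mat_diag_dim U(1) V(1) cU cV W
    have "W * ?D d = mat_adjoint V * (U * (?D d * (mat_adjoint U * U)))"
      by (simp add: W_def assoc car U(2) right_mult_one_mat[of _ n n])
    also have "\<dots> = mat_adjoint V * (A * U)"
      by (simp add: A assoc car)
    also have "\<dots> = (mat_adjoint V * V) * (?D e * W)"
      by (simp add: A' W_def assoc car)
    also have "\<dots> = ?D e * W"
      by (simp add: V(2) left_mult_one_mat[of _ n n] car)
    finally have WD: "W * ?D d = ?D e * W" .
    have ent: "W $$ (i, j) * complex_of_real (d j) = complex_of_real (e i) * W $$ (i, j)"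
      if "i < n" "j < n" for i j
      using arg_cong[OF WD, of "\<lambda>M. M $$ (i, j)"] that
      unfolding mat_diag_mult_left[OF W] mat_diag_mult_right[OF W] by simp
    have entf: "W $$ (i, j) * complex_of_real (f (d j)) = complex_of_real (f (e i)) * W $$ (i, j)"
      if "i < n" "j < n" for i j
      using ent[OF that] by (cases "W $$ (i, j) = 0") auto
    have Wf: "W * ?D (\<lambda>i. f (d i)) = ?D (\<lambda>i. f (e i)) * W"
      unfolding mat_diag_mult_left[OF W] mat_diag_mult_right[OF W]
      by (rule eq_matI) (use entf in auto)
    have "V * ?D (\<lambda>i. f (e i)) * mat_adjoint V = V * (?D (\<lambda>i. f (e i)) * W) * mat_adjoint U"
      unfolding WU[symmetric] by (simp add: assoc car)
    also have "\<dots> = V * W * ?D (\<lambda>i. f (d i)) * mat_adjoint U"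
      unfolding Wf[symmetric] by (simp add: assoc car)
    finally show ?thesis unfolding VW .
  qed
  show ?thesis
    unfolding spec_fun_def dim
    by (rule the_equality) (use U A uniq in blast)+
qed

text \<open>The logarithm is taken on the support and is \<open>0\<close> on the kernel. The choice of
  base is irrelevant: only ratios of relative entropies are considered.\<close>

definition mat_log :: "complex mat \<Rightarrow> complex mat" where
  "mat_log = spec_fun (\<lambda>x. if 0 < x then ln x else 0)"

definition msupp :: "complex mat \<Rightarrow> complex vec set" where
  "msupp A = {v \<in> carrier_vec (dim_col A). \<forall>w \<in> mat_kernel A. v \<bullet>c w = 0}"

definition rel_ent :: "complex mat \<Rightarrow> complex mat \<Rightarrow> ereal" where
  "rel_ent \<rho> \<sigma> =
     (if msupp \<rho> \<subseteq> msupp \<sigma> then ereal (Re (mtrace (\<rho> * (mat_log \<rho> - mat_log \<sigma>)))) else \<infinity>)"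

definition mutual_info :: "nat \<Rightarrow> nat \<Rightarrow> complex mat \<Rightarrow> ereal" where
  "mutual_info m n \<rho> = rel_ent \<rho> (kron (tr_snd m n \<rho>) (tr_fst m n \<rho>))"

record qmap =
  dim_in :: nat
  dim_out :: nat
  app :: "complex mat \<Rightarrow> complex mat"

definition id_map :: "nat \<Rightarrow> qmap" where
  "id_map d = \<lparr>dim_in = d, dim_out = d, app = (\<lambda>X. X)\<rparr>"

definition mat_unit :: "nat \<Rightarrow> nat \<Rightarrow> nat \<Rightarrow> complex mat" where
  "mat_unit n i j = mat n n (\<lambda>(k, l). if k = i \<and> l = j then 1 else 0)"

text \<open>The linear extension of \<open>kron E\<^sub>i\<^sub>j E\<^sub>k\<^sub>l \<mapsto> kron (S E\<^sub>i\<^sub>j) (T E\<^sub>k\<^sub>l)\<close> from matrix units,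
  see \<open>app_tensor_map_kron\<close> below.\<close>

definition tensor_map :: "qmap \<Rightarrow> qmap \<Rightarrow> qmap" where
  "tensor_map S T =
     \<lparr>dim_in = dim_in S * dim_in T, dim_out = dim_out S * dim_out T,
      app = (\<lambda>X. mat (dim_out S * dim_out T) (dim_out S * dim_out T) (\<lambda>(p, q).
        \<Sum>i<dim_in S. \<Sum>j<dim_in S. \<Sum>k<dim_in T. \<Sum>l<dim_in T.
          X $$ (i * dim_in T + k, j * dim_in T + l) *
          app S (mat_unit (dim_in S) i j) $$ (p div dim_out T, q div dim_out T) *
          app T (mat_unit (dim_in T) k l) $$ (p mod dim_out T, q mod dim_out T)))\<rparr>"

definition linear_map :: "qmap \<Rightarrow> bool" where
  "linear_map T \<longleftrightarrow>
     (\<forall>X \<in> carrier_mat (dim_in T) (dim_in T). app T X \<in> carrier_mat (dim_out T) (dim_out T)) \<and>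
     (\<forall>X \<in> carrier_mat (dim_in T) (dim_in T). \<forall>Y \<in> carrier_mat (dim_in T) (dim_in T).
        app T (X + Y) = app T X + app T Y) \<and>
     (\<forall>c. \<forall>X \<in> carrier_mat (dim_in T) (dim_in T). app T (c \<cdot>\<^sub>m X) = c \<cdot>\<^sub>m app T X)"

lemma linear_map_unit_expansion:
  assumes T: "linear_map T" and X: "X \<in> carrier_mat (dim_in T) (dim_in T)"
    and pq: "p < dim_out T" "q < dim_out T"
  shows "app T X $$ (p, q) =
    (\<Sum>i<dim_in T. \<Sum>j<dim_in T. X $$ (i, j) * app T (mat_unit (dim_in T) i j) $$ (p, q))"
proof -
  let ?n = "dim_in T" and ?m = "dim_out T"
  let ?P = "\<lambda>S. mat ?n ?n (\<lambda>ij. if ij \<in> S then X $$ ij else 0)"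
  have E: "mat_unit ?n i j \<in> carrier_mat ?n ?n" for i j by (simp add: mat_unit_def)
  have car: "app T Y \<in> carrier_mat ?m ?m" if "Y \<in> carrier_mat ?n ?n" for Y
    using T that by (simp add: linear_map_def)
  have add: "app T (Y + Z) $$ (p, q) = app T Y $$ (p, q) + app T Z $$ (p, q)"
    if "Y \<in> carrier_mat ?n ?n" "Z \<in> carrier_mat ?n ?n" for Y Z
    using T that pq car[OF that(2)] by (auto simp: linear_map_def)
  have scale: "app T (c \<cdot>\<^sub>m Y) $$ (p, q) = c * app T Y $$ (p, q)"
    if "Y \<in> carrier_mat ?n ?n" for c Y
    using T that pq car[OF that] by (auto simp: linear_map_def)
  have "app T (?P S) $$ (p, q) = (\<Sum>(i, j)\<in>S. X $$ (i, j) * app T (mat_unit ?n i j) $$ (p, q))"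
    if "finite S" "S \<subseteq> {..<?n} \<times> {..<?n}" for S
    using that
  proof (induction S rule: finite_induct)
    case empty
    have "?P {} = 0 \<cdot>\<^sub>m ?P {}" by (rule eq_matI) auto
    then show ?case using scale[of "?P {}" 0] by simp
  next
    case (insert x S)
    obtain i j where x: "x = (i, j)" by force
    have "?P (insert x S) = X $$ (i, j) \<cdot>\<^sub>m mat_unit ?n i j + ?P S"
      by (rule eq_matI) (use insert x in \<open>auto simp: mat_unit_def\<close>)
    then show ?case using insert x by (simp add: add scale E)
  qed
  from this[of "{..<?n} \<times> {..<?n}"]
  have "app T (?P ({..<?n} \<times> {..<?n})) $$ (p, q) =
      (\<Sum>(i, j)\<in>{..<?n} \<times> {..<?n}. X $$ (i, j) * app T (mat_unit ?n i j) $$ (p, q))" by simp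
  moreover have "?P ({..<?n} \<times> {..<?n}) = X" by (rule eq_matI) (use X in auto)
  ultimately show ?thesis by (simp add: sum.cartesian_product)
qed

lemma app_tensor_map_kron:
  assumes S: "linear_map S" and T: "linear_map T"
    and A: "A \<in> carrier_mat (dim_in S) (dim_in S)" and B: "B \<in> carrier_mat (dim_in T) (dim_in T)"
  shows "app (tensor_map S T) (kron A B) = kron (app S A) (app T B)"
proof (rule eq_matI)
  have SA: "app S A \<in> carrier_mat (dim_out S) (dim_out S)"
    and TB: "app T B \<in> carrier_mat (dim_out T) (dim_out T)"
    using S T A B by (auto simp: linear_map_def)
  show "dim_row (app (tensor_map S T) (kron A B)) = dim_row (kron (app S A) (app T B))"
    "dim_col (app (tensor_map S T) (kron A B)) = dim_col (kron (app S A) (app T B))"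
    using SA TB by (auto simp: tensor_map_def kron_def)
  fix p q assume "p < dim_row (kron (app S A) (app T B))" "q < dim_col (kron (app S A) (app T B))"
  then have pq: "p < dim_out S * dim_out T" "q < dim_out S * dim_out T"
    using SA TB by (auto simp: kron_def)
  then have "0 < dim_out T" by (cases "dim_out T") auto
  with pq have b: "p div dim_out T < dim_out S" "q div dim_out T < dim_out S"
    "p mod dim_out T < dim_out T" "q mod dim_out T < dim_out T"
    by (auto simp: less_mult_imp_div_less)
  have idx: "i * dim_in T + k < dim_in S * dim_in T" if "i < dim_in S" "k < dim_in T" for i k
  proof -
    have "i * dim_in T + k < Suc i * dim_in T" using that by simp
    also have "\<dots> \<le> dim_in S * dim_in T" using that by (intro mult_le_mono1) simp
    finally show ?thesis .
  qed
  have k: "kron A B $$ (i * dim_in T + k, j * dim_in T + l) = A $$ (i, j) * B $$ (k, l)"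
    if "i < dim_in S" "j < dim_in S" "k < dim_in T" "l < dim_in T" for i j k l
    using that A B idx[of i k] idx[of j l] by (simp add: kron_def)
  have "app (tensor_map S T) (kron A B) $$ (p, q) =
    (\<Sum>i<dim_in S. \<Sum>j<dim_in S. \<Sum>k<dim_in T. \<Sum>l<dim_in T.
      (A $$ (i, j) * app S (mat_unit (dim_in S) i j) $$ (p div dim_out T, q div dim_out T)) *
      (B $$ (k, l) * app T (mat_unit (dim_in T) k l) $$ (p mod dim_out T, q mod dim_out T)))"
    using pq by (simp add: tensor_map_def k mult_ac)
  also have "\<dots> = app S A $$ (p div dim_out T, q div dim_out T) *
      app T B $$ (p mod dim_out T, q mod dim_out T)"
    unfolding linear_map_unit_expansion[OF S A b(1,2)] linear_map_unit_expansion[OF T B b(3,4)]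
    by (simp add: sum_distrib_left[symmetric] sum_distrib_right[symmetric])
  also have "\<dots> = kron (app S A) (app T B) $$ (p, q)"
    using pq SA TB by (simp add: kron_def)
  finally show "app (tensor_map S T) (kron A B) $$ (p, q) = kron (app S A) (app T B) $$ (p, q)" .
qed

definition completely_positive :: "qmap \<Rightarrow> bool" where
  "completely_positive T \<longleftrightarrow>
     (\<forall>r X. psd (r * dim_in T) X \<longrightarrow> psd (r * dim_out T) (app (tensor_map (id_map r) T) X))"

definition trace_preserving :: "qmap \<Rightarrow> bool" where
  "trace_preserving T \<longleftrightarrow>
     (\<forall>X \<in> carrier_mat (dim_in T) (dim_in T). mtrace (app T X) = mtrace X)"

definition channel :: "qmap \<Rightarrow> bool" where
  "channel T \<longleftrightarrow> 0 < dim_in T \<and> 0 < dim_out T \<and>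
     linear_map T \<and> completely_positive T \<and> trace_preserving T"

definition sup_ratio :: "ereal set \<Rightarrow> ereal" where
  "sup_ratio S = (if S = {} then 0 else Sup S)"

definition eta_D :: "qmap \<Rightarrow> ereal" where
  "eta_D T = sup_ratio {rel_ent (app T \<rho>) (app T \<sigma>) / rel_ent \<rho> \<sigma> | \<rho> \<sigma>.
     state (dim_in T) \<rho> \<and> state (dim_in T) \<sigma> \<and> \<rho> \<noteq> \<sigma> \<and>
     0 < rel_ent \<rho> \<sigma> \<and> rel_ent \<rho> \<sigma> < \<infinity>}"

definition eta_MI :: "qmap \<Rightarrow> ereal" where
  "eta_MI T = sup_ratio
     {mutual_info c (dim_out T) (app (tensor_map (id_map c) T) \<rho>) / mutual_info c (dim_in T) \<rho>
      | c \<rho>. state (c * dim_in T) \<rho> \<and>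
        0 < mutual_info c (dim_in T) \<rho> \<and> mutual_info c (dim_in T) \<rho> < \<infinity>}"

text \<open>As \<open>\<infinity> - x = \<infinity>\<close> for every \<open>x :: ereal\<close>, the condition below that the denominator be finite
  excludes all pairs with \<open>rel_ent \<rho> \<sigma> = \<infinity>\<close>.\<close>

definition eta_Delta_D :: "qmap \<Rightarrow> ereal" where
  "eta_Delta_D T = sup_ratio
     {(rel_ent (app (tensor_map (id_map r) T) \<rho>) (app (tensor_map (id_map r) T) \<sigma>) -
         rel_ent (tr_snd r (dim_in T) \<rho>) (tr_snd r (dim_in T) \<sigma>)) /
      (rel_ent \<rho> \<sigma> - rel_ent (tr_snd r (dim_in T) \<rho>) (tr_snd r (dim_in T) \<sigma>))
      | r \<rho> \<sigma>. state (r * dim_in T) \<rho> \<and> state (r * dim_in T) \<sigma> \<and>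
        0 < rel_ent \<rho> \<sigma> - rel_ent (tr_snd r (dim_in T) \<rho>) (tr_snd r (dim_in T) \<sigma>) \<and>
        rel_ent \<rho> \<sigma> - rel_ent (tr_snd r (dim_in T) \<rho>) (tr_snd r (dim_in T) \<sigma>) < \<infinity>}"

end

theory Submission
  imports Defs "HOL-Computational_Algebra.Fundamental_Theorem_Algebra"
begin

text \<open>
  Factor \<open>N \<otimes> M\<close> as \<open>N\<close> followed by \<open>M\<close>, with the output of \<open>N\<close> and the reference system
  playing the role of \<open>R\<close> in \<open>\<eta>\<^sup>\<Delta>(M)\<close>. If \<open>d'\<close> is the divergence after the first step and \<open>y\<close> its
  part on \<open>R\<close>, the final divergence is at most \<open>\<eta>\<^sup>\<Delta>(M) d' + (1 - \<eta>\<^sup>\<Delta>(M)) y\<close>, where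
  \<open>y \<le> \<eta>(N) d\<close> and, by data processing, \<open>d' \<le> d\<close>. Mutual information is the case
  \<open>\<sigma> = \<rho>\<^sub>C \<otimes> \<rho>\<^sub>A\<^sub>B\<close>. The other half of the minimum follows by swapping the factors.

  Data processing: for \<open>s \<ge> 0\<close> put
  \<open>F\<^sub>s(\<rho>, \<sigma>) = sup\<^sub>X (2 Re tr(X* \<rho>) - tr(X* \<sigma> X) - s tr(X \<rho> X*))\<close>. The Kadison--Schwarz inequality
  for the adjoint of a channel shows that \<open>F\<^sub>s\<close> decreases under channels. In eigenbases of \<open>\<rho>\<close> and
  \<open>\<sigma>\<close> with eigenvalues \<open>p\<^sub>i\<close>, \<open>q\<^sub>j\<close> and overlaps \<open>w\<^sub>i\<^sub>j\<close> it equals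
  \<open>\<Sum> w\<^sub>i\<^sub>j p\<^sub>i\<^sup>2 / (q\<^sub>j + s p\<^sub>i)\<close>, whose integral over \<open>[0, S]\<close>, minus \<open>ln (1 + S) tr \<rho>\<close>, tends to
  \<open>D(\<rho> \<parallel> \<sigma>)\<close> as \<open>S \<rightarrow> \<infinity>\<close>. Finiteness of \<open>F\<^sub>0\<close> encodes the support condition.
\<close>

section \<open>Adjoint, trace and positive semidefinite matrices\<close>

text \<open>Data processing is the only analytic input: nonnegativity, monotonicity under partial
  traces and the bounds 0 and 1 on every coefficient are instances of it. The obstacle is that the
  logarithm does not interact with a channel in any direct way. The functional under the supremum is
  therefore only linear and quadratic in \<open>X\<close>. Write \<open><A, B> = tr (A* B)\<close>,
  \<open>L\<close> for left multiplication by \<open>\<sigma>\<close> and \<open>R\<close> for right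
  multiplication by \<open>\<rho>\<close>. The functional is
  \<open>2 Re <X, \<rho>> - <X, (L + s R) X>\<close>, with supremum
  \<open><\<rho>, (L + s R)^-1 \<rho>>\<close> when \<open>L + s R\<close> is invertible. Since
  \<open>L\<close> and \<open>R\<close> commute, the two eigenbases diagonalise
  \<open>L + s R\<close> although \<open>\<rho>\<close> and \<open>\<sigma>\<close> need not
  commute. The adjoint map transports the linear term exactly and the quadratic one in the right
  direction. The logarithm returns because \<open>p^2 / (q + s p)\<close> is the derivative in
  \<open>s\<close> of \<open>p ln (q + s p)\<close>. The subtracted
  \<open>ln (1 + S) tr \<rho>\<close> is the diverging part of the integral; it is the same before
  and after a trace-preserving map and so drops out of the comparison.\<close>

lemma mat_adjoint_dim [simp]: "dim_row (mat_adjoint A) = dim_col A" "dim_col (mat_adjoint A) = dim_row A"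
  by (simp_all add: mat_adjoint_def mat_of_rows_def)

lemma mat_adjoint_index [simp]:
  fixes A :: "complex mat"
  assumes "i < dim_col A" "j < dim_row A"
  shows "mat_adjoint A $$ (i, j) = cnj (A $$ (j, i))"
  using assms by (simp add: mat_adjoint_def mat_of_rows_def vec_of_list_index conjugate_vec_def)

lemma mat_mult_index:
  assumes "A \<in> carrier_mat n m" "B \<in> carrier_mat m k" "i < n" "j < k"
  shows "(A * B) $$ (i, j) = (\<Sum>l<m. A $$ (i, l) * B $$ (l, j))"
  using assms by (auto simp: scalar_prod_def atLeast0LessThan intro!: sum.cong)

lemma mat_adjoint_adjoint [simp]: "mat_adjoint (mat_adjoint A) = A" for A :: "complex mat"
  by (rule eq_matI) auto

lemma mat_adjoint_mult:
  fixes A :: "complex mat"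
  assumes A: "A \<in> carrier_mat n m" and B: "B \<in> carrier_mat m k"
  shows "mat_adjoint (A * B) = mat_adjoint B * mat_adjoint A"
proof (rule eq_matI)
  fix i j assume "i < dim_row (mat_adjoint B * mat_adjoint A)" "j < dim_col (mat_adjoint B * mat_adjoint A)"
  then have ij: "i < k" "j < n" using A B by auto
  have "(A * B) $$ (j, i) = (\<Sum>l<m. A $$ (j, l) * B $$ (l, i))"
    by (rule mat_mult_index[OF A B ij(2,1)])
  moreover have "(mat_adjoint B * mat_adjoint A) $$ (i, j) = (\<Sum>l<m. mat_adjoint B $$ (i, l) * mat_adjoint A $$ (l, j))"
    by (rule mat_mult_index[OF mat_adjoint_carrier[OF B] mat_adjoint_carrier[OF A] ij])
  ultimately show "mat_adjoint (A * B) $$ (i, j) = (mat_adjoint B * mat_adjoint A) $$ (i, j)"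
    using A B ij by (simp add: mult.commute)
qed (use A B in auto)

lemma mat_adjoint_one [simp]: "mat_adjoint (1\<^sub>m n) = (1\<^sub>m n :: complex mat)"
  by (rule eq_matI) auto

lemma mat_adjoint_real_diag [simp]:
  "mat_adjoint (mat_diag n (\<lambda>i. complex_of_real (d i))) = mat_diag n (\<lambda>i. complex_of_real (d i))"
  by (rule eq_matI) (auto simp: mat_diag_def)

lemma mtrace_mult:
  assumes "A \<in> carrier_mat n m" "B \<in> carrier_mat m n"
  shows "mtrace (A * B) = (\<Sum>i<n. \<Sum>l<m. A $$ (i, l) * B $$ (l, i))"
  using assms by (auto simp: mtrace_def mat_mult_index[of _ n m _ n] simp del: index_mult_mat(1))

lemma mtrace_mult_commute:
  assumes "A \<in> carrier_mat n m" "B \<in> carrier_mat m n"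
  shows "mtrace (A * B) = mtrace (B * A)"
  unfolding mtrace_mult[OF assms] mtrace_mult[OF assms(2,1)]
  by (subst sum.swap) (simp add: mult.commute)

lemma mtrace_adjoint: "A \<in> carrier_mat n n \<Longrightarrow> mtrace (mat_adjoint A) = cnj (mtrace A)"
  by (auto simp: mtrace_def)

lemma mtrace_add: "A \<in> carrier_mat n n \<Longrightarrow> B \<in> carrier_mat n n \<Longrightarrow> mtrace (A + B) = mtrace A + mtrace B"
  by (auto simp: mtrace_def sum.distrib)

lemma mtrace_minus: "A \<in> carrier_mat n n \<Longrightarrow> B \<in> carrier_mat n n \<Longrightarrow> mtrace (A - B) = mtrace A - mtrace B"
  by (auto simp: mtrace_def sum_subtractf)

lemma mtrace_smult: "mtrace (c \<cdot>\<^sub>m A) = c * mtrace A" if "A \<in> carrier_mat n n"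
  using that by (auto simp: mtrace_def sum_distrib_left)

lemma mtrace_sandwich:
  assumes "A \<in> carrier_mat n n" "V \<in> carrier_mat n k" "W \<in> carrier_mat n k"
  shows "mtrace (mat_adjoint V * A * W) = (\<Sum>c<k. \<Sum>i<n. \<Sum>j<n. cnj (V $$ (i, c)) * A $$ (i, j) * W $$ (j, c))"
proof -
  note V' = mat_adjoint_carrier[OF assms(2)]
  have "mtrace (mat_adjoint V * A * W) =
      (\<Sum>c<k. \<Sum>j<n. (\<Sum>i<n. cnj (V $$ (i, c)) * A $$ (i, j)) * W $$ (j, c))"
    using assms by (simp add: mtrace_mult[OF mult_carrier_mat[OF V' assms(1)] assms(3)]
      mat_mult_index[OF V' assms(1)] del: index_mult_mat(1))
  also have "\<dots> = (\<Sum>c<k. \<Sum>i<n. \<Sum>j<n. cnj (V $$ (i, c)) * A $$ (i, j) * W $$ (j, c))"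
    unfolding sum_distrib_right by (rule sum.cong[OF refl]) (rule sum.swap)
  finally show ?thesis .
qed


section \<open>Positivity through quadratic forms\<close>

lemma psd_carrier: "psd n A \<Longrightarrow> A \<in> carrier_mat n n"
  by (simp add: psd_def)

lemma psd_form:
  assumes "A \<in> carrier_mat n n"
  shows "psd n A \<longleftrightarrow> (\<forall>v. 0 \<le> (\<Sum>i<n. \<Sum>j<n. cnj (v i) * A $$ (i, j) * v j))"
proof -
  have *: "(A *\<^sub>v v) \<bullet>c v = (\<Sum>i<n. \<Sum>j<n. cnj (v $ i) * A $$ (i, j) * v $ j)"
    if "v \<in> carrier_vec n" for v
    using assms that
    by (auto simp: scalar_prod_def atLeast0LessThan sum_distrib_left sum_distrib_right mult_ac intro!: sum.cong)
  show ?thesis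
  proof
    assume R: "psd n A"
    show "\<forall>v. 0 \<le> (\<Sum>i<n. \<Sum>j<n. cnj (v i) * A $$ (i, j) * v j)"
    proof
      fix v :: "nat \<Rightarrow> complex"
      show "0 \<le> (\<Sum>i<n. \<Sum>j<n. cnj (v i) * A $$ (i, j) * v j)"
        using bspec[OF conjunct2[OF R[unfolded psd_def]], of "vec n v"] *[of "vec n v"] by simp
    qed
  next
    assume "\<forall>v. 0 \<le> (\<Sum>i<n. \<Sum>j<n. cnj (v i) * A $$ (i, j) * v j)"
    then show "psd n A" using assms * by (auto simp: psd_def)
  qed
qed

text \<open>Each column of \<open>V\<close> contributes one quadratic form. Rectangular
  \<open>V\<close> is allowed because operators stacked on top of each other will be used for
  it.\<close>

lemma psd_mtrace_conj:
  assumes "psd n A" "V \<in> carrier_mat n k"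
  shows "0 \<le> mtrace (mat_adjoint V * A * V)"
  using assms psd_form[OF psd_carrier[OF assms(1)]]
  by (simp add: mtrace_sandwich[OF psd_carrier[OF assms(1)] assms(2,2)] sum_nonneg)

lemma psdI:
  assumes "A \<in> carrier_mat n n" "\<And>V. V \<in> carrier_mat n 1 \<Longrightarrow> 0 \<le> mtrace (mat_adjoint V * A * V)"
  shows "psd n A"
  unfolding psd_form[OF assms(1)]
proof
  fix v :: "nat \<Rightarrow> complex"
  show "0 \<le> (\<Sum>i<n. \<Sum>j<n. cnj (v i) * A $$ (i, j) * v j)"
    using assms(2)[of "mat n 1 (\<lambda>(i, _). v i)"] mtrace_sandwich[OF assms(1), of "mat n 1 (\<lambda>(i, _). v i)" 1 "mat n 1 (\<lambda>(i, _). v i)"]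
    by simp
qed

lemma psd_conj:
  assumes "psd n A" "B \<in> carrier_mat m n"
  shows "psd m (B * A * mat_adjoint B)"
proof (rule psdI)
  note A = psd_carrier[OF assms(1)]
  note B' = mat_adjoint_carrier[OF assms(2)]
  show "B * A * mat_adjoint B \<in> carrier_mat m m" using assms A B' by simp
  fix V :: "complex mat" assume V: "V \<in> carrier_mat m 1"
  note V' = mat_adjoint_carrier[OF V]
  have "mat_adjoint V * (B * A * mat_adjoint B) * V =
      mat_adjoint (mat_adjoint B * V) * A * (mat_adjoint B * V)"
    using A B' V V' assms(2) mult_carrier_mat[OF V' assms(2)] mult_carrier_mat[OF A B'] mult_carrier_mat[OF B' V]
      mult_carrier_mat[OF assms(2) A]
    by (simp add: mat_adjoint_mult[OF B' V] assoc_mult_mat[of _ 1 m _ n _ n] assoc_mult_mat[of _ m n _ n _ m]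
        assoc_mult_mat[of _ 1 m _ m _ 1] assoc_mult_mat[of _ 1 m _ n _ 1] assoc_mult_mat[of _ m n _ n _ 1]
        assoc_mult_mat[of _ n n _ m _ 1] assoc_mult_mat[of _ m n _ m _ 1])
  then show "0 \<le> mtrace (mat_adjoint V * (B * A * mat_adjoint B) * V)"
    using psd_mtrace_conj[OF assms(1) mult_carrier_mat[OF B' V]] by simp
qed

lemma psd_one: "psd n (1\<^sub>m n)"
proof (rule psdI)
  fix V :: "complex mat" assume V: "V \<in> carrier_mat n 1"
  have "0 \<le> cnj z * z" for z
    by (simp add: less_eq_complex_def)
  then show "0 \<le> mtrace (mat_adjoint V * 1\<^sub>m n * V)"
    using V by (simp add: mtrace_mult[OF mat_adjoint_carrier[OF V] V] mat_adjoint_carrier sum_nonneg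
      right_mult_one_mat[OF mat_adjoint_carrier[OF V]])
qed simp

lemma psd_diag:
  assumes "psd n A" "i < n"
  shows "0 \<le> A $$ (i, i)"
proof -
  have "(\<Sum>k<n. \<Sum>l<n. cnj (of_bool (k = i)) * A $$ (k, l) * of_bool (l = i)) = A $$ (i, i)"
    using assms(2) by (simp add: of_bool_def if_distrib[of "\<lambda>x. _ * x"] if_distrib[of cnj]
      if_distrib[of "\<lambda>x. x * _"] cong: if_cong)
  moreover have "0 \<le> (\<Sum>k<n. \<Sum>l<n. cnj (of_bool (k = i)) * A $$ (k, l) * of_bool (l = i))"
    using iffD1[OF psd_form[OF psd_carrier[OF assms(1)]] assms(1)] by (rule spec)
  ultimately show ?thesis by simp
qed

text \<open>A quadratic form with only real values comes from a Hermitian matrix. This is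
  polarisation with the test vectors \<open>e_i + c e_j\<close>.\<close>

lemma psd_adjoint:
  assumes "psd n A"
  shows "mat_adjoint A = A"
proof -
  note A = psd_carrier[OF assms]
  have pos: "0 \<le> (\<Sum>i<n. \<Sum>j<n. cnj (v i) * A $$ (i, j) * v j)" for v
    using assms psd_form[OF A] by simp
  have two: "(\<Sum>k<n. (if k = i then a else if k = j then b else 0) * f k) = a * f i + b * f j"
    if "i < n" "j < n" "i \<noteq> j" for i j and a b :: complex and f
  proof -
    have "(\<Sum>k<n. (if k = i then a else if k = j then b else 0) * f k) =
      (\<Sum>k<n. (if k = i then a * f k else 0) + (if k = j then b * f k else 0))"
      by (rule sum.cong) (use that in auto)
    also have "\<dots> = a * f i + b * f j" using that by (simp add: sum.distrib)
    finally show ?thesis .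
  qed
  note diag = psd_diag[OF assms]
  have off: "A $$ (i, j) = cnj (A $$ (j, i))" if ij: "i < n" "j < n" "i \<noteq> j" for i j
  proof -
    have form: "0 \<le> A $$ (i, i) + c * A $$ (i, j) + cnj c * (A $$ (j, i) + c * A $$ (j, j))" for c
    proof -
      let ?v = "\<lambda>k. if k = i then 1 else if k = j then c else (0::complex)"
      have "(\<Sum>k<n. \<Sum>l<n. cnj (?v k) * A $$ (k, l) * ?v l) =
        (\<Sum>k<n. (if k = i then 1 else if k = j then cnj c else 0) *
           (\<Sum>l<n. ?v l * A $$ (k, l)))"
        by (intro sum.cong) (auto simp: sum_distrib_left mult_ac intro!: sum.cong)
      also have "\<dots> = A $$ (i, i) + c * A $$ (i, j) + cnj c * (A $$ (j, i) + c * A $$ (j, j))"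
        by (simp add: two[OF ij])
      finally show ?thesis using pos[of ?v] by simp
    qed
    \<comment> \<open>\<open>c = 1\<close> makes the imaginary parts of the two off-diagonal entries
      opposite, and \<open>c = \<i>\<close> makes their real parts equal.\<close>
    from form[of 1] form[of \<i>] diag[OF ij(1)] diag[OF ij(2)]
    show ?thesis by (auto simp: less_eq_complex_def complex_eq_iff algebra_simps)
  qed
  show ?thesis
  proof (rule eq_matI)
    fix i j assume "i < dim_row A" "j < dim_col A"
    then show "mat_adjoint A $$ (i, j) = A $$ (i, j)"
      using A diag[of i] off[of i j] by (cases "i = j") (auto simp: less_eq_complex_def complex_eq_iff)
  qed (use A in auto)
qed

section \<open>Spectral theorem\<close>

definition unitary_mat :: "nat \<Rightarrow> complex mat \<Rightarrow> bool" where
  "unitary_mat n U \<longleftrightarrow> U \<in> carrier_mat n n \<and> mat_adjoint U * U = 1\<^sub>m n \<and> U * mat_adjoint U = 1\<^sub>m n"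

lemma unitary_matI:
  assumes "U \<in> carrier_mat n n" "mat_adjoint U * U = 1\<^sub>m n"
  shows "unitary_mat n U"
  using assms mat_mult_left_right_inverse[OF mat_adjoint_carrier[OF assms(1)] assms(1)]
  by (simp add: unitary_mat_def)

lemma unitary_mat_mult:
  assumes "unitary_mat n U" "unitary_mat n V"
  shows "unitary_mat n (U * V)"
proof (rule unitary_matI)
  have U: "U \<in> carrier_mat n n" and V: "V \<in> carrier_mat n n"
    using assms by (auto simp: unitary_mat_def)
  note U' = mat_adjoint_carrier[OF U] and V' = mat_adjoint_carrier[OF V]
  show "U * V \<in> carrier_mat n n" using U V by simp
  have "mat_adjoint (U * V) * (U * V) = mat_adjoint V * ((mat_adjoint U * U) * V)"
    by (simp add: mat_adjoint_mult[OF U V] assoc_mult_mat[of _ n n _ n _ n] U V U' V' mult_carrier_mat[of _ n n _ n])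
  also have "\<dots> = 1\<^sub>m n" using assms V by (simp add: unitary_mat_def)
  finally show "mat_adjoint (U * V) * (U * V) = 1\<^sub>m n" .
qed

text \<open>Gram-Schmidt on a basis completion keeps \<open>v\<close> as first vector and yields
  orthogonal vectors, which are then normalised. The factor \<open>c\<close> stays unspecified
  because only the line through an eigenvector matters later.\<close>

lemma unitary_completion:
  fixes v :: "complex vec"
  assumes v: "v \<in> carrier_vec n" "v \<noteq> 0\<^sub>v n"
  obtains W c where "unitary_mat n W" "col W 0 = c \<cdot>\<^sub>v v"
proof -
  interpret cof_vec_space n "TYPE(complex)" .
  define ws where "ws = gram_schmidt n (basis_completion v)"
  note bc = basis_completion[OF v]
  have n: "n \<noteq> 0" using v by (auto intro!: eq_vecI)
  from bc obtain vs where bv: "basis_completion v = v # vs"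
    using n by (cases "basis_completion v") auto
  have ws: "set ws \<subseteq> carrier_vec n" "corthogonal ws" "length ws = n"
    using gram_schmidt_result[OF bc(2) bc(4) bc(5) ws_def] bc(6) by auto
  have hd: "hd ws = v"
    using gram_schmidt_hd[OF v(1), of vs] by (simp add: ws_def bv)
  have w0: "ws ! 0 = v" using hd hd_conv_nth[of ws] ws(3) n by auto
  have wc: "ws ! i \<in> carrier_vec n" if "i < n" for i using ws that by auto
  \<comment> \<open>The norm of the j-th vector; that it is nonzero is part of
    \<open>corthogonal\<close>.\<close>
  define r where "r j = sqrt (Re (ws ! j \<bullet>c ws ! j))" for j
  have rr: "complex_of_real (r j) * complex_of_real (r j) = ws ! j \<bullet>c ws ! j" and r0: "r j \<noteq> 0" if "j < n" for j
  proof -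
    have ge: "0 \<le> ws ! j \<bullet>c ws ! j" by (rule conjugate_square_ge_0_vec)
    have ne: "ws ! j \<bullet>c ws ! j \<noteq> 0" using corthogonalD[OF ws(2), of j j] that ws(3) by simp
    from ge have re: "complex_of_real (Re (ws ! j \<bullet>c ws ! j)) = ws ! j \<bullet>c ws ! j"
      by (simp add: less_eq_complex_def complex_eq_iff)
    have "r j * r j = Re (ws ! j \<bullet>c ws ! j)" using ge by (simp add: r_def less_eq_complex_def)
    then show "complex_of_real (r j) * complex_of_real (r j) = ws ! j \<bullet>c ws ! j"
      using re by (metis of_real_mult)
    then show "r j \<noteq> 0" using ne by auto
  qed
  define W where "W = mat n n (\<lambda>(i, j). ws ! j $ i / complex_of_real (r j))"
  have W: "W \<in> carrier_mat n n" by (simp add: W_def)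
  have "mat_adjoint W * W = 1\<^sub>m n"
  proof (rule eq_matI)
    fix i j assume "i < dim_row (1\<^sub>m n :: complex mat)" "j < dim_col (1\<^sub>m n :: complex mat)"
    then have ij: "i < n" "j < n" by auto
    have "(mat_adjoint W * W) $$ (i, j) = (\<Sum>l<n. mat_adjoint W $$ (i, l) * W $$ (l, j))"
      by (rule mat_mult_index[OF mat_adjoint_carrier[OF W] W ij])
    also have "\<dots> = (\<Sum>l<n. ws ! j $ l * cnj (ws ! i $ l)) / (complex_of_real (r i) * complex_of_real (r j))"
      unfolding sum_divide_distrib using ij W by (auto simp: W_def mult_ac intro!: sum.cong)
    also have "(\<Sum>l<n. ws ! j $ l * cnj (ws ! i $ l)) = ws ! j \<bullet>c ws ! i"
      using wc[OF ij(1)] wc[OF ij(2)] by (auto simp: scalar_prod_def atLeast0LessThan)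
    also have "ws ! j \<bullet>c ws ! i / (complex_of_real (r i) * complex_of_real (r j)) = (if i = j then 1 else 0)"
      using rr[OF ij(1)] r0[OF ij(1)] corthogonalD[OF ws(2), of j i] ij ws(3)
      by (metis divide_eq_0_iff divide_self no_zero_divisors of_real_eq_0_iff)
    finally show "(mat_adjoint W * W) $$ (i, j) = 1\<^sub>m n $$ (i, j)" using ij by simp
  qed (use W in auto)
  with W have "unitary_mat n W" by (rule unitary_matI)
  moreover have "col W 0 = (1 / complex_of_real (r 0)) \<cdot>\<^sub>v v"
    using n w0 v(1) by (intro eq_vecI) (auto simp: W_def)
  ultimately show thesis using that by blast
qed

lemma exists_eigenvector:
  fixes A :: "complex mat"
  assumes A: "A \<in> carrier_mat n n" and n: "0 < n"
  obtains v e where "v \<in> carrier_vec n" "v \<noteq> 0\<^sub>v n" "A *\<^sub>v v = e \<cdot>\<^sub>v v"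
proof -
  have "\<not> constant (poly (char_poly A))"
    using degree_monic_char_poly[OF A] n by (simp add: constant_degree)
  then obtain e where "poly (char_poly A) e = 0"
    using fundamental_theorem_of_algebra by blast
  then obtain v where "eigenvector A v e"
    using eigenvalue_root_char_poly[OF A] by (auto simp: eigenvalue_def)
  then show thesis using that[of v e] A by (auto simp: eigenvector_def)
qed

text \<open>Induction on the dimension by deflation: in an orthonormal basis that starts with an
  eigenvector, the first column of the matrix is a multiple of the first unit vector, by symmetry so
  is the first row, and the remaining block is Hermitian again.\<close>

theorem hermitian_spectral:
  assumes "A \<in> carrier_mat n n" "mat_adjoint A = A"
  shows "\<exists>U d. unitary_mat n U \<and> A = U * mat_diag n (\<lambda>i. complex_of_real (d i)) * mat_adjoint U"
  using assms
proof (induction n arbitrary: A)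
  case 0
  then show ?case
    by (intro exI[of _ "1\<^sub>m 0"] exI[of _ "\<lambda>_. 0"]) (auto simp: unitary_mat_def intro!: eq_matI)
next
  case (Suc n)
  let ?N = "Suc n"
  note A = Suc.prems(1)
  note assoc = assoc_mult_mat[of _ ?N ?N _ ?N _ ?N]
  note car = mult_carrier_mat[of _ ?N ?N _ ?N]
  obtain v e where v: "v \<in> carrier_vec ?N" "v \<noteq> 0\<^sub>v ?N" "A *\<^sub>v v = e \<cdot>\<^sub>v v"
    using exists_eigenvector[OF A] by auto
  obtain W c where W: "unitary_mat ?N W" and cW: "col W 0 = c \<cdot>\<^sub>v v"
    using unitary_completion[OF v(1,2)] .
  have Wc: "W \<in> carrier_mat ?N ?N" and WW: "mat_adjoint W * W = 1\<^sub>m ?N" and WW': "W * mat_adjoint W = 1\<^sub>m ?N"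
    using W by (auto simp: unitary_mat_def)
  note W' = mat_adjoint_carrier[OF Wc]
  define B where "B = mat_adjoint W * (A * W)"
  have B: "B \<in> carrier_mat ?N ?N" by (simp add: B_def A Wc W' car)
  have Bh: "mat_adjoint B = B"
    by (simp add: B_def mat_adjoint_mult[of _ ?N ?N _ ?N] A Wc W' car Suc.prems(2) assoc)
  have colAW: "col (A * W) 0 = e \<cdot>\<^sub>v col W 0"
    using mult_mat_vec[OF A v(1), of c] by (simp add: col_mult2[OF A Wc] cW v(3) smult_smult_assoc mult.commute)
  have B0: "B $$ (i, 0) = (if i = 0 then e else 0)" if "i < ?N" for i
  proof -
    have "B $$ (i, 0) = row (mat_adjoint W) i \<bullet> col (A * W) 0"
      unfolding B_def using that A Wc W' by (subst index_mult_mat(1)) auto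
    also have "\<dots> = e * (row (mat_adjoint W) i \<bullet> col W 0)"
      unfolding colAW using that Wc by (simp add: scalar_prod_smult_distrib[of _ ?N])
    also have "row (mat_adjoint W) i \<bullet> col W 0 = (mat_adjoint W * W) $$ (i, 0)"
      using that Wc W' by (subst index_mult_mat(1)) auto
    finally show ?thesis using that WW by simp
  qed
  have B0': "B $$ (0, j) = (if j = 0 then cnj e else 0)" if "j < ?N" for j
    using arg_cong[OF Bh, of "\<lambda>M. M $$ (0, j)"] B0[OF that] that B by (auto split: if_splits)
  \<comment> \<open>The corner entry is \<open>e\<close> when read from the first column and
    \<open>cnj e\<close> when read from the first row, so the eigenvalue is real.\<close>
  have e: "complex_of_real (Re e) = e"
    using B0[of 0] B0'[of 0] by (simp add: complex_eq_iff)
  define B3 where "B3 = mat n n (\<lambda>(i, j). B $$ (Suc i, Suc j))"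
  have B3: "B3 \<in> carrier_mat n n" by (simp add: B3_def)
  have "mat_adjoint B3 = B3"
  proof (rule eq_matI)
    fix i j assume ij: "i < dim_row B3" "j < dim_col B3"
    then show "mat_adjoint B3 $$ (i, j) = B3 $$ (i, j)"
      using arg_cong[OF Bh, of "\<lambda>M. M $$ (Suc i, Suc j)"] B by (simp add: B3_def)
  qed (simp_all add: B3_def)
  from Suc.IH[OF B3 this] obtain U d where U: "unitary_mat n U"
    and UB: "B3 = U * mat_diag n (\<lambda>i. complex_of_real (d i)) * mat_adjoint U" by blast
  have Uc: "U \<in> carrier_mat n n" and UU: "mat_adjoint U * U = 1\<^sub>m n"
    using U by (auto simp: unitary_mat_def)
  note U' = mat_adjoint_carrier[OF Uc]
  define V where "V = four_block_mat (1\<^sub>m 1) (0\<^sub>m 1 n) (0\<^sub>m n 1) U"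
  define D where "D = four_block_mat (e \<cdot>\<^sub>m 1\<^sub>m 1) (0\<^sub>m 1 n) (0\<^sub>m n 1) (mat_diag n (\<lambda>i. complex_of_real (d i)))"
  have V: "V \<in> carrier_mat ?N ?N" using Uc by (auto simp: V_def)
  have V': "mat_adjoint V = four_block_mat (1\<^sub>m 1) (0\<^sub>m 1 n) (0\<^sub>m n 1) (mat_adjoint U)"
    using Uc V U' by (intro eq_matI) (auto simp: V_def)
  have D: "D = mat_diag ?N (\<lambda>i. complex_of_real (case i of 0 \<Rightarrow> Re e | Suc i \<Rightarrow> d i))"
    by (rule eq_matI) (auto simp: D_def mat_diag_def e split: nat.splits)
  have "mat_adjoint V * V = 1\<^sub>m ?N"
    using Uc U' UU
    by (subst V', subst V_def, subst mult_four_block_mat[of _ 1 1 _ n _ n _ _ 1 _ n]) (auto intro!: eq_matI)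
  with V have uV: "unitary_mat ?N V" by (rule unitary_matI)
  have "V * D * mat_adjoint V = four_block_mat (e \<cdot>\<^sub>m 1\<^sub>m 1) (0\<^sub>m 1 n) (0\<^sub>m n 1) B3"
    unfolding V'[unfolded V_def] V_def D_def UB using Uc U'
    by (simp add: left_mult_zero_mat[OF mat_diag_dim] right_mult_zero_mat[of _ n n] mult_four_block_mat[of _ 1 1 _ n _ n _ _ 1 _ n] mult_carrier_mat[of _ n n _ n])
  also have "\<dots> = B"
  proof (rule eq_matI)
    fix i j assume "i < dim_row B" "j < dim_col B"
    then show "four_block_mat (e \<cdot>\<^sub>m 1\<^sub>m 1) (0\<^sub>m 1 n) (0\<^sub>m n 1) B3 $$ (i, j) = B $$ (i, j)"
      using B B0[of i] B0'[of j] e by (cases i; cases j) (auto simp: B3_def complex_eq_iff)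
  qed (use B B3 in auto)
  finally have VB: "B = V * D * mat_adjoint V" by simp
  have Dc: "D \<in> carrier_mat ?N ?N" by (simp add: D)
  note V'c = mat_adjoint_carrier[OF V]
  have "A = (W * mat_adjoint W) * A * (W * mat_adjoint W)"
    using A by (simp add: WW')
  also have "\<dots> = W * B * mat_adjoint W"
    by (simp add: B_def assoc car A Wc W')
  also have "\<dots> = (W * V) * D * mat_adjoint (W * V)"
    by (simp add: VB mat_adjoint_mult[OF Wc V] assoc car V V'c Wc W' Dc)
  finally show ?case using unitary_mat_mult[OF W uV] unfolding D by blast
qed

text \<open>The eigenvalues are the diagonal entries of \<open>mat_adjoint U * A * U\<close>, a
  conjugate of a positive matrix.\<close>

theorem psd_spectral:
  assumes "psd n A"
  obtains U d where "unitary_mat n U" "\<And>i. i < n \<Longrightarrow> 0 \<le> d i"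
    "A = U * mat_diag n (\<lambda>i. complex_of_real (d i)) * mat_adjoint U"
proof -
  note A = psd_carrier[OF assms]
  obtain U d where U: "unitary_mat n U"
    and dec: "A = U * mat_diag n (\<lambda>i. complex_of_real (d i)) * mat_adjoint U"
    using hermitian_spectral[OF A psd_adjoint[OF assms]] by blast
  have Uc: "U \<in> carrier_mat n n" and UU: "mat_adjoint U * U = 1\<^sub>m n"
    using U by (auto simp: unitary_mat_def)
  note U' = mat_adjoint_carrier[OF Uc]
  note car = mult_carrier_mat[of _ n n _ n] mat_diag_dim Uc U'
  let ?D = "mat_diag n (\<lambda>i. complex_of_real (d i))"
  have "mat_adjoint U * A * U = (mat_adjoint U * U) * ?D * (mat_adjoint U * U)"
    unfolding dec by (simp add: assoc_mult_mat[of _ n n _ n _ n] car)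
  then have "mat_adjoint U * A * mat_adjoint (mat_adjoint U) = ?D"
    using left_mult_one_mat[of ?D n n] right_mult_one_mat[of ?D n n] by (simp add: UU)
  then have "psd n ?D" using psd_conj[OF assms U'] by simp
  then have "0 \<le> d i" if "i < n" for i
    using psd_diag[of n ?D i] that by (simp add: mat_diag_def less_eq_complex_def)
  then show thesis using that U dec by blast
qed

section \<open>Relative entropy in eigenbases\<close>

abbreviation rdiag :: "nat \<Rightarrow> (nat \<Rightarrow> real) \<Rightarrow> complex mat" where
  "rdiag n d \<equiv> mat_diag n (\<lambda>i. complex_of_real (d i))"

definition variational :: "real \<Rightarrow> complex mat \<Rightarrow> complex mat \<Rightarrow> complex mat \<Rightarrow> real" where
  "variational s \<rho> \<sigma> X = Re (2 * mtrace (mat_adjoint X * \<rho>) - mtrace (mat_adjoint X * \<sigma> * X)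
     - complex_of_real s * mtrace (X * \<rho> * mat_adjoint X))"

locale spectral_pair =
  fixes n :: nat and \<rho> \<sigma> U V :: "complex mat" and p q :: "nat \<Rightarrow> real"
  assumes U: "unitary_mat n U" and V: "unitary_mat n V"
    and p: "\<And>i. i < n \<Longrightarrow> 0 \<le> p i" and q: "\<And>i. i < n \<Longrightarrow> 0 \<le> q i"
    and rho: "\<rho> = U * rdiag n p * mat_adjoint U"
    and sigma: "\<sigma> = V * rdiag n q * mat_adjoint V"
begin

definition g :: "nat \<Rightarrow> nat \<Rightarrow> complex" where
  "g i j = (mat_adjoint V * U) $$ (j, i)"

text \<open>Transition weights between the eigenbases. The families \<open>w i j * p i\<close> and
  \<open>w i j * q j\<close> form the Nussbaum-Szkola pair, whose classical relative entropy is that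
  of the two matrices.\<close>

definition w :: "nat \<Rightarrow> nat \<Rightarrow> real" where
  "w i j = (cmod (g i j))\<^sup>2"

lemma U_car: "U \<in> carrier_mat n n" "mat_adjoint U \<in> carrier_mat n n"
  using U mat_adjoint_carrier by (auto simp: unitary_mat_def)

lemma V_car: "V \<in> carrier_mat n n" "mat_adjoint V \<in> carrier_mat n n"
  using V mat_adjoint_carrier by (auto simp: unitary_mat_def)

lemma UU: "mat_adjoint U * U = 1\<^sub>m n" "U * mat_adjoint U = 1\<^sub>m n"
  using U by (auto simp: unitary_mat_def)

lemma VV: "mat_adjoint V * V = 1\<^sub>m n" "V * mat_adjoint V = 1\<^sub>m n"
  using V by (auto simp: unitary_mat_def)

lemmas car = mult_carrier_mat[of _ n n _ n] mat_diag_dim U_car V_car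
lemmas assoc = assoc_mult_mat[of _ n n _ n _ n]

lemma cancel:
  assumes "X \<in> carrier_mat n n"
  shows "mat_adjoint U * (U * X) = X" "U * (mat_adjoint U * X) = X"
    "mat_adjoint V * (V * X) = X" "V * (mat_adjoint V * X) = X"
  using assms by (simp_all add: assoc[symmetric] car UU VV)

lemma rho_car: "\<rho> \<in> carrier_mat n n" and sigma_car: "\<sigma> \<in> carrier_mat n n"
  by (simp_all add: rho sigma car)

lemma rdiag_mult_index:
  assumes "X \<in> carrier_mat n n" "i < n" "j < n"
  shows "(rdiag n d * X) $$ (i, j) = complex_of_real (d i) * X $$ (i, j)"
    "(X * rdiag n d) $$ (i, j) = X $$ (i, j) * complex_of_real (d j)"
  using assms by (simp_all add: mat_diag_mult_left[of _ n n] mat_diag_mult_right[of _ n n])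

lemma adjoint_overlap:
  assumes "i < n" "j < n"
  shows "(mat_adjoint U * V) $$ (i, j) = cnj (g i j)"
proof -
  have "mat_adjoint U * V = mat_adjoint (mat_adjoint V * U)"
    by (simp add: mat_adjoint_mult[of _ n n _ n] car)
  moreover have "mat_adjoint (mat_adjoint V * U) $$ (i, j) = cnj ((mat_adjoint V * U) $$ (j, i))"
    by (rule mat_adjoint_index) (use assms U_car V_car in auto)
  ultimately show ?thesis by (simp only: g_def)
qed

text \<open>Cyclicity brings the unitaries together into overlap matrices, and each pair of
  eigenvectors then contributes \<open>g i j * cnj (g i j)\<close>. The trace of
  \<open>\<rho>\<close> and both logarithmic terms are instances.\<close>

lemma mtrace_diag_diag:
  "mtrace ((U * rdiag n a * mat_adjoint U) * (V * rdiag n b * mat_adjoint V)) =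
    complex_of_real (\<Sum>i<n. \<Sum>j<n. a i * b j * w i j)"
proof -
  let ?A = "rdiag n a * (mat_adjoint U * V)" and ?B = "rdiag n b * (mat_adjoint V * U)"
  have A: "?A \<in> carrier_mat n n" and B: "?B \<in> carrier_mat n n" by (simp_all add: car)
  have "mtrace ((U * rdiag n a * mat_adjoint U) * (V * rdiag n b * mat_adjoint V)) =
      mtrace (U * (?A * (rdiag n b * mat_adjoint V)))"
    by (simp add: assoc car)
  also have "\<dots> = mtrace ((?A * (rdiag n b * mat_adjoint V)) * U)"
    by (rule mtrace_mult_commute[of _ n n]) (simp_all add: car)
  also have "\<dots> = mtrace (?A * ?B)"
    by (simp add: assoc car)
  also have "\<dots> = (\<Sum>i<n. \<Sum>j<n. ?A $$ (i, j) * ?B $$ (j, i))"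
    by (rule mtrace_mult[OF A B])
  also have "\<dots> = (\<Sum>i<n. \<Sum>j<n. complex_of_real (a i * b j * w i j))"
  proof (intro sum.cong refl)
    fix i j assume ij: "i \<in> {..<n}" "j \<in> {..<n}"
    have "?A $$ (i, j) = complex_of_real (a i) * cnj (g i j)"
      using ij by (subst rdiag_mult_index(1)) (simp_all add: car adjoint_overlap del: index_mult_mat(1))
    moreover have "?B $$ (j, i) = complex_of_real (b j) * g i j"
      using ij by (subst rdiag_mult_index(1)) (simp_all add: car g_def del: index_mult_mat(1))
    moreover have "complex_of_real (w i j) = g i j * cnj (g i j)"
      unfolding w_def by (rule complex_norm_square)
    ultimately show "?A $$ (i, j) * ?B $$ (j, i) = complex_of_real (a i * b j * w i j)"
      by (simp add: mult_ac)
  qed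
  finally show ?thesis by simp
qed

lemma diag_mult_diag:
  "(U * rdiag n a * mat_adjoint U) * (U * rdiag n b * mat_adjoint U) = U * rdiag n (\<lambda>i. a i * b i) * mat_adjoint U"
proof -
  have "(U * rdiag n a * mat_adjoint U) * (U * rdiag n b * mat_adjoint U) =
      U * ((rdiag n a * rdiag n b) * mat_adjoint U)"
    by (simp add: assoc car cancel del: mat_diag_diag)
  then show ?thesis by (simp add: assoc car)
qed

text \<open>Writing the identity in the eigenbasis of \<open>\<sigma>\<close> brings traces that
  involve only \<open>\<rho>\<close> into the same double-sum shape, so that all of them can be
  combined term by term.\<close>

lemma V_one: "V * rdiag n (\<lambda>_. 1) * mat_adjoint V = 1\<^sub>m n"
  using VV V_car by simp

lemma mtrace_rho: "mtrace \<rho> = complex_of_real (\<Sum>i<n. \<Sum>j<n. p i * w i j)"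
proof -
  have "mtrace \<rho> = mtrace (\<rho> * (V * rdiag n (\<lambda>_. 1) * mat_adjoint V))"
    unfolding V_one using rho_car by simp
  then show ?thesis unfolding rho mtrace_diag_diag by simp
qed

lemma mtrace_log:
  "mtrace (\<rho> * (mat_log \<rho> - mat_log \<sigma>)) = complex_of_real
     (\<Sum>i<n. \<Sum>j<n. w i j * p i * ((if 0 < p i then ln (p i) else 0) - (if 0 < q j then ln (q j) else 0)))"
proof -
  let ?L = "\<lambda>x::real. if 0 < x then ln x else 0"
  have lr: "mat_log \<rho> = U * rdiag n (\<lambda>i. ?L (p i)) * mat_adjoint U"
    unfolding mat_log_def by (rule spec_fun_eqI[OF U_car(1) UU rho])
  have ls: "mat_log \<sigma> = V * rdiag n (\<lambda>i. ?L (q i)) * mat_adjoint V"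
    unfolding mat_log_def by (rule spec_fun_eqI[OF V_car(1) VV sigma])
  have lc: "mat_log \<rho> \<in> carrier_mat n n" "mat_log \<sigma> \<in> carrier_mat n n"
    unfolding lr ls by (simp_all add: car)
  have rl: "\<rho> * mat_log \<rho> = U * rdiag n (\<lambda>i. p i * ?L (p i)) * mat_adjoint U"
    unfolding lr by (subst rho) (rule diag_mult_diag)
  have "mtrace (\<rho> * (mat_log \<rho> - mat_log \<sigma>)) = mtrace (\<rho> * mat_log \<rho>) - mtrace (\<rho> * mat_log \<sigma>)"
    using rho_car lc by (simp add: mult_minus_distrib_mat[of _ n n] mtrace_minus[of _ n])
  also have "\<rho> * mat_log \<rho> = (\<rho> * mat_log \<rho>) * (V * rdiag n (\<lambda>_. 1) * mat_adjoint V)"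
    unfolding V_one using rho_car lc by (simp add: right_mult_one_mat[of _ n n])
  also have "mtrace \<dots> = complex_of_real (\<Sum>i<n. \<Sum>j<n. p i * ?L (p i) * 1 * w i j)"
    unfolding rl mtrace_diag_diag by simp
  also have "mtrace (\<rho> * mat_log \<sigma>) = complex_of_real (\<Sum>i<n. \<Sum>j<n. p i * ?L (q j) * w i j)"
    unfolding ls by (subst rho) (simp add: mtrace_diag_diag)
  finally show ?thesis
    unfolding of_real_diff[symmetric] sum_subtractf[symmetric] by (simp add: algebra_simps)
qed

lemma kernel_iff:
  assumes "unitary_mat n W"
  shows "x \<in> mat_kernel (W * rdiag n d * mat_adjoint W) \<longleftrightarrow>
    x \<in> carrier_vec n \<and> (\<forall>i<n. d i \<noteq> 0 \<longrightarrow> (mat_adjoint W *\<^sub>v x) $ i = 0)"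
proof -
  have W: "W \<in> carrier_mat n n" and W': "mat_adjoint W \<in> carrier_mat n n"
    and WW: "mat_adjoint W * W = 1\<^sub>m n"
    using assms mat_adjoint_carrier by (auto simp: unitary_mat_def)
  let ?A = "W * rdiag n d * mat_adjoint W"
  have A: "?A \<in> carrier_mat n n" using W W' by (simp add: car)
  have D: "rdiag n d *\<^sub>v y = vec n (\<lambda>i. complex_of_real (d i) * y $ i)" if "y \<in> carrier_vec n" for y
    using that by (intro eq_vecI)
      (auto simp: mat_diag_def scalar_prod_def if_distrib[of "\<lambda>z. z * _"] cong: if_cong)
  have zero: "M *\<^sub>v 0\<^sub>v n = 0\<^sub>v n" if "M \<in> carrier_mat n n" for M :: "complex mat"
    using that by (intro eq_vecI) auto
  show ?thesis
  proof (cases "x \<in> carrier_vec n")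
    case x: True
    have Wx: "mat_adjoint W *\<^sub>v x \<in> carrier_vec n" using W' x by simp
    have Ax: "?A *\<^sub>v x = W *\<^sub>v (rdiag n d *\<^sub>v (mat_adjoint W *\<^sub>v x))"
      using W W' x Wx by (simp add: assoc_mult_mat_vec[of _ n n _ n] car)
    have "rdiag n d *\<^sub>v (mat_adjoint W *\<^sub>v x) \<in> carrier_vec n"
      unfolding D[OF Wx] by simp
    then have bk: "mat_adjoint W *\<^sub>v (?A *\<^sub>v x) = rdiag n d *\<^sub>v (mat_adjoint W *\<^sub>v x)"
      unfolding Ax using assoc_mult_mat_vec[OF W' W] WW by (metis one_mult_mat_vec)
    have "?A *\<^sub>v x = 0\<^sub>v n \<longleftrightarrow> rdiag n d *\<^sub>v (mat_adjoint W *\<^sub>v x) = 0\<^sub>v n"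
      using bk Ax zero[OF W] zero[OF W'] by metis
    also have "\<dots> \<longleftrightarrow> (\<forall>i<n. d i \<noteq> 0 \<longrightarrow> (mat_adjoint W *\<^sub>v x) $ i = 0)"
      unfolding D[OF Wx] vec_eq_iff by auto
    finally show ?thesis using x A by (auto simp: mat_kernel_def)
  qed (use A in \<open>auto simp: mat_kernel_def\<close>)
qed

lemma mat_vec_index:
  assumes "M \<in> carrier_mat n n" "y \<in> carrier_vec n" "i < n"
  shows "(M *\<^sub>v y) $ i = (\<Sum>j<n. M $$ (i, j) * y $ j)"
  using assms by (simp add: scalar_prod_def atLeast0LessThan)

text \<open>Left to right, an eigenvector of \<open>\<rho>\<close> with nonzero eigenvalue is tested
  against a kernel vector of \<open>\<sigma>\<close>. Right to left, the condition puts the kernel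
  of \<open>\<sigma>\<close> inside the kernel of \<open>\<rho>\<close>, and orthogonal complements
  reverse the inclusion.\<close>

lemma msupp_iff:
  "msupp \<rho> \<subseteq> msupp \<sigma> \<longleftrightarrow> (\<forall>i<n. \<forall>j<n. p i \<noteq> 0 \<longrightarrow> q j = 0 \<longrightarrow> g i j = 0)"
proof -
  have sp: "col W i \<bullet>c x = cnj ((mat_adjoint W *\<^sub>v x) $ i)"
    if "W \<in> carrier_mat n n" "x \<in> carrier_vec n" "i < n" for W x i
    using that by (auto simp: scalar_prod_def mult.commute intro!: sum.cong)
  have mr: "v \<in> msupp \<rho> \<longleftrightarrow> v \<in> carrier_vec n \<and> (\<forall>x \<in> mat_kernel \<rho>. v \<bullet>c x = 0)"
    and ms: "v \<in> msupp \<sigma> \<longleftrightarrow> v \<in> carrier_vec n \<and> (\<forall>x \<in> mat_kernel \<sigma>. v \<bullet>c x = 0)" for v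
    using rho_car sigma_car by (auto simp: msupp_def)
  note kr = kernel_iff[OF U, of _ p, folded rho] and ks = kernel_iff[OF V, of _ q, folded sigma]
  show ?thesis
  proof
    assume sub: "msupp \<rho> \<subseteq> msupp \<sigma>"
    show "\<forall>i<n. \<forall>j<n. p i \<noteq> 0 \<longrightarrow> q j = 0 \<longrightarrow> g i j = 0"
    proof (intro allI impI)
      fix i j assume ij: "i < n" "j < n" "p i \<noteq> 0" "q j = 0"
      have "col U i \<in> msupp \<rho>"
        unfolding mr
      proof (intro conjI ballI)
        show "col U i \<in> carrier_vec n" using U_car(1) by auto
        fix x assume "x \<in> mat_kernel \<rho>"
        then have "x \<in> carrier_vec n" "(mat_adjoint U *\<^sub>v x) $ i = 0" using ij kr by auto
        then show "col U i \<bullet>c x = 0" using sp[OF U_car(1) _ ij(1)] by (metis complex_cnj_zero)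
      qed
      then have "col U i \<in> msupp \<sigma>" using sub by blast
      moreover have "col V j \<in> mat_kernel \<sigma>"
      proof -
        have "mat_adjoint V *\<^sub>v col V j = col (mat_adjoint V * V) j"
          by (rule col_mult2[symmetric, OF V_car(2,1) ij(2)])
        then show ?thesis unfolding ks using VV V_car ij by (auto simp: unit_vec_def)
      qed
      ultimately have "col U i \<bullet>c col V j = 0" using ms by blast
      moreover have "g i j = col U i \<bullet>c col V j"
        unfolding g_def using U_car V_car ij
        by (auto simp: mat_mult_index[of _ n n _ n] scalar_prod_def atLeast0LessThan mult.commute
            simp del: index_mult_mat(1) intro!: sum.cong)
      ultimately show "g i j = 0" by simp
    qed
  next
    assume R: "\<forall>i<n. \<forall>j<n. p i \<noteq> 0 \<longrightarrow> q j = 0 \<longrightarrow> g i j = 0"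
    have "x \<in> mat_kernel \<rho>" if "x \<in> mat_kernel \<sigma>" for x
      unfolding kr
    proof (intro conjI allI impI)
      show x: "x \<in> carrier_vec n" using that ks by blast
      fix i assume i: "i < n" "p i \<noteq> 0"
      have Vx: "mat_adjoint V *\<^sub>v x \<in> carrier_vec n" using V_car x by simp
      have "mat_adjoint U *\<^sub>v x = (mat_adjoint U * V) *\<^sub>v (mat_adjoint V *\<^sub>v x)"
      proof -
        have "(mat_adjoint U * V) *\<^sub>v (mat_adjoint V *\<^sub>v x) = mat_adjoint U *\<^sub>v (V *\<^sub>v (mat_adjoint V *\<^sub>v x))"
          using Vx by (simp add: assoc_mult_mat_vec[of _ n n _ n] car)
        also have "V *\<^sub>v (mat_adjoint V *\<^sub>v x) = x"
          using x VV assoc_mult_mat_vec[OF V_car x] by simp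
        finally show ?thesis by simp
      qed
      then have "(mat_adjoint U *\<^sub>v x) $ i = (\<Sum>j<n. (mat_adjoint U * V) $$ (i, j) * (mat_adjoint V *\<^sub>v x) $ j)"
        using mat_vec_index[OF mult_carrier_mat[OF U_car(2) V_car(1)] Vx i(1)] by simp
      also have "\<dots> = 0"
      proof (intro sum.neutral ballI)
        fix j assume "j \<in> {..<n}"
        then have j: "j < n" by simp
        note gg = adjoint_overlap[OF i(1) j]
        show "(mat_adjoint U * V) $$ (i, j) * (mat_adjoint V *\<^sub>v x) $ j = 0"
          using R i j that[unfolded ks] unfolding gg by (cases "q j = 0") auto
      qed
      finally show "(mat_adjoint U *\<^sub>v x) $ i = 0" .
    qed
    then have K: "mat_kernel \<sigma> \<subseteq> mat_kernel \<rho>" by (rule subsetI)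
    show "msupp \<rho> \<subseteq> msupp \<sigma>"
    proof
      fix v assume "v \<in> msupp \<rho>"
      then have "v \<in> carrier_vec n \<and> (\<forall>x \<in> mat_kernel \<rho>. v \<bullet>c x = 0)" by (rule iffD1[OF mr])
      then show "v \<in> msupp \<sigma>" unfolding ms using K by blast
    qed
  qed
qed

end

section \<open>A variational family interpolating relative entropy\<close>

context spectral_pair
begin

definition supp :: bool where
  "supp \<longleftrightarrow> (\<forall>i<n. \<forall>j<n. p i \<noteq> 0 \<longrightarrow> q j = 0 \<longrightarrow> g i j = 0)"

text \<open>A term with vanishing denominator is 0 by the convention for division. Under
  \<open>supp\<close> and for \<open>s \<ge> 0\<close> its numerator vanishes as well.\<close>

definition F :: "real \<Rightarrow> real" where
  "F s = (\<Sum>i<n. \<Sum>j<n. w i j * (p i)\<^sup>2 / (q j + s * p i))"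

text \<open>The antiderivative of \<open>F\<close> that vanishes at 0, standing in for the integral
  over \<open>[0, s]\<close>. Under \<open>supp\<close>, the factor \<open>w i j * p i\<close> is 0
  wherever \<open>q j = 0\<close>, so the value of \<open>ln 0\<close> does not enter.\<close>

definition H :: "real \<Rightarrow> real" where
  "H s = (\<Sum>i<n. \<Sum>j<n. w i j * p i * (ln (q j + s * p i) - ln (q j)))"

definition divergence :: real where
  "divergence = (\<Sum>i<n. \<Sum>j<n. w i j * p i *
     ((if 0 < p i then ln (p i) else 0) - (if 0 < q j then ln (q j) else 0)))"

lemma rel_ent_eq: "rel_ent \<rho> \<sigma> = (if supp then ereal divergence else \<infinity>)"
  unfolding rel_ent_def msupp_iff supp_def divergence_def mtrace_log Re_complex_of_real ..

text \<open>\<open>Z\<close> has its rows in the eigenbasis of \<open>\<sigma>\<close> and its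
  columns in that of \<open>\<rho>\<close>. Left multiplication by \<open>\<sigma>\<close> and right
  multiplication by \<open>\<rho>\<close> are both diagonal there, so the functional splits into one
  scalar quadratic per entry.\<close>

lemma variational_expand:
  assumes Z: "Z \<in> carrier_mat n n"
  shows "variational s \<rho> \<sigma> (V * Z * mat_adjoint U) = (\<Sum>i<n. \<Sum>j<n.
     2 * Re (cnj (Z $$ (j, i)) * g i j) * p i - (cmod (Z $$ (j, i)))\<^sup>2 * (q j + s * p i))"
proof -
  note Z' = mat_adjoint_carrier[OF Z]
  let ?X = "V * Z * mat_adjoint U"
  have X': "mat_adjoint ?X = U * mat_adjoint Z * mat_adjoint V"
    by (simp add: mat_adjoint_mult[of _ n n _ n] car Z Z' assoc)
  have com: "mtrace (A * B) = mtrace (B * A)" if "A \<in> carrier_mat n n" "B \<in> carrier_mat n n" for A B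
    using mtrace_mult_commute[OF that] .
  have tr: "mtrace (mat_adjoint Z * Y) = (\<Sum>i<n. \<Sum>j<n. cnj (Z $$ (j, i)) * Y $$ (j, i))"
    if "Y \<in> carrier_mat n n" for Y
    unfolding mtrace_mult[OF Z' that] using Z by simp
  have t1: "mtrace (mat_adjoint ?X * \<rho>) = (\<Sum>i<n. \<Sum>j<n. cnj (Z $$ (j, i)) * (g i j * complex_of_real (p i)))"
  proof -
    have "mtrace (mat_adjoint ?X * \<rho>) = mtrace (U * (mat_adjoint Z * (mat_adjoint V * U * rdiag n p) * mat_adjoint U))"
      unfolding X' rho by (simp add: assoc car Z Z')
    also have "\<dots> = mtrace (mat_adjoint Z * (mat_adjoint V * U * rdiag n p) * mat_adjoint U * U)"
      by (rule com) (simp_all add: car Z Z')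
    also have "\<dots> = mtrace (mat_adjoint Z * (mat_adjoint V * U * rdiag n p))"
      by (simp add: assoc car Z Z' UU right_mult_one_mat[of _ n n])
    also have "\<dots> = (\<Sum>i<n. \<Sum>j<n. cnj (Z $$ (j, i)) * (mat_adjoint V * U * rdiag n p) $$ (j, i))"
      by (rule tr) (simp add: car)
    finally show ?thesis
      using rdiag_mult_index(2)[of "mat_adjoint V * U"] by (simp add: g_def car del: index_mult_mat(1))
  qed
  have t2: "mtrace (mat_adjoint ?X * \<sigma> * ?X) = (\<Sum>i<n. \<Sum>j<n. cnj (Z $$ (j, i)) * (complex_of_real (q j) * Z $$ (j, i)))"
  proof -
    have "mtrace (mat_adjoint ?X * \<sigma> * ?X) = mtrace (U * (mat_adjoint Z * (rdiag n q * Z) * mat_adjoint U))"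
      unfolding X' sigma by (simp add: assoc car Z Z' cancel)
    also have "\<dots> = mtrace (mat_adjoint Z * (rdiag n q * Z) * mat_adjoint U * U)"
      by (rule com) (simp_all add: car Z Z')
    also have "\<dots> = mtrace (mat_adjoint Z * (rdiag n q * Z))"
      by (simp add: assoc car Z Z' UU right_mult_one_mat[of _ n n])
    also have "\<dots> = (\<Sum>i<n. \<Sum>j<n. cnj (Z $$ (j, i)) * (rdiag n q * Z) $$ (j, i))"
      by (rule tr) (simp add: car Z)
    finally show ?thesis
      using rdiag_mult_index(1)[OF Z] by (simp del: index_mult_mat(1))
  qed
  have t3: "mtrace (?X * \<rho> * mat_adjoint ?X) = (\<Sum>i<n. \<Sum>j<n. cnj (Z $$ (j, i)) * (Z $$ (j, i) * complex_of_real (p i)))"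
  proof -
    have "mtrace (?X * \<rho> * mat_adjoint ?X) = mtrace (V * (Z * rdiag n p * mat_adjoint Z * mat_adjoint V))"
      unfolding X' rho by (simp add: assoc car Z Z' cancel)
    also have "\<dots> = mtrace (Z * rdiag n p * mat_adjoint Z * mat_adjoint V * V)"
      by (rule com) (simp_all add: car Z Z')
    also have "\<dots> = mtrace ((Z * rdiag n p) * mat_adjoint Z)"
      by (simp add: assoc car Z Z' VV right_mult_one_mat[of _ n n])
    also have "\<dots> = mtrace (mat_adjoint Z * (Z * rdiag n p))"
      by (rule com) (simp_all add: car Z Z')
    also have "\<dots> = (\<Sum>i<n. \<Sum>j<n. cnj (Z $$ (j, i)) * (Z * rdiag n p) $$ (j, i))"
      by (rule tr) (simp add: car Z)
    finally show ?thesis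
      using rdiag_mult_index(2)[OF Z] by (simp del: index_mult_mat(1))
  qed
  have sq: "cnj z * (complex_of_real a * z) = complex_of_real ((cmod z)\<^sup>2 * a)"
    "cnj z * (z * complex_of_real a) = complex_of_real ((cmod z)\<^sup>2 * a)" for z a
    using complex_norm_square[of z] by (simp_all add: mult_ac)
  show ?thesis
    unfolding variational_def t1 t2 t3 sq of_real_sum[symmetric] of_real_mult[symmetric] minus_complex.sel Re_complex_of_real
    by (simp add: sum_distrib_left sum_subtractf sum.distrib algebra_simps)
qed

lemma F_term:
  assumes supp "0 \<le> s" "i < n" "j < n"
  shows "2 * Re (cnj z * g i j) * p i - (cmod z)\<^sup>2 * (q j + s * p i) \<le> w i j * (p i)\<^sup>2 / (q j + s * p i)"
proof (cases "q j + s * p i = 0")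
  case True
  \<comment> \<open>Degenerate entry: the quadratic term is absent, and \<open>supp\<close> removes
    the linear one.\<close>
  then have "q j = 0" using q[OF assms(4)] p[OF assms(3)] assms(2)
    by (simp add: add_nonneg_eq_0_iff)
  then have "p i = 0 \<or> g i j = 0" using assms(1,3,4) by (auto simp: supp_def)
  then show ?thesis using True by auto
next
  case False
  let ?c = "q j + s * p i"
  have expand: "(cmod (z - complex_of_real a * g i j))\<^sup>2 =
      (cmod z)\<^sup>2 - 2 * a * Re (cnj z * g i j) + a\<^sup>2 * w i j" for a
    unfolding w_def cmod_power2 by (simp add: power2_eq_square algebra_simps)
  have scale: "(A - 2 * (P / c) * R + (P / c)\<^sup>2 * W) * c = A * c - 2 * R * P + W * P\<^sup>2 / c"
    if "c \<noteq> 0" for A P c R W :: real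
    using that by (simp add: field_simps power2_eq_square)
  have c: "0 < ?c" using False q[OF assms(4)] p[OF assms(3)] assms(2)
    by (simp add: order_less_le)
  \<comment> \<open>Completing the square around the maximiser
    \<open>z = (p i / ?c) * g i j\<close>.\<close>
  have "(cmod (z - complex_of_real (p i / ?c) * g i j))\<^sup>2 =
      (cmod z)\<^sup>2 - 2 * (p i / ?c) * Re (cnj z * g i j) + (p i / ?c)\<^sup>2 * w i j"
    by (rule expand)
  then have "0 \<le> ((cmod z)\<^sup>2 - 2 * (p i / ?c) * Re (cnj z * g i j) + (p i / ?c)\<^sup>2 * w i j) * ?c"
    using c by (metis less_imp_le mult_nonneg_nonneg zero_le_power2)
  also have "\<dots> = (cmod z)\<^sup>2 * ?c - 2 * Re (cnj z * g i j) * p i + w i j * (p i)\<^sup>2 / ?c"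
    using False scale by blast
  finally show ?thesis by simp
qed

lemma variational_le_F:
  assumes supp "0 \<le> s" and X: "X \<in> carrier_mat n n"
  shows "variational s \<rho> \<sigma> X \<le> F s"
proof -
  let ?Z = "mat_adjoint V * X * U"
  have Z: "?Z \<in> carrier_mat n n" by (simp add: car X)
  have "X = V * ?Z * mat_adjoint U"
    by (simp add: assoc car X cancel UU right_mult_one_mat[of _ n n])
  then have "variational s \<rho> \<sigma> X = variational s \<rho> \<sigma> (V * ?Z * mat_adjoint U)" by simp
  also have "\<dots> \<le> F s"
    unfolding variational_expand[OF Z] F_def
    by (intro sum_mono F_term assms) auto
  finally show ?thesis .
qed

lemma F_attained: "\<exists>X \<in> carrier_mat n n. variational s \<rho> \<sigma> X = F s"
proof -
  \<comment> \<open>The entrywise maximiser from completing the square. For a vanishing denominator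
    the division convention gives entry 0 and value 0, in agreement with the term of
    \<open>F\<close>.\<close>
  let ?Z = "mat n n (\<lambda>(j, i). complex_of_real (p i / (q j + s * p i)) * g i j)"
  have Z: "?Z \<in> carrier_mat n n" by simp
  have "variational s \<rho> \<sigma> (V * ?Z * mat_adjoint U) = F s"
    unfolding variational_expand[OF Z] F_def
  proof (intro sum.cong refl)
    fix i j assume ij: "i \<in> {..<n}" "j \<in> {..<n}"
    let ?c = "q j + s * p i"
    have "Re (cnj (complex_of_real a * g i j) * g i j) = a * w i j" for a
      unfolding w_def cmod_power2 by (simp add: power2_eq_square algebra_simps)
    then have "Re (cnj (complex_of_real (p i / ?c) * g i j) * g i j) = (p i / ?c) * w i j" .
    moreover have "(cmod (complex_of_real a * g i j))\<^sup>2 = a\<^sup>2 * w i j" for a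
      by (simp add: w_def norm_mult power_mult_distrib)
    then have "(cmod (complex_of_real (p i / ?c) * g i j))\<^sup>2 = (p i / ?c)\<^sup>2 * w i j" .
    moreover have "2 * (P / c * W) * P - (P / c)\<^sup>2 * W * c = W * P\<^sup>2 / c" for P c W :: real
      by (cases "c = 0") (simp_all add: field_simps power2_eq_square)
    ultimately show "2 * Re (cnj (?Z $$ (j, i)) * g i j) * p i - (cmod (?Z $$ (j, i)))\<^sup>2 * ?c =
        w i j * (p i)\<^sup>2 / ?c"
      using ij by (simp only: index_mat split lessThan_iff)
  qed
  moreover have "V * ?Z * mat_adjoint U \<in> carrier_mat n n"
    by (intro car Z)
  ultimately show ?thesis by blast
qed

text \<open>If an overlap violates the support condition, the functional at \<open>s = 0\<close> has
  no quadratic term in the matching entry and grows linearly along it.\<close>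

lemma supp_if_bounded:
  assumes "\<And>X. X \<in> carrier_mat n n \<Longrightarrow> variational 0 \<rho> \<sigma> X \<le> K"
  shows supp
  unfolding supp_def
proof (intro allI impI, rule ccontr)
  fix i j assume ij: "i < n" "j < n" "p i \<noteq> 0" "q j = 0" "g i j \<noteq> 0"
  let ?c = "2 * w i j * p i"
  have c: "0 < ?c" using ij p[of i] by (simp add: w_def)
  \<comment> \<open>Scaled against the growth rate \<open>?c\<close> so that the functional takes
    the value \<open>K + 1\<close>.\<close>
  define t where "t = (K + 1) / ?c"
  let ?Z = "mat n n (\<lambda>(l, k). if k = i \<and> l = j then complex_of_real t * g i j else 0)"
  have Z: "?Z \<in> carrier_mat n n" by simp
  have "variational 0 \<rho> \<sigma> (V * ?Z * mat_adjoint U) =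
      (\<Sum>k<n. \<Sum>l<n. if k = i then (if l = j then t * ?c else 0) else 0)"
    unfolding variational_expand[OF Z]
  proof (intro sum.cong refl)
    fix k l assume kl: "k \<in> {..<n}" "l \<in> {..<n}"
    have "2 * Re (cnj (complex_of_real t * g i j) * g i j) * p i = t * ?c"
      unfolding w_def cmod_power2 by (simp add: power2_eq_square algebra_simps)
    then show "2 * Re (cnj (?Z $$ (l, k)) * g k l) * p k - (cmod (?Z $$ (l, k)))\<^sup>2 * (q l + 0 * p k) =
        (if k = i then (if l = j then t * ?c else 0) else 0)"
      using kl ij(4) by (auto simp del: complex_cnj_mult)
  qed
  also have "\<dots> = (\<Sum>k<n. if k = i then t * ?c else 0)"
    by (rule sum.cong) (use ij in auto)
  also have "\<dots> = t * ?c" using ij by simp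
  also have "\<dots> = K + 1" using c unfolding t_def by (metis less_numeral_extra(3) nonzero_eq_divide_eq)
  finally have "variational 0 \<rho> \<sigma> (V * ?Z * mat_adjoint U) = K + 1" .
  moreover have "V * ?Z * mat_adjoint U \<in> carrier_mat n n"
    by (intro car Z)
  ultimately show False using assms[of "V * ?Z * mat_adjoint U"] by linarith
qed

lemma H_0: "H 0 = 0"
  by (simp add: H_def)

lemma H_deriv:
  assumes supp "0 \<le> s"
  shows "(H has_real_derivative F s) (at s)"
proof -
  have "((\<lambda>s. w i j * p i * (ln (q j + s * p i) - ln (q j))) has_real_derivative
      w i j * (p i)\<^sup>2 / (q j + s * p i)) (at s)" if ij: "i < n" "j < n" for i j
  proof (cases "w i j * p i = 0")
    case True
    then consider "w i j = 0" | "p i = 0" by auto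
    then show ?thesis by cases simp_all
  next
    case False
    then have "0 < q j" using assms(1) ij q[OF ij(2)] by (auto simp: supp_def w_def order_less_le)
    then have c: "0 < q j + s * p i" using p[OF ij(1)] assms(2) by (simp add: add_pos_nonneg)
    have "((\<lambda>s. w i j * p i * (ln (q j + s * p i) - ln (q j))) has_real_derivative
        w i j * p i * (p i / (q j + s * p i))) (at s)"
      using c by (auto intro!: derivative_eq_intros)
    then show ?thesis by (simp add: power2_eq_square mult_ac)
  qed
  then show ?thesis
    unfolding H_def[abs_def] F_def by (intro DERIV_sum) auto
qed

text \<open>For \<open>p i > 0\<close> and \<open>q j > 0\<close> the logarithm
  \<open>ln (q j + s * p i)\<close> exceeds \<open>ln (1 + s)\<close> by an amount tending to
  \<open>ln (p i)\<close>. The total weight of these growing terms is the sum of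
  \<open>w i j * p i\<close>, which is the trace of \<open>\<rho>\<close>.\<close>

lemma H_limit:
  assumes supp
  shows "((\<lambda>s. H s - ln (1 + s) * Re (mtrace \<rho>)) \<longlongrightarrow> divergence) at_top"
proof -
  let ?L = "\<lambda>x::real. if 0 < x then ln x else 0"
  let ?f = "\<lambda>s i j. w i j * p i * (ln (q j + s * p i) - ln (q j)) - ln (1 + s) * (p i * w i j)"
  have "((\<lambda>s. ?f s i j) \<longlongrightarrow> w i j * p i * (?L (p i) - ?L (q j))) at_top" if ij: "i < n" "j < n" for i j
  proof (cases "w i j * p i = 0")
    case True
    then consider "w i j = 0" | "p i = 0" by auto
    then show ?thesis by cases simp_all
  next
    case False
    then have q0: "0 < q j" and p0: "0 < p i"
      using assms(1) ij q[OF ij(2)] p[OF ij(1)] by (auto simp: supp_def w_def order_less_le)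
    have inv: "((\<lambda>s::real. c / s) \<longlongrightarrow> 0) at_top" for c
      by (rule tendsto_divide_0[OF tendsto_const filterlim_at_top_imp_at_infinity[OF filterlim_ident]])
    \<comment> \<open>Numerator and denominator are divided by \<open>s\<close> so that both
      converge.\<close>
    have "((\<lambda>s. ln ((q j / s + p i) / (1 / s + 1))) \<longlongrightarrow> ln ((0 + p i) / (0 + 1))) at_top"
      by (intro tendsto_ln tendsto_divide tendsto_add tendsto_const inv) (use p0 in auto)
    moreover have "\<forall>\<^sub>F s in at_top. ln ((q j / s + p i) / (1 / s + 1)) = ln (q j + s * p i) - ln (1 + s)"
      using eventually_gt_at_top[of 0]
    proof eventually_elim
      case (elim s)
      have "(q j / s + p i) / (1 / s + 1) = (q j + s * p i) / (1 + s)"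
      proof -
        have "q j / s + p i = (q j + s * p i) / s" "1 / s + 1 = (1 + s) / s"
          using elim by (simp_all add: field_simps)
        then show ?thesis using elim by simp
      qed
      moreover have "0 < q j + s * p i" using elim q0 p0 by (simp add: add_pos_pos)
      ultimately show ?case using elim by (simp add: ln_div)
    qed
    ultimately have "((\<lambda>s. ln (q j + s * p i) - ln (1 + s)) \<longlongrightarrow> ln (p i)) at_top"
      by (auto elim: Lim_transform_eventually)
    from tendsto_mult_left[OF tendsto_diff[OF this tendsto_const[of "ln (q j)"]], of "w i j * p i"]
    show ?thesis using p0 q0 by (simp add: algebra_simps)
  qed
  then have "((\<lambda>s. \<Sum>i<n. \<Sum>j<n. ?f s i j) \<longlongrightarrow> divergence) at_top"
    unfolding divergence_def by (intro tendsto_sum) auto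
  moreover have "(\<Sum>i<n. \<Sum>j<n. ?f s i j) = H s - ln (1 + s) * Re (mtrace \<rho>)" for s
    unfolding mtrace_rho Re_complex_of_real H_def by (simp add: sum_subtractf sum_distrib_left)
  ultimately show ?thesis by simp
qed

end

section \<open>Comparing two pairs of operators\<close>

lemma spectral_pair_exists:
  assumes "psd n \<rho>" "psd n \<sigma>"
  obtains U V p q where "spectral_pair n \<rho> \<sigma> U V p q"
proof -
  obtain U p where "unitary_mat n U" "\<And>i. i < n \<Longrightarrow> 0 \<le> p i" "\<rho> = U * rdiag n p * mat_adjoint U"
    using psd_spectral[OF assms(1)] by metis
  moreover obtain V q where "unitary_mat n V" "\<And>i. i < n \<Longrightarrow> 0 \<le> q i" "\<sigma> = V * rdiag n q * mat_adjoint V"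
    using psd_spectral[OF assms(2)] by metis
  ultimately have "spectral_pair n \<rho> \<sigma> U V p q" unfolding spectral_pair_def by blast
  then show thesis by (rule that)
qed

text \<open>Comparing suprema orders the two functions \<open>F\<close> for each \<open>s\<close>.
  Integration from 0 orders the antiderivatives, and in the limit the relative entropies, since
  equal traces make the diverging corrections cancel.\<close>

theorem rel_ent_mono_variational:
  assumes psd: "psd n \<rho>" "psd n \<sigma>" "psd m \<rho>'" "psd m \<sigma>'"
    and tr: "mtrace \<rho>' = mtrace \<rho>"
    and dual: "\<And>X. X \<in> carrier_mat m m \<Longrightarrow>
      \<exists>Y \<in> carrier_mat n n. \<forall>s\<ge>0. variational s \<rho>' \<sigma>' X \<le> variational s \<rho> \<sigma> Y"
  shows "rel_ent \<rho>' \<sigma>' \<le> rel_ent \<rho> \<sigma>"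
proof -
  obtain U V p q where "spectral_pair n \<rho> \<sigma> U V p q" using spectral_pair_exists[OF psd(1,2)] .
  then interpret A: spectral_pair n \<rho> \<sigma> U V p q .
  obtain U' V' p' q' where "spectral_pair m \<rho>' \<sigma>' U' V' p' q'" using spectral_pair_exists[OF psd(3,4)] .
  then interpret B: spectral_pair m \<rho>' \<sigma>' U' V' p' q' .
  show ?thesis
  proof (cases A.supp)
    case True
    have le: "variational s \<rho>' \<sigma>' X \<le> A.F s" if "X \<in> carrier_mat m m" "0 \<le> s" for X s
      using dual[OF that(1)] A.variational_le_F[OF True that(2)] that(2) by (meson order_trans)
    \<comment> \<open>The bound at the single value \<open>s = 0\<close> already forces the support
      condition on the second pair, so its relative entropy is finite.\<close>
    have sB: B.supp using B.supp_if_bounded le[of _ 0] by blast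
    have F: "B.F s \<le> A.F s" if "0 \<le> s" for s
      using B.F_attained[of s] le[OF _ that] by metis
    have H: "B.H s \<le> A.H s" if "0 \<le> s" for s
    proof -
      \<comment> \<open>A difference with nonnegative derivative replaces monotonicity of the
        integral.\<close>
      have "A.H 0 - B.H 0 \<le> A.H s - B.H s"
        using that
      proof (rule DERIV_nonneg_imp_nondecreasing)
        fix x assume "0 \<le> x" "x \<le> s"
        then show "\<exists>y. ((\<lambda>s. A.H s - B.H s) has_real_derivative y) (at x) \<and> 0 \<le> y"
          using DERIV_diff[OF A.H_deriv[OF True] B.H_deriv[OF sB]] F[of x] by (metis diff_ge_0_iff_ge)
      qed
      then show ?thesis by (simp add: A.H_0 B.H_0)
    qed
    have "B.divergence \<le> A.divergence"
    proof (rule tendsto_le[OF _ A.H_limit[OF True] B.H_limit[OF sB]])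
      show "\<forall>\<^sub>F s in at_top. B.H s - ln (1 + s) * Re (mtrace \<rho>') \<le> A.H s - ln (1 + s) * Re (mtrace \<rho>)"
        using eventually_ge_at_top[of 0] by eventually_elim (simp add: tr H)
    qed simp
    then show ?thesis using True sB by (simp add: A.rel_ent_eq B.rel_ent_eq)
  qed (simp add: A.rel_ent_eq)
qed

section \<open>Data processing inequality\<close>

lemma mat_adjoint_smult: "mat_adjoint (c \<cdot>\<^sub>m A) = cnj c \<cdot>\<^sub>m mat_adjoint A" for A :: "complex mat"
  by (rule eq_matI) auto

section \<open>Composite indices and blocks\<close>

lemma pair_index_less: "i * n + k < c * n" if "i < c" "k < n" for i k c n :: nat
proof -
  have "i * n + k < Suc i * n" using that by simp
  also have "\<dots> \<le> c * n" using that by (intro mult_le_mono1) simp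
  finally show ?thesis .
qed

lemma sum_pair_index: "(\<Sum>P<c * n. f P) = (\<Sum>i<c. \<Sum>k<n. f (i * n + k))" for c n :: nat
proof -
  have "(\<Sum>P\<in>{i * n..<i * n + n}. f P) = (\<Sum>k<n. f (i * n + k))" for i
    using sum.shift_bounds_nat_ivl[of f 0 "i * n" n] by (simp add: atLeast0LessThan add.commute)
  then show ?thesis by (simp add: sum.nat_group[symmetric])
qed

lemma eq_mat_pairI:
  assumes "A \<in> carrier_mat (c * n) (c * n)" "B \<in> carrier_mat (c * n) (c * n)"
    "\<And>i j k l. i < c \<Longrightarrow> j < c \<Longrightarrow> k < n \<Longrightarrow> l < n \<Longrightarrow>
      A $$ (i * n + k, j * n + l) = B $$ (i * n + k, j * n + l)"
  shows "A = B"
proof (rule eq_matI)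
  fix P Q assume "P < dim_row B" "Q < dim_col B"
  then have PQ: "P < c * n" "Q < c * n" using assms by auto
  then have n: "0 < n" by (cases n) auto
  have "P div n < c" "Q div n < c" using PQ by (auto simp: less_mult_imp_div_less)
  from assms(3)[OF this, of "P mod n" "Q mod n"] show "A $$ (P, Q) = B $$ (P, Q)" using n by simp
qed (use assms in auto)

text \<open>The operator \<open>(<a| \<otimes> 1) X (|b> \<otimes> 1)\<close>, with the first tensor
  factor as reference.\<close>

definition block :: "nat \<Rightarrow> complex mat \<Rightarrow> nat \<Rightarrow> nat \<Rightarrow> complex mat" where
  "block n X a b = mat n n (\<lambda>(k, l). X $$ (a * n + k, b * n + l))"

lemma block_carrier [simp]: "block n X a b \<in> carrier_mat n n"
  by (simp add: block_def)

lemma block_index [simp]: "k < n \<Longrightarrow> l < n \<Longrightarrow> block n X a b $$ (k, l) = X $$ (a * n + k, b * n + l)"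
  by (simp add: block_def)

lemma mat_unit_carrier [simp]: "mat_unit n i j \<in> carrier_mat n n"
  by (simp add: mat_unit_def)

lemma id_map_simps [simp]: "dim_in (id_map r) = r" "dim_out (id_map r) = r" "app (id_map r) X = X"
  by (simp_all add: id_map_def)

lemma tensor_map_dims [simp]: "dim_in (tensor_map S T) = dim_in S * dim_in T"
  "dim_out (tensor_map S T) = dim_out S * dim_out T"
  by (simp_all add: tensor_map_def)

lemma tensor_map_carrier [simp]:
  "app (tensor_map S T) X \<in> carrier_mat (dim_out S * dim_out T) (dim_out S * dim_out T)"
  by (simp add: tensor_map_def)

lemma tensor_map_index:
  assumes "a < dim_out S" "b < dim_out S" "c < dim_out T" "d < dim_out T"
  shows "app (tensor_map S T) X $$ (a * dim_out T + c, b * dim_out T + d) =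
    (\<Sum>i<dim_in S. \<Sum>j<dim_in S. \<Sum>k<dim_in T. \<Sum>l<dim_in T.
          X $$ (i * dim_in T + k, j * dim_in T + l) *
          app S (mat_unit (dim_in S) i j) $$ (a, b) *
          app T (mat_unit (dim_in T) k l) $$ (c, d))"
  using assms pair_index_less by (simp add: tensor_map_def)

text \<open>Among the matrix units of the reference only the one at \<open>(a, b)\<close> has a
  nonzero entry there, so the amplified map applies \<open>T\<close> to each block
  separately.\<close>

lemma id_tensor_index:
  assumes T: "linear_map T" and "a < r" "b < r" "c < dim_out T" "d < dim_out T"
  shows "app (tensor_map (id_map r) T) X $$ (a * dim_out T + c, b * dim_out T + d) =
    app T (block (dim_in T) X a b) $$ (c, d)"
proof -
  let ?t = "\<lambda>i j k l. X $$ (i * dim_in T + k, j * dim_in T + l) * app T (mat_unit (dim_in T) k l) $$ (c, d)"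
  have "app (tensor_map (id_map r) T) X $$ (a * dim_out T + c, b * dim_out T + d) =
      (\<Sum>i<r. \<Sum>j<r. if i = a then (if j = b then (\<Sum>k<dim_in T. \<Sum>l<dim_in T. ?t a b k l) else 0) else 0)"
    using assms by (subst tensor_map_index) (auto simp: mat_unit_def intro!: sum.cong)
  also have "\<dots> = (\<Sum>i<r. if i = a then (\<Sum>k<dim_in T. \<Sum>l<dim_in T. ?t a b k l) else 0)"
    by (rule sum.cong) (use assms in auto)
  also have "\<dots> = (\<Sum>k<dim_in T. \<Sum>l<dim_in T. ?t a b k l)" using assms by simp
  also have "\<dots> = app T (block (dim_in T) X a b) $$ (c, d)"
    using assms by (subst linear_map_unit_expansion[OF T]) auto
  finally show ?thesis .
qed

lemma block_id_tensor:
  assumes "linear_map T" "a < r" "b < r"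
  shows "block (dim_out T) (app (tensor_map (id_map r) T) X) a b = app T (block (dim_in T) X a b)"
proof -
  have "app T (block (dim_in T) X a b) \<in> carrier_mat (dim_out T) (dim_out T)"
    using assms by (simp add: linear_map_def)
  then show ?thesis
    by (intro eq_matI) (auto simp: id_tensor_index assms block_def)
qed

lemma channelD:
  assumes "channel T"
  shows "0 < dim_in T" "0 < dim_out T" "linear_map T" "completely_positive T" "trace_preserving T"
  using assms by (auto simp: channel_def)

lemma app_carrier:
  assumes "linear_map T" "X \<in> carrier_mat (dim_in T) (dim_in T)"
  shows "app T X \<in> carrier_mat (dim_out T) (dim_out T)"
  using assms by (simp add: linear_map_def)

lemma mtrace_app:
  assumes "channel T" "X \<in> carrier_mat (dim_in T) (dim_in T)"
  shows "mtrace (app T X) = mtrace X"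
  using assms by (simp add: channel_def trace_preserving_def)

text \<open>A one-dimensional reference is invisible. This gives plain positivity from complete
  positivity, and later places states without a reference in the setting with one.\<close>

lemma id_one_tensor:
  assumes "linear_map T" "X \<in> carrier_mat (dim_in T) (dim_in T)"
  shows "app (tensor_map (id_map 1) T) X = app T X"
proof -
  have "block (dim_in T) X 0 0 = X" using assms(2) by (intro eq_matI) (auto simp: block_def)
  then show ?thesis
    using id_tensor_index[OF assms(1), of 0 1 0 _ _ X] app_carrier[OF assms] 
    by (intro eq_matI) (auto simp: tensor_map_def)
qed

lemma channel_psd:
  assumes "channel T" "psd (dim_in T) X"
  shows "psd (dim_out T) (app T X)"
proof -
  have "psd (1 * dim_out T) (app (tensor_map (id_map 1) T) X)"
    using channelD(4)[OF assms(1)] assms(2) unfolding completely_positive_def by (metis mult_1)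
  then show ?thesis using id_one_tensor[OF channelD(3)[OF assms(1)] psd_carrier[OF assms(2)]] by simp
qed

lemma channel_state:
  assumes "channel T" "state (dim_in T) \<rho>"
  shows "state (dim_out T) (app T \<rho>)"
  using assms channel_psd mtrace_app psd_carrier by (auto simp: state_def)

section \<open>Complete positivity tested on stacked operators\<close>

definition stack :: "nat \<Rightarrow> nat \<Rightarrow> (nat \<Rightarrow> complex mat) \<Rightarrow> complex mat" where
  "stack r n A = mat (r * n) n (\<lambda>(P, l). A (P div n) $$ (P mod n, l))"

lemma stack_carrier [simp]: "stack r n A \<in> carrier_mat (r * n) n"
  by (simp add: stack_def)

lemma stack_index [simp]: "i < r \<Longrightarrow> k < n \<Longrightarrow> l < n \<Longrightarrow> stack r n A $$ (i * n + k, l) = A i $$ (k, l)"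
  using pair_index_less[of i r k n] by (simp add: stack_def)

lemma conj_index:
  assumes "A \<in> carrier_mat a n" "B \<in> carrier_mat n n" "C \<in> carrier_mat c n" "i < a" "j < c"
  shows "(A * B * mat_adjoint C) $$ (i, j) = (\<Sum>y<n. (\<Sum>x<n. A $$ (i, x) * B $$ (x, y)) * cnj (C $$ (j, y)))"
proof -
  have "(A * B * mat_adjoint C) $$ (i, j) = (\<Sum>y<n. (A * B) $$ (i, y) * mat_adjoint C $$ (y, j))"
    by (rule mat_mult_index[OF mult_carrier_mat[OF assms(1,2)] mat_adjoint_carrier[OF assms(3)] assms(4,5)])
  also have "\<dots> = (\<Sum>y<n. (\<Sum>x<n. A $$ (i, x) * B $$ (x, y)) * cnj (C $$ (j, y)))"
    using assms by (intro sum.cong refl) (simp add: mat_mult_index[OF assms(1,2)] del: index_mult_mat(1))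
  finally show ?thesis .
qed

lemma block_stack:
  assumes "\<And>i. i < r \<Longrightarrow> A i \<in> carrier_mat n n" "\<rho> \<in> carrier_mat n n" "i < r" "j < r"
  shows "block n (stack r n A * \<rho> * mat_adjoint (stack r n A)) i j = A i * \<rho> * mat_adjoint (A j)"
proof (rule eq_matI)
  have Ai: "A i \<in> carrier_mat n n" and Aj: "A j \<in> carrier_mat n n" using assms by auto
  show "dim_row (block n (stack r n A * \<rho> * mat_adjoint (stack r n A)) i j) = dim_row (A i * \<rho> * mat_adjoint (A j))"
    "dim_col (block n (stack r n A * \<rho> * mat_adjoint (stack r n A)) i j) = dim_col (A i * \<rho> * mat_adjoint (A j))"
    using Ai Aj by (simp_all add: block_def)
  fix k l assume "k < dim_row (A i * \<rho> * mat_adjoint (A j))" "l < dim_col (A i * \<rho> * mat_adjoint (A j))"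
  then have kl: "k < n" "l < n" using Ai Aj by auto
  show "block n (stack r n A * \<rho> * mat_adjoint (stack r n A)) i j $$ (k, l) = (A i * \<rho> * mat_adjoint (A j)) $$ (k, l)"
    unfolding conj_index[OF Ai assms(2) Aj kl] block_index[OF kl]
    using kl assms
    by (subst conj_index[OF stack_carrier assms(2) stack_carrier]) (simp_all add: pair_index_less)
qed

lemma mtrace_stack:
  assumes "\<And>i. i < r \<Longrightarrow> C i \<in> carrier_mat m m" "W \<in> carrier_mat (r * m) (r * m)"
  shows "mtrace (mat_adjoint (stack r m C) * W * stack r m C) =
    (\<Sum>i<r. \<Sum>j<r. mtrace (mat_adjoint (C i) * block m W i j * C j))"
proof -
  let ?t = "\<lambda>c i k j l. cnj (C i $$ (k, c)) * W $$ (i * m + k, j * m + l) * C j $$ (l, c)"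
  have "mtrace (mat_adjoint (stack r m C) * W * stack r m C) =
      (\<Sum>c<m. \<Sum>i<r. \<Sum>k<m. \<Sum>j<r. \<Sum>l<m. ?t c i k j l)"
    unfolding mtrace_sandwich[OF assms(2) stack_carrier stack_carrier] sum_pair_index
    by (intro sum.cong refl) simp
  also have "\<dots> = (\<Sum>i<r. \<Sum>c<m. \<Sum>k<m. \<Sum>j<r. \<Sum>l<m. ?t c i k j l)"
    by (rule sum.swap)
  also have "\<dots> = (\<Sum>i<r. \<Sum>j<r. \<Sum>c<m. \<Sum>k<m. \<Sum>l<m. ?t c i k j l)"
  proof (rule sum.cong[OF refl])
    fix i
    have "(\<Sum>c<m. \<Sum>k<m. \<Sum>j<r. \<Sum>l<m. ?t c i k j l) = (\<Sum>c<m. \<Sum>j<r. \<Sum>k<m. \<Sum>l<m. ?t c i k j l)"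
      by (rule sum.cong[OF refl]) (rule sum.swap)
    also have "\<dots> = (\<Sum>j<r. \<Sum>c<m. \<Sum>k<m. \<Sum>l<m. ?t c i k j l)" by (rule sum.swap)
    finally show "(\<Sum>c<m. \<Sum>k<m. \<Sum>j<r. \<Sum>l<m. ?t c i k j l) = (\<Sum>j<r. \<Sum>c<m. \<Sum>k<m. \<Sum>l<m. ?t c i k j l)" .
  qed
  also have "\<dots> = (\<Sum>i<r. \<Sum>j<r. mtrace (mat_adjoint (C i) * block m W i j * C j))"
    using assms(1) by (intro sum.cong refl) (simp add: mtrace_sandwich[OF block_carrier, of _ _ m])
  finally show ?thesis .
qed

text \<open>Complete positivity as a scalar inequality: stacking makes the operators
  \<open>A i * \<rho> * mat_adjoint (A j)\<close> the blocks of one positive operator, and the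
  \<open>C i\<close> form a single column that compresses its image.\<close>

lemma channel_stack_nonneg:
  fixes r :: nat
  assumes T: "channel T" and \<rho>: "psd (dim_in T) \<rho>"
    and A: "\<And>i. i < r \<Longrightarrow> A i \<in> carrier_mat (dim_in T) (dim_in T)"
    and C: "\<And>i. i < r \<Longrightarrow> C i \<in> carrier_mat (dim_out T) (dim_out T)"
  shows "0 \<le> (\<Sum>i<r. \<Sum>j<r. mtrace (mat_adjoint (C i) * app T (A i * \<rho> * mat_adjoint (A j)) * C j))"
proof -
  let ?n = "dim_in T" and ?m = "dim_out T"
  let ?Z = "stack r ?n A * \<rho> * mat_adjoint (stack r ?n A)"
  let ?W = "app (tensor_map (id_map r) T) ?Z"
  have "psd (r * ?n) ?Z" using \<rho> by (rule psd_conj) simp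
  then have W: "psd (r * ?m) ?W" using channelD(4)[OF T] by (simp add: completely_positive_def)
  have "0 \<le> mtrace (mat_adjoint (stack r ?m C) * ?W * stack r ?m C)"
    using W stack_carrier by (rule psd_mtrace_conj)
  also have "\<dots> = (\<Sum>i<r. \<Sum>j<r. mtrace (mat_adjoint (C i) * block ?m ?W i j * C j))"
    by (rule mtrace_stack[OF C psd_carrier[OF W]])
  also have "\<dots> = (\<Sum>i<r. \<Sum>j<r. mtrace (mat_adjoint (C i) * app T (A i * \<rho> * mat_adjoint (A j)) * C j))"
    by (intro sum.cong refl) (simp add: block_id_tensor[OF channelD(3)[OF T]] block_stack[OF A psd_carrier[OF \<rho>]])
  finally show ?thesis .
qed

text \<open>The positive operator \<open>[[1, W*], [W, W W*]]\<close> has a positive and hence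
  Hermitian image, whose off-diagonal blocks are the images of \<open>W*\<close> and
  \<open>W\<close>.\<close>

lemma channel_adjoint:
  assumes T: "channel T" and W: "W \<in> carrier_mat (dim_in T) (dim_in T)"
  shows "app T (mat_adjoint W) = mat_adjoint (app T W)"
proof -
  let ?n = "dim_in T" and ?m = "dim_out T"
  note lin = channelD(3)[OF T]
  let ?A = "\<lambda>i::nat. if i = 0 then 1\<^sub>m ?n else W"
  let ?Z = "stack 2 ?n ?A * 1\<^sub>m ?n * mat_adjoint (stack 2 ?n ?A)"
  let ?M = "app (tensor_map (id_map 2) T) ?Z"
  have A: "?A i \<in> carrier_mat ?n ?n" for i using W by simp
  note W' = mat_adjoint_carrier[OF W]
  have "psd (2 * ?n) ?Z" using psd_one by (rule psd_conj) simp
  then have M: "psd (2 * ?m) ?M" using channelD(4)[OF T] by (simp add: completely_positive_def)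
  have b01: "block ?m ?M 0 1 = app T (mat_adjoint W)"
    using W' by (simp add: block_id_tensor[OF lin] block_stack[of 2 ?A ?n] W left_mult_one_mat[of _ ?n ?n])
  have b10: "block ?m ?M 1 0 = app T W"
    using W by (simp add: block_id_tensor[OF lin] block_stack[of 2 ?A ?n])
  have "block ?m ?M 0 1 = mat_adjoint (block ?m ?M 1 0)"
  proof (rule eq_matI)
    fix k l assume "k < dim_row (mat_adjoint (block ?m ?M 1 0))" "l < dim_col (mat_adjoint (block ?m ?M 1 0))"
    then have kl: "k < ?m" "l < ?m" by (auto simp: block_def)
    have ix: "1 * ?m + l < 2 * ?m" "0 * ?m + k < 2 * ?m" using kl by auto
    have "?M $$ (0 * ?m + k, 1 * ?m + l) = mat_adjoint ?M $$ (0 * ?m + k, 1 * ?m + l)"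
      using psd_adjoint[OF M] by simp
    also have "\<dots> = cnj (?M $$ (1 * ?m + l, 0 * ?m + k))"
      using psd_carrier[OF M] ix by (intro mat_adjoint_index) auto
    finally show "block ?m ?M 0 1 $$ (k, l) = mat_adjoint (block ?m ?M 1 0) $$ (k, l)"
      using kl by (simp add: block_def)
  qed (simp_all add: block_def)
  then show ?thesis unfolding b01 b10 .
qed

section \<open>The adjoint map and the Schwarz inequality\<close>

definition dual_map :: "qmap \<Rightarrow> complex mat \<Rightarrow> complex mat" where
  "dual_map T X = mat (dim_in T) (dim_in T) (\<lambda>(j, i). mtrace (X * app T (mat_unit (dim_in T) i j)))"

lemma dual_map_carrier [simp]: "dual_map T X \<in> carrier_mat (dim_in T) (dim_in T)"
  by (simp add: dual_map_def)

text \<open>The pairing is bilinear, with no adjoint on \<open>X\<close>. On matrix units it holds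
  by the transposed index order in \<open>dual_map\<close>, and linearity does the rest.\<close>

lemma mtrace_dual_map:
  assumes T: "linear_map T" and X: "X \<in> carrier_mat (dim_out T) (dim_out T)"
    and W: "W \<in> carrier_mat (dim_in T) (dim_in T)"
  shows "mtrace (X * app T W) = mtrace (dual_map T X * W)"
proof -
  let ?n = "dim_in T" and ?m = "dim_out T"
  let ?t = "\<lambda>x y i j. X $$ (x, y) * (W $$ (i, j) * app T (mat_unit ?n i j) $$ (y, x))"
  have "mtrace (X * app T W) = (\<Sum>x<?m. \<Sum>y<?m. \<Sum>i<?n. \<Sum>j<?n. ?t x y i j)"
    unfolding mtrace_mult[OF X app_carrier[OF T W]]
    by (intro sum.cong refl) (simp add: linear_map_unit_expansion[OF T W] sum_distrib_left)
  also have "\<dots> = (\<Sum>x<?m. \<Sum>i<?n. \<Sum>j<?n. \<Sum>y<?m. ?t x y i j)"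
  proof (rule sum.cong[OF refl])
    fix x
    have "(\<Sum>y<?m. \<Sum>i<?n. \<Sum>j<?n. ?t x y i j) = (\<Sum>i<?n. \<Sum>y<?m. \<Sum>j<?n. ?t x y i j)" by (rule sum.swap)
    also have "\<dots> = (\<Sum>i<?n. \<Sum>j<?n. \<Sum>y<?m. ?t x y i j)"
      by (rule sum.cong[OF refl]) (rule sum.swap)
    finally show "(\<Sum>y<?m. \<Sum>i<?n. \<Sum>j<?n. ?t x y i j) = (\<Sum>i<?n. \<Sum>j<?n. \<Sum>y<?m. ?t x y i j)" .
  qed
  also have "\<dots> = (\<Sum>i<?n. \<Sum>x<?m. \<Sum>j<?n. \<Sum>y<?m. ?t x y i j)" by (rule sum.swap)
  also have "\<dots> = (\<Sum>i<?n. \<Sum>j<?n. \<Sum>x<?m. \<Sum>y<?m. ?t x y i j)"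
    by (rule sum.cong[OF refl]) (rule sum.swap)
  also have "\<dots> = (\<Sum>i<?n. \<Sum>j<?n. dual_map T X $$ (j, i) * W $$ (i, j))"
    by (intro sum.cong refl)
      (simp add: dual_map_def mtrace_mult[OF X app_carrier[OF T mat_unit_carrier]] sum_distrib_left mult_ac)
  also have "\<dots> = mtrace (dual_map T X * W)"
    unfolding mtrace_mult[OF dual_map_carrier W] by (rule sum.swap)
  finally show ?thesis .
qed

text \<open>Because channels preserve adjoints, the adjoint for the bilinear pairing is also the
  Hilbert-Schmidt adjoint.\<close>

lemma dual_map_adjoint:
  assumes T: "channel T" and X: "X \<in> carrier_mat (dim_out T) (dim_out T)"
  shows "dual_map T (mat_adjoint X) = mat_adjoint (dual_map T X)"
proof (rule eq_matI)
  let ?n = "dim_in T" and ?m = "dim_out T"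
  fix j i assume "j < dim_row (mat_adjoint (dual_map T X))" "i < dim_col (mat_adjoint (dual_map T X))"
  then have ij: "j < ?n" "i < ?n" by (auto simp: dual_map_def)
  let ?E = "app T (mat_unit ?n j i)"
  have E: "?E \<in> carrier_mat ?m ?m" using app_carrier[OF channelD(3)[OF T] mat_unit_carrier] .
  note E' = mat_adjoint_carrier[OF E]
  have adj: "app T (mat_unit ?n i j) = mat_adjoint ?E"
    unfolding channel_adjoint[OF T mat_unit_carrier, symmetric]
    by (rule arg_cong[of _ _ "app T"], rule eq_matI) (auto simp: mat_unit_def)
  have "mtrace (mat_adjoint X * mat_adjoint ?E) = mtrace (mat_adjoint (?E * X))"
    using mat_adjoint_mult[OF E X] by simp
  also have "\<dots> = cnj (mtrace (?E * X))" using E X by (intro mtrace_adjoint) auto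
  also have "mtrace (?E * X) = mtrace (X * ?E)" using E X by (rule mtrace_mult_commute)
  finally have "mtrace (mat_adjoint X * app T (mat_unit ?n i j)) = cnj (mtrace (X * ?E))"
    unfolding adj .
  then show "dual_map T (mat_adjoint X) $$ (j, i) = mat_adjoint (dual_map T X) $$ (j, i)"
    using ij by (simp add: dual_map_def)
qed (simp_all add: dual_map_def)

text \<open>The Kadison--Schwarz inequality for the adjoint map, obtained from two-positivity: the
  operator \<open>[[\<rho>, \<rho> Y*], [Y \<rho>, Y \<rho> Y*]]\<close> is positive, and so is its image, which is compressed
  to the row \<open>[X, -1]\<close>.\<close>

lemma dual_map_schwarz:
  assumes T: "channel T" and \<rho>: "psd (dim_in T) \<rho>" and X: "X \<in> carrier_mat (dim_out T) (dim_out T)"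
  shows "Re (mtrace (dual_map T X * \<rho> * mat_adjoint (dual_map T X))) \<le> Re (mtrace (X * app T \<rho> * mat_adjoint X))"
proof -
  let ?n = "dim_in T" and ?m = "dim_out T"
  define Y where "Y = dual_map T X"
  note lin = channelD(3)[OF T]
  have Y: "Y \<in> carrier_mat ?n ?n" by (simp add: Y_def)
  note Y' = mat_adjoint_carrier[OF Y] and X' = mat_adjoint_carrier[OF X]
  note R = psd_carrier[OF \<rho>]
  note car = mult_carrier_mat[of _ ?n ?n _ ?n] mult_carrier_mat[of _ ?m ?m _ ?m] Y Y' X X' R
    app_carrier[OF lin]
  let ?A = "\<lambda>i::nat. if i = 0 then 1\<^sub>m ?n else Y"
  let ?C = "\<lambda>i::nat. if i = 0 then mat_adjoint X else (-1) \<cdot>\<^sub>m 1\<^sub>m ?m"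
  define t where "t = mtrace (Y * \<rho> * mat_adjoint Y)"
  have neg: "mat_adjoint ((-1) \<cdot>\<^sub>m 1\<^sub>m ?m) = (-1) \<cdot>\<^sub>m (1\<^sub>m ?m :: complex mat)"
    by (simp add: mat_adjoint_smult)
  have one: "mtrace (A * ((-1) \<cdot>\<^sub>m 1\<^sub>m ?m)) = - mtrace A" "mtrace ((-1) \<cdot>\<^sub>m 1\<^sub>m ?m * A) = - mtrace A"
    if "A \<in> carrier_mat ?m ?m" for A
    using that by (simp_all add: mult_smult_distrib[of _ ?m ?m _ ?m] mult_smult_assoc_mat[of _ ?m ?m _ ?m] mtrace_smult[of _ ?m])
  have "0 \<le> (\<Sum>i<2. \<Sum>j<2. mtrace (mat_adjoint (?C i) * app T (?A i * \<rho> * mat_adjoint (?A j)) * ?C j))"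
    by (rule channel_stack_nonneg[OF T \<rho>]) (simp_all add: car)
  also have "\<dots> = mtrace (X * app T \<rho> * mat_adjoint X)
      + mtrace (X * app T (\<rho> * mat_adjoint Y) * ((-1) \<cdot>\<^sub>m 1\<^sub>m ?m))
      + mtrace ((-1) \<cdot>\<^sub>m 1\<^sub>m ?m * app T (Y * \<rho>) * mat_adjoint X)
      + mtrace ((-1) \<cdot>\<^sub>m 1\<^sub>m ?m * app T (Y * \<rho> * mat_adjoint Y) * ((-1) \<cdot>\<^sub>m 1\<^sub>m ?m))"
    by (simp add: numeral_2_eq_2 neg left_mult_one_mat[OF R] right_mult_one_mat[OF R]
        right_mult_one_mat[of _ ?n ?n] car)
  \<comment> \<open>Duality turns each cross term into \<open>- t\<close>, and trace preservation
    turns the last term into \<open>t\<close>. What remains is the difference of the two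
    sides.\<close>
  also have "mtrace (X * app T (\<rho> * mat_adjoint Y) * ((-1) \<cdot>\<^sub>m 1\<^sub>m ?m)) = - t"
    unfolding t_def using mtrace_dual_map[OF lin X, of "\<rho> * mat_adjoint Y"]
    by (subst one) (simp_all add: car Y_def[symmetric] assoc_mult_mat[of _ ?n ?n _ ?n _ ?n])
  also have "mtrace ((-1) \<cdot>\<^sub>m 1\<^sub>m ?m * app T (Y * \<rho>) * mat_adjoint X) = - t"
  proof -
    have "mtrace ((-1) \<cdot>\<^sub>m 1\<^sub>m ?m * app T (Y * \<rho>) * mat_adjoint X) = - mtrace (app T (Y * \<rho>) * mat_adjoint X)"
      using one(2)[of "app T (Y * \<rho>) * mat_adjoint X"] by (simp add: car assoc_mult_mat[of _ ?m ?m _ ?m _ ?m])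
    also have "mtrace (app T (Y * \<rho>) * mat_adjoint X) = mtrace (mat_adjoint X * app T (Y * \<rho>))"
      by (rule mtrace_mult_commute[of _ ?m ?m]) (simp_all add: car)
    also have "\<dots> = mtrace (mat_adjoint Y * (Y * \<rho>))"
      using mtrace_dual_map[OF lin X', of "Y * \<rho>"] by (simp add: dual_map_adjoint[OF T X] Y_def car)
    also have "\<dots> = t"
      unfolding t_def by (rule mtrace_mult_commute[of _ ?n ?n]) (simp_all add: car)
    finally show ?thesis .
  qed
  also have "mtrace ((-1) \<cdot>\<^sub>m 1\<^sub>m ?m * app T (Y * \<rho> * mat_adjoint Y) * ((-1) \<cdot>\<^sub>m 1\<^sub>m ?m)) = t"
    unfolding t_def using mtrace_app[OF T, of "Y * \<rho> * mat_adjoint Y"]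
    by (subst one(1)) (simp_all add: car one(2))
  finally show ?thesis by (simp add: t_def Y_def less_eq_complex_def)
qed

text \<open>The linear term is transported exactly. The quadratic terms carry a minus sign and are
  handled by the Schwarz inequality, applied to \<open>X\<close> for \<open>\<rho>\<close> and to
  its adjoint for \<open>\<sigma>\<close>.\<close>

lemma variational_channel:
  assumes T: "channel T" and \<rho>: "psd (dim_in T) \<rho>" and \<sigma>: "psd (dim_in T) \<sigma>"
    and X: "X \<in> carrier_mat (dim_out T) (dim_out T)" and s: "0 \<le> s"
  shows "variational s (app T \<rho>) (app T \<sigma>) X \<le> variational s \<rho> \<sigma> (dual_map T X)"
proof -
  note X' = mat_adjoint_carrier[OF X]
  have "mtrace (mat_adjoint X * app T \<rho>) = mtrace (mat_adjoint (dual_map T X) * \<rho>)"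
    using mtrace_dual_map[OF channelD(3)[OF T] X' psd_carrier[OF \<rho>]] by (simp add: dual_map_adjoint[OF T X])
  moreover have "Re (mtrace (mat_adjoint (dual_map T X) * \<sigma> * dual_map T X)) \<le>
      Re (mtrace (mat_adjoint X * app T \<sigma> * X))"
    using dual_map_schwarz[OF T \<sigma> X'] by (simp add: dual_map_adjoint[OF T X])
  moreover have "s * Re (mtrace (dual_map T X * \<rho> * mat_adjoint (dual_map T X))) \<le>
      s * Re (mtrace (X * app T \<rho> * mat_adjoint X))"
    using dual_map_schwarz[OF T \<rho> X] s by (rule mult_left_mono)
  ultimately show ?thesis by (simp add: variational_def)
qed

theorem rel_ent_data_processing:
  assumes T: "channel T" and \<rho>: "psd (dim_in T) \<rho>" and \<sigma>: "psd (dim_in T) \<sigma>"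
  shows "rel_ent (app T \<rho>) (app T \<sigma>) \<le> rel_ent \<rho> \<sigma>"
proof (rule rel_ent_mono_variational[OF \<rho> \<sigma> channel_psd[OF T \<rho>] channel_psd[OF T \<sigma>]])
  show "mtrace (app T \<rho>) = mtrace \<rho>" using mtrace_app[OF T psd_carrier[OF \<rho>]] .
  show "\<exists>Y \<in> carrier_mat (dim_in T) (dim_in T).
      \<forall>s\<ge>0. variational s (app T \<rho>) (app T \<sigma>) X \<le> variational s \<rho> \<sigma> Y"
    if "X \<in> carrier_mat (dim_out T) (dim_out T)" for X
    using variational_channel[OF T \<rho> \<sigma> that] dual_map_carrier by blast
qed

section \<open>Tensor products of channels\<close>

lemma linear_tensor_map: "linear_map (tensor_map S T)"
proof -
  have "app (tensor_map S T) (X + Y) = app (tensor_map S T) X + app (tensor_map S T) Y"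
    if "X \<in> carrier_mat (dim_in S * dim_in T) (dim_in S * dim_in T)"
      "Y \<in> carrier_mat (dim_in S * dim_in T) (dim_in S * dim_in T)" for X Y
    using that by (intro eq_matI) (simp_all add: tensor_map_def pair_index_less distrib_right sum.distrib)
  moreover have "app (tensor_map S T) (c \<cdot>\<^sub>m X) = c \<cdot>\<^sub>m app (tensor_map S T) X"
    if "X \<in> carrier_mat (dim_in S * dim_in T) (dim_in S * dim_in T)" for c X
    using that by (intro eq_matI) (simp_all add: tensor_map_def pair_index_less sum_distrib_left mult.assoc)
  ultimately show ?thesis by (simp add: linear_map_def)
qed

lemma eq_mat_blockI:
  assumes "A \<in> carrier_mat (c * n) (c * n)" "B \<in> carrier_mat (c * n) (c * n)"
    "\<And>i j. i < c \<Longrightarrow> j < c \<Longrightarrow> block n A i j = block n B i j"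
  shows "A = B"
  using assms by (intro eq_mat_pairI[of A c n B]) (metis block_index)+

lemma block_block:
  assumes "b < r" "b' < r"
  shows "block n (block (r * n) X a a') b b' = block n X (a * r + b) (a' * r + b')"
proof -
  have "(a * r + b) * n = a * (r * n) + b * n" for a b :: nat
    by (simp add: algebra_simps)
  then show ?thesis using assms by (intro eq_matI) (simp_all add: block_def pair_index_less add.assoc)
qed

text \<open>Two successive references act as a single one of dimension \<open>s * r\<close>, which
  is why amplification preserves complete positivity.\<close>

lemma id_tensor_assoc:
  assumes T: "linear_map T"
  shows "app (tensor_map (id_map s) (tensor_map (id_map r) T)) X = app (tensor_map (id_map (s * r)) T) X"
    (is "?L = ?R")
proof -
  let ?m = "dim_out T"
  have "?L $$ (a * (r * ?m) + P, a' * (r * ?m) + Q) = ?R $$ (a * (r * ?m) + P, a' * (r * ?m) + Q)"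
    if a: "a < s" "a' < s" and PQ: "P < r * ?m" "Q < r * ?m" for a a' P Q
  proof -
    define b c where "b = P div ?m" and "c = P mod ?m"
    define b' c' where "b' = Q div ?m" and "c' = Q mod ?m"
    have m: "0 < ?m" using PQ by (cases ?m) auto
    have P: "P = b * ?m + c" and Q: "Q = b' * ?m + c'" by (simp_all add: b_def c_def b'_def c'_def)
    have bc: "b < r" "b' < r" "c < ?m" "c' < ?m"
      using PQ m by (auto simp: b_def c_def b'_def c'_def less_mult_imp_div_less)
    have "?L $$ (a * (r * ?m) + P, a' * (r * ?m) + Q) =
        app (tensor_map (id_map r) T) (block (r * dim_in T) X a a') $$ (P, Q)"
      using id_tensor_index[OF linear_tensor_map, of a s a' P "id_map r" T Q X] a PQ by simp
    also have "\<dots> = app T (block (dim_in T) X (a * r + b) (a' * r + b')) $$ (c, c')"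
      unfolding P Q id_tensor_index[OF T bc] block_block[OF bc(1,2)] ..
    also have "\<dots> = ?R $$ ((a * r + b) * ?m + c, (a' * r + b') * ?m + c')"
      using bc pair_index_less a by (simp add: id_tensor_index[OF T])
    also have "\<dots> = ?R $$ (a * (r * ?m) + P, a' * (r * ?m) + Q)"
      unfolding P Q by (simp add: algebra_simps)
    finally show ?thesis .
  qed
  then show ?thesis
    by (intro eq_mat_pairI[of _ s "r * ?m"])
      (use tensor_map_carrier[of "id_map s" "tensor_map (id_map r) T"]
        tensor_map_carrier[of "id_map (s * r)" T] in \<open>simp_all add: mult.assoc\<close>)
qed

lemma mtrace_blocks:
  assumes "X \<in> carrier_mat (r * n) (r * n)"
  shows "mtrace X = (\<Sum>a<r. mtrace (block n X a a))"
  using assms by (simp add: mtrace_def sum_pair_index block_def)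

lemma channel_id_tensor:
  assumes T: "channel T" and r: "0 < r"
  shows "channel (tensor_map (id_map r) T)"
  unfolding channel_def
proof (intro conjI linear_tensor_map)
  note lin = channelD(3)[OF T]
  show "0 < dim_in (tensor_map (id_map r) T)" "0 < dim_out (tensor_map (id_map r) T)"
    using channelD(1,2)[OF T] r by simp_all
  show "completely_positive (tensor_map (id_map r) T)"
    using channelD(4)[OF T] by (simp add: completely_positive_def id_tensor_assoc[OF lin] mult.assoc[symmetric])
  show "trace_preserving (tensor_map (id_map r) T)"
    unfolding trace_preserving_def
  proof
    fix X :: "complex mat" assume X: "X \<in> carrier_mat (dim_in (tensor_map (id_map r) T)) (dim_in (tensor_map (id_map r) T))"
    have "mtrace (app (tensor_map (id_map r) T) X) =
        (\<Sum>a<r. mtrace (block (dim_out T) (app (tensor_map (id_map r) T) X) a a))"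
      by (rule mtrace_blocks) (use tensor_map_carrier[of "id_map r" T X] in simp)
    also have "\<dots> = (\<Sum>a<r. mtrace (block (dim_in T) X a a))"
      by (intro sum.cong refl) (simp add: block_id_tensor[OF lin] mtrace_app[OF T])
    also have "\<dots> = mtrace X" using X by (simp add: mtrace_blocks[of X r "dim_in T"])
    finally show "mtrace (app (tensor_map (id_map r) T) X) = mtrace X" .
  qed
qed

lemma id_tensor_comp:
  assumes lin: "linear_map S" "linear_map T" "linear_map R"
    and dim: "dim_out S = dim_in T" "dim_in R = dim_in S" "dim_out R = dim_out T"
    and app: "\<And>X. X \<in> carrier_mat (dim_in S) (dim_in S) \<Longrightarrow> app R X = app T (app S X)"
  shows "app (tensor_map (id_map r) R) X =
    app (tensor_map (id_map r) T) (app (tensor_map (id_map r) S) X)"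
proof (rule eq_mat_blockI[of _ r "dim_out T"])
  show "app (tensor_map (id_map r) R) X \<in> carrier_mat (r * dim_out T) (r * dim_out T)"
    using tensor_map_carrier[of "id_map r" R X] dim by simp
  show "app (tensor_map (id_map r) T) (app (tensor_map (id_map r) S) X) \<in>
      carrier_mat (r * dim_out T) (r * dim_out T)"
    using tensor_map_carrier[of "id_map r" T] by simp
  fix i j assume ij: "i < r" "j < r"
  show "block (dim_out T) (app (tensor_map (id_map r) R) X) i j =
      block (dim_out T) (app (tensor_map (id_map r) T) (app (tensor_map (id_map r) S) X)) i j"
    using block_id_tensor[OF lin(3) ij, of X] block_id_tensor[OF lin(1) ij, of X] dim
    by (simp add: block_id_tensor[OF lin(2) ij] app)
qed

text \<open>\<open>R\<close> has to agree with the composite on the carrier only, so that maps with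
  a defining formula of their own, such as \<open>tensor_map N M\<close>, are recognised as
  channels.\<close>

lemma channel_compI:
  assumes S: "channel S" and T: "channel T" and R: "linear_map R"
    and dim: "dim_out S = dim_in T" "dim_in R = dim_in S" "dim_out R = dim_out T"
    and app: "\<And>X. X \<in> carrier_mat (dim_in S) (dim_in S) \<Longrightarrow> app R X = app T (app S X)"
  shows "channel R"
  unfolding channel_def
proof (intro conjI R)
  note linS = channelD(3)[OF S] and linT = channelD(3)[OF T]
  show "0 < dim_in R" "0 < dim_out R" using channelD(1,2)[OF S] channelD(1,2)[OF T] dim by simp_all
  show "completely_positive R"
    using channelD(4)[OF S] channelD(4)[OF T]
    by (simp add: completely_positive_def id_tensor_comp[OF linS linT R dim app] dim)
  show "trace_preserving R"
    using app_carrier[OF linS] dim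
    by (simp add: trace_preserving_def app mtrace_app[OF S] mtrace_app[OF T])
qed

text \<open>Pulling indices back along \<open>h\<close> is conjugation by the 0-1 matrix whose row
  \<open>i\<close> is the unit vector with index \<open>h i\<close>.\<close>

lemma psd_reindex:
  assumes "psd n X" "\<And>i. i < m \<Longrightarrow> h i < n"
  shows "psd m (mat m m (\<lambda>(i, j). X $$ (h i, h j)))"
proof -
  let ?B = "mat m n (\<lambda>(i, x). if x = h i then 1 else 0) :: complex mat"
  have "mat m m (\<lambda>(i, j). X $$ (h i, h j)) = ?B * X * mat_adjoint ?B"
  proof (rule eq_matI)
    fix i j assume "i < dim_row (?B * X * mat_adjoint ?B)" "j < dim_col (?B * X * mat_adjoint ?B)"
    then have ij: "i < m" "j < m" by auto
    have B: "?B \<in> carrier_mat m n" by simp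
    have "(?B * X * mat_adjoint ?B) $$ (i, j) =
        (\<Sum>y<n. if y = h j then (\<Sum>x<n. if x = h i then X $$ (x, y) else 0) else 0)"
      unfolding conj_index[OF B psd_carrier[OF assms(1)] B ij]
    proof (intro sum.cong refl)
      fix y assume y: "y \<in> {..<n}"
      have "(\<Sum>x<n. ?B $$ (i, x) * X $$ (x, y)) = (\<Sum>x<n. if x = h i then X $$ (x, y) else 0)"
        by (intro sum.cong refl) (use ij in auto)
      then show "(\<Sum>x<n. ?B $$ (i, x) * X $$ (x, y)) * cnj (?B $$ (j, y)) =
          (if y = h j then (\<Sum>x<n. if x = h i then X $$ (x, y) else 0) else 0)"
        using ij y by simp
    qed
    also have "\<dots> = X $$ (h i, h j)" using assms(2)[OF ij(1)] assms(2)[OF ij(2)] by simp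
    finally show "mat m m (\<lambda>(i, j). X $$ (h i, h j)) $$ (i, j) = (?B * X * mat_adjoint ?B) $$ (i, j)"
      using ij by simp
  qed simp_all
  then show ?thesis using psd_conj[OF assms(1), of ?B m] by simp
qed

section \<open>Swap, trace and partial trace as channels\<close>

definition swap_map :: "nat \<Rightarrow> nat \<Rightarrow> qmap" where
  "swap_map a b = \<lparr>dim_in = a * b, dim_out = b * a,
     app = (\<lambda>X. mat (b * a) (b * a) (\<lambda>(P, Q). X $$ (P mod a * b + P div a, Q mod a * b + Q div a)))\<rparr>"

lemma swap_map_simps [simp]: "dim_in (swap_map a b) = a * b" "dim_out (swap_map a b) = b * a"
  by (simp_all add: swap_map_def)

lemma swap_index_less:
  assumes "P < b * a"
  shows "P mod a * b + P div a < a * (b::nat)"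
proof -
  have "0 < a" using assms by (cases a) auto
  then show ?thesis using assms by (intro pair_index_less) (auto simp: less_mult_imp_div_less)
qed

lemma swap_map_index:
  assumes "u < a" "v < a" "k < b" "l < b"
  shows "app (swap_map a b) X $$ (k * a + u, l * a + v) = X $$ (u * b + k, v * b + l)"
  using assms pair_index_less by (simp add: swap_map_def)

lemma swap_map_carrier [simp]: "app (swap_map a b) X \<in> carrier_mat (b * a) (b * a)"
  by (simp add: swap_map_def)

lemma linear_swap_map: "linear_map (swap_map a b)"
  unfolding linear_map_def swap_map_def
  by (auto intro!: eq_matI simp: swap_index_less)

lemma channel_swap_map:
  assumes "0 < a" "0 < b"
  shows "channel (swap_map a b)"
  unfolding channel_def
proof (intro conjI linear_swap_map)
  show "0 < dim_in (swap_map a b)" "0 < dim_out (swap_map a b)" using assms by simp_all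
  show "completely_positive (swap_map a b)"
    unfolding completely_positive_def
  proof (intro allI impI)
    fix r X assume X: "psd (r * dim_in (swap_map a b)) X"
    \<comment> \<open>\<open>h\<close> keeps the reference index and exchanges the two factors
      inside each block.\<close>
    define h where "h P = P div (b * a) * (a * b) + (P mod (b * a) mod a * b + P mod (b * a) div a)" for P
    let ?Y = "mat (r * (b * a)) (r * (b * a)) (\<lambda>(P, Q). X $$ (h P, h Q))"
    have "app (tensor_map (id_map r) (swap_map a b)) X = ?Y"
    proof (rule eq_mat_pairI[of _ r "b * a"])
      fix i j k l assume ij: "i < r" "j < r" "k < b * a" "l < b * a"
      have "app (tensor_map (id_map r) (swap_map a b)) X $$ (i * (b * a) + k, j * (b * a) + l) =
          app (swap_map a b) (block (a * b) X i j) $$ (k, l)"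
        using id_tensor_index[OF linear_swap_map, of i r j k a b l X] ij by simp
      moreover have dv: "(x * m + y) div m = x" if "y < m" for x y m :: nat
        using that by simp
      ultimately show "app (tensor_map (id_map r) (swap_map a b)) X $$ (i * (b * a) + k, j * (b * a) + l) =
          ?Y $$ (i * (b * a) + k, j * (b * a) + l)"
        using ij by (simp add: swap_map_def h_def swap_index_less pair_index_less dv[OF ij(3)] dv[OF ij(4)])
    qed (use tensor_map_carrier[of "id_map r" "swap_map a b" X] in simp_all)
    moreover have "psd (r * (b * a)) ?Y"
    proof (rule psd_reindex[OF X])
      fix P assume "P < r * (b * a)"
      then show "h P < r * dim_in (swap_map a b)"
        unfolding h_def swap_map_simps using assms
        by (intro pair_index_less swap_index_less) (auto simp: less_mult_imp_div_less)
    qed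
    ultimately show "psd (r * dim_out (swap_map a b)) (app (tensor_map (id_map r) (swap_map a b)) X)"
      by simp
  qed
  show "trace_preserving (swap_map a b)"
    unfolding trace_preserving_def
  proof
    fix X :: "complex mat" assume X: "X \<in> carrier_mat (dim_in (swap_map a b)) (dim_in (swap_map a b))"
    have "mtrace (app (swap_map a b) X) = (\<Sum>k<b. \<Sum>u<a. X $$ (u * b + k, u * b + k))"
      using carrier_matD(1)[OF swap_map_carrier, of a b X]
      by (simp add: mtrace_def sum_pair_index swap_map_index)
    also have "\<dots> = (\<Sum>u<a. \<Sum>k<b. X $$ (u * b + k, u * b + k))" by (rule sum.swap)
    also have "\<dots> = mtrace X" using X by (simp add: mtrace_def sum_pair_index)
    finally show "mtrace (app (swap_map a b) X) = mtrace X" .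
  qed
qed

definition trace_map :: "nat \<Rightarrow> qmap" where
  "trace_map n = \<lparr>dim_in = n, dim_out = 1, app = (\<lambda>X. mat 1 1 (\<lambda>_. mtrace X))\<rparr>"

lemma trace_map_simps [simp]: "dim_in (trace_map n) = n" "dim_out (trace_map n) = 1"
  "app (trace_map n) X = mat 1 1 (\<lambda>_. mtrace X)"
  by (simp_all add: trace_map_def)

lemma linear_trace_map: "linear_map (trace_map n)"
  unfolding linear_map_def by (auto intro!: eq_matI simp: mtrace_add mtrace_smult)

text \<open>As an amplified channel, the partial trace becomes subject to data processing.\<close>

lemma tr_snd_eq_tensor:
  "app (tensor_map (id_map r) (trace_map n)) X = tr_snd r n X"
proof (rule eq_matI)
  fix i j assume "i < dim_row (tr_snd r n X)" "j < dim_col (tr_snd r n X)"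
  then have ij: "i < r" "j < r" by (auto simp: tr_snd_def)
  then show "app (tensor_map (id_map r) (trace_map n)) X $$ (i, j) = tr_snd r n X $$ (i, j)"
    using id_tensor_index[OF linear_trace_map ij, of 0 n 0 X]
    by (simp add: tr_snd_def mtrace_def block_def)
qed (simp_all add: tr_snd_def tensor_map_def)

text \<open>The quadratic form of the partial trace at \<open>v\<close> is the sum over
  \<open>k\<close> of the form of \<open>X\<close> at \<open>v \<otimes> e_k\<close>. This is at the
  same time the complete positivity of \<open>trace_map\<close>.\<close>

lemma psd_tr_snd:
  assumes "psd (r * n) X"
  shows "psd r (tr_snd r n X)"
proof -
  have T: "tr_snd r n X \<in> carrier_mat r r" by (simp add: tr_snd_def)
  show ?thesis
    unfolding psd_form[OF T]
  proof
    fix v :: "nat \<Rightarrow> complex"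
    let ?t = "\<lambda>k a b. cnj (v a) * X $$ (a * n + k, b * n + k) * v b"
    have pos: "0 \<le> (\<Sum>a<r. \<Sum>b<r. ?t k a b)" if k: "k < n" for k
    proof -
      \<comment> \<open>The coordinates of \<open>v \<otimes> e_k\<close>.\<close>
      define u where "u Q = (if Q mod n = k then v (Q div n) else 0)" for Q
      have "0 \<le> (\<Sum>P<r * n. \<Sum>Q<r * n. cnj (u P) * X $$ (P, Q) * u Q)"
        using assms psd_form[OF psd_carrier[OF assms]] by simp
      also have "\<dots> = (\<Sum>a<r. \<Sum>x<n. \<Sum>b<r. \<Sum>y<n. if x = k then (if y = k then ?t k a b else 0) else 0)"
        unfolding sum_pair_index by (intro sum.cong refl) (auto simp: u_def)
      also have "\<dots> = (\<Sum>a<r. \<Sum>x<n. if x = k then (\<Sum>b<r. ?t k a b) else 0)"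
        by (intro sum.cong refl) (use k in auto)
      also have "\<dots> = (\<Sum>a<r. \<Sum>b<r. ?t k a b)" using k by simp
      finally show ?thesis .
    qed
    have "(\<Sum>a<r. \<Sum>b<r. cnj (v a) * tr_snd r n X $$ (a, b) * v b) = (\<Sum>a<r. \<Sum>b<r. \<Sum>k<n. ?t k a b)"
      by (intro sum.cong refl) (simp add: tr_snd_def sum_distrib_left sum_distrib_right)
    also have "\<dots> = (\<Sum>a<r. \<Sum>k<n. \<Sum>b<r. ?t k a b)"
      by (rule sum.cong[OF refl], rule sum.swap)
    also have "\<dots> = (\<Sum>k<n. \<Sum>a<r. \<Sum>b<r. ?t k a b)" by (rule sum.swap)
    also have "0 \<le> \<dots>" by (rule sum_nonneg) (use pos in auto)
    finally show "0 \<le> (\<Sum>a<r. \<Sum>b<r. cnj (v a) * tr_snd r n X $$ (a, b) * v b)" .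
  qed
qed

lemma channel_trace_map:
  assumes "0 < n"
  shows "channel (trace_map n)"
  using assms linear_trace_map psd_tr_snd
  by (auto simp: channel_def completely_positive_def trace_preserving_def tr_snd_eq_tensor mtrace_def)

lemma channel_tr_snd: "0 < r \<Longrightarrow> 0 < n \<Longrightarrow> channel (tensor_map (id_map r) (trace_map n))"
  by (simp add: channel_id_tensor channel_trace_map)

section \<open>The tensor product as a composition\<close>

lemma tensor_map_swap:
  "app (tensor_map S T) X = app (swap_map (dim_out T) (dim_out S))
     (app (tensor_map T S) (app (swap_map (dim_in S) (dim_in T)) X))"
proof (rule eq_mat_pairI[of _ "dim_out S" "dim_out T"])
  fix i j k l assume ij: "i < dim_out S" "j < dim_out S" "k < dim_out T" "l < dim_out T"
  let ?t = "\<lambda>x y u v. X $$ (x * dim_in T + u, y * dim_in T + v) *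
      app S (mat_unit (dim_in S) x y) $$ (i, j) * app T (mat_unit (dim_in T) u v) $$ (k, l)"
  have "app (tensor_map S T) X $$ (i * dim_out T + k, j * dim_out T + l) =
      (\<Sum>x<dim_in S. \<Sum>y<dim_in S. \<Sum>u<dim_in T. \<Sum>v<dim_in T. ?t x y u v)"
    by (rule tensor_map_index[OF ij])
  also have "\<dots> = (\<Sum>x<dim_in S. \<Sum>u<dim_in T. \<Sum>y<dim_in S. \<Sum>v<dim_in T. ?t x y u v)"
    by (rule sum.cong[OF refl], rule sum.swap)
  also have "\<dots> = (\<Sum>u<dim_in T. \<Sum>x<dim_in S. \<Sum>y<dim_in S. \<Sum>v<dim_in T. ?t x y u v)"
    by (rule sum.swap)
  also have "\<dots> = (\<Sum>u<dim_in T. \<Sum>x<dim_in S. \<Sum>v<dim_in T. \<Sum>y<dim_in S. ?t x y u v)"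
    by (rule sum.cong[OF refl], rule sum.cong[OF refl], rule sum.swap)
  also have "\<dots> = (\<Sum>u<dim_in T. \<Sum>v<dim_in T. \<Sum>x<dim_in S. \<Sum>y<dim_in S. ?t x y u v)"
    by (rule sum.cong[OF refl], rule sum.swap)
  also have "\<dots> = app (tensor_map T S) (app (swap_map (dim_in S) (dim_in T)) X) $$ (k * dim_out S + i, l * dim_out S + j)"
    unfolding tensor_map_index[OF ij(3,4,1,2)]
    by (intro sum.cong refl) (simp add: swap_map_index)
  finally show "app (tensor_map S T) X $$ (i * dim_out T + k, j * dim_out T + l) =
      app (swap_map (dim_out T) (dim_out S)) (app (tensor_map T S) (app (swap_map (dim_in S) (dim_in T)) X))
        $$ (i * dim_out T + k, j * dim_out T + l)"
    using ij by (simp add: swap_map_index)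
qed simp_all

text \<open>Complete positivity is formulated with the reference on the left; swaps before and after
  carry it to a bystander on the right. \<open>R\<close> is the intermediate map, the first swap
  followed by \<open>N\<close> on the second factor.\<close>

lemma channel_tensor_id:
  assumes N: "channel N" and b: "0 < b"
  shows "channel (tensor_map N (id_map b))"
proof -
  define R where "R = \<lparr>dim_in = dim_in N * b, dim_out = b * dim_out N,
     app = \<lambda>X. app (tensor_map (id_map b) N) (app (swap_map (dim_in N) b) X)\<rparr>"
  note lin = linear_tensor_map[of "id_map b" N] and linS = linear_swap_map[of "dim_in N" b]
  have linR: "linear_map R"
    using linS lin tensor_map_carrier[of "id_map b" N]
    unfolding linear_map_def R_def by simp
  have "channel R"
    by (rule channel_compI[OF channel_swap_map[of "dim_in N" b] channel_id_tensor[OF N b] linR])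
      (use b channelD(1)[OF N] in \<open>simp_all add: R_def\<close>)
  then show ?thesis
    by (rule channel_compI[OF _ channel_swap_map[of b "dim_out N"] linear_tensor_map])
      (use b channelD(2)[OF N] in \<open>simp_all add: R_def tensor_map_swap[of N "id_map b"]\<close>)
qed

lemma tensor_id_index:
  assumes N: "linear_map N" and "p < dim_out N" "q < dim_out N" "k < b" "l < b"
  shows "app (tensor_map N (id_map b)) X $$ (p * b + k, q * b + l) =
    app N (mat (dim_in N) (dim_in N) (\<lambda>(i, j). X $$ (i * b + k, j * b + l))) $$ (p, q)"
proof -
  let ?Y = "mat (dim_in N) (dim_in N) (\<lambda>(i, j). X $$ (i * b + k, j * b + l))"
  have "app (tensor_map N (id_map b)) X $$ (p * b + k, q * b + l) =
      (\<Sum>i<dim_in N. \<Sum>j<dim_in N. \<Sum>u<b. \<Sum>v<b. if u = k then (if v = l then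
        X $$ (i * b + k, j * b + l) * app N (mat_unit (dim_in N) i j) $$ (p, q) else 0) else 0)"
    using assms tensor_map_index[of p N q k "id_map b" l X]
    by (auto simp: mat_unit_def intro!: sum.cong)
  also have "\<dots> = (\<Sum>i<dim_in N. \<Sum>j<dim_in N. \<Sum>u<b. if u = k then
        X $$ (i * b + k, j * b + l) * app N (mat_unit (dim_in N) i j) $$ (p, q) else 0)"
    by (intro sum.cong refl) (use assms in auto)
  also have "\<dots> = (\<Sum>i<dim_in N. \<Sum>j<dim_in N. ?Y $$ (i, j) * app N (mat_unit (dim_in N) i j) $$ (p, q))"
    by (intro sum.cong refl) (use assms in auto)
  also have "\<dots> = app N ?Y $$ (p, q)"
    using assms by (subst linear_map_unit_expansion[OF N]) auto
  finally show ?thesis .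
qed

text \<open>With \<open>N\<close> applied first, its output can join the reference system of
  \<open>M\<close>.\<close>

lemma tensor_map_factor:
  assumes N: "linear_map N" and M: "linear_map M"
  shows "app (tensor_map N M) X =
    app (tensor_map (id_map (dim_out N)) M) (app (tensor_map N (id_map (dim_in M))) X)"
proof (rule eq_mat_pairI[of _ "dim_out N" "dim_out M"])
  let ?b = "dim_in M" and ?a = "dim_in N"
  fix p q k l assume ij: "p < dim_out N" "q < dim_out N" "k < dim_out M" "l < dim_out M"
  let ?W = "app (tensor_map N (id_map ?b)) X"
  let ?t = "\<lambda>x y u v. X $$ (x * ?b + u, y * ?b + v) *
      app N (mat_unit ?a x y) $$ (p, q) * app M (mat_unit ?b u v) $$ (k, l)"
  have "app (tensor_map (id_map (dim_out N)) M) ?W $$ (p * dim_out M + k, q * dim_out M + l) =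
      app M (block ?b ?W p q) $$ (k, l)"
    by (rule id_tensor_index[OF M ij])
  also have "\<dots> = (\<Sum>u<?b. \<Sum>v<?b. ?W $$ (p * ?b + u, q * ?b + v) * app M (mat_unit ?b u v) $$ (k, l))"
    by (subst linear_map_unit_expansion[OF M _ ij(3,4)]) simp_all
  also have "\<dots> = (\<Sum>u<?b. \<Sum>v<?b. \<Sum>x<?a. \<Sum>y<?a. ?t x y u v)"
  proof (intro sum.cong refl)
    fix u v assume uv: "u \<in> {..<?b}" "v \<in> {..<?b}"
    have "?W $$ (p * ?b + u, q * ?b + v) =
        (\<Sum>x<?a. \<Sum>y<?a. X $$ (x * ?b + u, y * ?b + v) * app N (mat_unit ?a x y) $$ (p, q))"
      using uv ij by (subst tensor_id_index[OF N], simp_all)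
        (subst linear_map_unit_expansion[OF N], simp_all)
    then show "?W $$ (p * ?b + u, q * ?b + v) * app M (mat_unit ?b u v) $$ (k, l) = (\<Sum>x<?a. \<Sum>y<?a. ?t x y u v)"
      by (simp add: sum_distrib_right)
  qed
  also have "\<dots> = (\<Sum>u<?b. \<Sum>x<?a. \<Sum>v<?b. \<Sum>y<?a. ?t x y u v)"
    by (rule sum.cong[OF refl], rule sum.swap)
  also have "\<dots> = (\<Sum>u<?b. \<Sum>x<?a. \<Sum>y<?a. \<Sum>v<?b. ?t x y u v)"
    by (rule sum.cong[OF refl], rule sum.cong[OF refl], rule sum.swap)
  also have "\<dots> = (\<Sum>x<?a. \<Sum>u<?b. \<Sum>y<?a. \<Sum>v<?b. ?t x y u v)"
    by (rule sum.swap)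
  also have "\<dots> = (\<Sum>x<?a. \<Sum>y<?a. \<Sum>u<?b. \<Sum>v<?b. ?t x y u v)"
    by (rule sum.cong[OF refl], rule sum.swap)
  also have "\<dots> = app (tensor_map N M) X $$ (p * dim_out M + k, q * dim_out M + l)"
    by (rule tensor_map_index[OF ij, symmetric])
  finally show "app (tensor_map N M) X $$ (p * dim_out M + k, q * dim_out M + l) =
      app (tensor_map (id_map (dim_out N)) M) ?W $$ (p * dim_out M + k, q * dim_out M + l)" by simp
qed (use tensor_map_carrier[of "id_map (dim_out N)" M] in simp_all)

lemma channel_tensor_map:
  assumes N: "channel N" and M: "channel M"
  shows "channel (tensor_map N M)"
  by (rule channel_compI[OF channel_tensor_id[OF N, of "dim_in M"]
        channel_id_tensor[OF M, of "dim_out N"] linear_tensor_map])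
    (use channelD[OF N] channelD[OF M] in \<open>simp_all add: tensor_map_factor\<close>)

section \<open>Contraction coefficients of relative entropy\<close>

lemma state_psd: "state n \<rho> \<Longrightarrow> psd n \<rho>"
  by (simp add: state_def)

lemma state_dim_pos: "state n \<rho> \<Longrightarrow> 0 < n"
  by (cases n) (auto simp: state_def psd_def mtrace_def)

lemma rel_ent_self:
  assumes "psd n \<rho>"
  shows "rel_ent \<rho> \<rho> = 0"
proof -
  obtain U d where U: "unitary_mat n U" and \<rho>: "\<rho> = U * rdiag n d * mat_adjoint U"
    using psd_spectral[OF assms] by metis
  have Uc: "U \<in> carrier_mat n n" and UU: "mat_adjoint U * U = 1\<^sub>m n" "U * mat_adjoint U = 1\<^sub>m n"
    using U by (auto simp: unitary_mat_def)
  have "mat_log \<rho> = U * rdiag n (\<lambda>i. if 0 < d i then ln (d i) else 0) * mat_adjoint U"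
    unfolding mat_log_def by (rule spec_fun_eqI[OF Uc UU \<rho>])
  then have "mat_log \<rho> \<in> carrier_mat n n" using Uc mat_adjoint_carrier[OF Uc]
    by (simp add: mult_carrier_mat[of _ n n _ n])
  then have "mat_log \<rho> - mat_log \<rho> = 0\<^sub>m n n" by (intro eq_matI) auto
  then have "\<rho> * (mat_log \<rho> - mat_log \<rho>) = 0\<^sub>m n n"
    using psd_carrier[OF assms] by (simp add: right_mult_zero_mat[of _ n n])
  then show ?thesis by (simp add: rel_ent_def mtrace_def zero_ereal_def)
qed

text \<open>Data processing under the full trace, which sends all states to the same 1-by-1
  state.\<close>

lemma rel_ent_nonneg:
  assumes "state n \<rho>" "state n \<sigma>"
  shows "0 \<le> rel_ent \<rho> \<sigma>"
proof -
  have "channel (trace_map n)" using state_dim_pos[OF assms(1)] by (rule channel_trace_map)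
  then have le: "rel_ent (app (trace_map n) \<rho>) (app (trace_map n) \<sigma>) \<le> rel_ent \<rho> \<sigma>"
    using assms by (intro rel_ent_data_processing) (simp_all add: state_psd)
  have "psd 1 (app (trace_map n) \<rho>)"
    using channel_psd[OF \<open>channel (trace_map n)\<close>, of \<rho>] assms by (simp add: state_psd)
  moreover have "app (trace_map n) \<sigma> = app (trace_map n) \<rho>"
    using assms by (simp add: state_def)
  ultimately show ?thesis using le rel_ent_self by metis
qed

lemma rel_ent_channel_state:
  assumes "channel T" "state (dim_in T) \<rho>" "state (dim_in T) \<sigma>"
  shows "rel_ent (app T \<rho>) (app T \<sigma>) \<le> rel_ent \<rho> \<sigma>"
  using assms by (simp add: rel_ent_data_processing state_psd)

lemma state_factors_pos: "state (r * n) \<rho> \<Longrightarrow> 0 < r \<and> 0 < n"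
  using state_dim_pos by fastforce

lemma state_tr_snd:
  assumes "state (r * n) \<rho>"
  shows "state r (tr_snd r n \<rho>)"
  using channel_state[OF channel_tr_snd, of r n \<rho>] state_factors_pos[OF assms] assms
  by (simp add: tr_snd_eq_tensor)

lemma rel_ent_tr_snd:
  assumes "state (r * n) \<rho>" "state (r * n) \<sigma>"
  shows "rel_ent (tr_snd r n \<rho>) (tr_snd r n \<sigma>) \<le> rel_ent \<rho> \<sigma>"
  using rel_ent_channel_state[OF channel_tr_snd, of r n \<rho> \<sigma>] state_factors_pos[OF assms(1)] assms
  by (simp add: tr_snd_eq_tensor)

lemma state_id_tensor:
  assumes "channel T" "state (r * dim_in T) \<rho>"
  shows "state (r * dim_out T) (app (tensor_map (id_map r) T) \<rho>)"
  using channel_state[OF channel_id_tensor[OF assms(1)], of r \<rho>] assms(2) state_factors_pos[OF assms(2)]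
  by simp

lemma rel_ent_id_tensor:
  assumes "channel T" "state (r * dim_in T) \<rho>" "state (r * dim_in T) \<sigma>"
  shows "rel_ent (app (tensor_map (id_map r) T) \<rho>) (app (tensor_map (id_map r) T) \<sigma>) \<le> rel_ent \<rho> \<sigma>"
  using rel_ent_channel_state[OF channel_id_tensor[OF assms(1)], of r \<rho> \<sigma>] assms(2,3)
    state_factors_pos[OF assms(2)]
  by simp

lemma tr_snd_block: "i < r \<Longrightarrow> j < r \<Longrightarrow> tr_snd r n X $$ (i, j) = mtrace (block n X i j)"
  by (simp add: tr_snd_def mtrace_def block_def)

text \<open>By trace preservation on each block, the input marginal subtracted in the numerator of
  \<open>eta_Delta_D\<close> is also the marginal of the output.\<close>

lemma tr_snd_id_tensor:
  assumes "channel T"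
  shows "tr_snd r (dim_out T) (app (tensor_map (id_map r) T) X) = tr_snd r (dim_in T) X"
proof (rule eq_matI)
  fix i j assume "i < dim_row (tr_snd r (dim_in T) X)" "j < dim_col (tr_snd r (dim_in T) X)"
  then have "i < r" "j < r" by (auto simp: tr_snd_def)
  then show "tr_snd r (dim_out T) (app (tensor_map (id_map r) T) X) $$ (i, j) = tr_snd r (dim_in T) X $$ (i, j)"
    by (simp add: tr_snd_block block_id_tensor[OF channelD(3)[OF assms]] mtrace_app[OF assms])
qed (simp_all add: tr_snd_def)

lemma rel_ent_real:
  assumes "state n \<rho>" "state n \<sigma>" "rel_ent \<rho> \<sigma> \<le> ereal d"
  obtains x where "rel_ent \<rho> \<sigma> = ereal x" "0 \<le> x" "x \<le> d"
  using rel_ent_nonneg[OF assms(1,2)] assms(3) by (cases "rel_ent \<rho> \<sigma>") auto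

section \<open>From suprema of ratios to linear inequalities\<close>

lemma sup_ratio_unit:
  assumes "\<And>y. y \<in> S \<Longrightarrow> 0 \<le> y \<and> y \<le> 1"
  shows "\<exists>e. sup_ratio S = ereal e \<and> 0 \<le> e \<and> e \<le> 1"
proof -
  have "0 \<le> sup_ratio S"
    using assms by (auto simp: sup_ratio_def intro: order_trans[OF _ Sup_upper])
  moreover have "sup_ratio S \<le> 1"
    using assms by (auto simp: sup_ratio_def intro: Sup_least)
  ultimately show ?thesis by (cases "sup_ratio S") (auto simp: one_ereal_def)
qed

lemma sup_ratio_le:
  assumes "0 \<le> B" "\<And>y. y \<in> S \<Longrightarrow> y \<le> B"
  shows "sup_ratio S \<le> B"
  using assms by (auto simp: sup_ratio_def intro: Sup_least)

text \<open>A zero denominator contributes no ratio to \<open>S\<close>; there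
  \<open>x \<le> d = 0\<close> gives the claim directly.\<close>

lemma sup_ratio_bound:
  assumes "sup_ratio S = ereal e" "x \<le> d" "0 < d \<Longrightarrow> ereal x / ereal d \<in> S" "0 \<le> d"
  shows "x \<le> e * d"
proof (cases "0 < d")
  case True
  then have "ereal x / ereal d \<le> sup_ratio S"
    using assms(3) by (auto simp: sup_ratio_def intro: Sup_upper)
  then show ?thesis using True assms(1) by (simp add: divide_le_eq)
qed (use assms in auto)

text \<open>Data processing twice: along \<open>T\<close>, and along the partial trace of the
  output, whose reference marginal is that of the input. Once \<open>d\<close> is finite, all three
  quantities are real and the subtractions in \<open>ereal\<close> are genuine.\<close>

lemma delta_reals:
  assumes T: "channel T" and \<rho>: "state (r * dim_in T) \<rho>" and \<sigma>: "state (r * dim_in T) \<sigma>"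
    and d: "rel_ent \<rho> \<sigma> = ereal d"
  obtains x y where "rel_ent (app (tensor_map (id_map r) T) \<rho>) (app (tensor_map (id_map r) T) \<sigma>) = ereal x"
    "rel_ent (tr_snd r (dim_in T) \<rho>) (tr_snd r (dim_in T) \<sigma>) = ereal y" "y \<le> x" "x \<le> d"
proof -
  note \<rho>' = state_id_tensor[OF T \<rho>] and \<sigma>' = state_id_tensor[OF T \<sigma>]
  obtain x where x: "rel_ent (app (tensor_map (id_map r) T) \<rho>) (app (tensor_map (id_map r) T) \<sigma>) = ereal x" "x \<le> d"
    using rel_ent_real[OF \<rho>' \<sigma>'] rel_ent_id_tensor[OF T \<rho> \<sigma>] d by metis
  have "rel_ent (tr_snd r (dim_in T) \<rho>) (tr_snd r (dim_in T) \<sigma>) \<le> ereal x"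
    using rel_ent_tr_snd[OF \<rho>' \<sigma>'] x by (simp add: tr_snd_id_tensor[OF T])
  then obtain y where "rel_ent (tr_snd r (dim_in T) \<rho>) (tr_snd r (dim_in T) \<sigma>) = ereal y" "y \<le> x"
    using rel_ent_real[OF state_tr_snd[OF \<rho>] state_tr_snd[OF \<sigma>]] by metis
  with x show thesis using that by blast
qed

lemma eta_Delta_D_unit:
  assumes T: "channel T"
  shows "\<exists>e. eta_Delta_D T = ereal e \<and> 0 \<le> e \<and> e \<le> 1"
  unfolding eta_Delta_D_def
proof (rule sup_ratio_unit, elim CollectE exE conjE)
  fix z r \<rho> \<sigma>
  assume \<rho>: "state (r * dim_in T) \<rho>" and \<sigma>: "state (r * dim_in T) \<sigma>"
    and pos: "0 < rel_ent \<rho> \<sigma> - rel_ent (tr_snd r (dim_in T) \<rho>) (tr_snd r (dim_in T) \<sigma>)"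
    and fin: "rel_ent \<rho> \<sigma> - rel_ent (tr_snd r (dim_in T) \<rho>) (tr_snd r (dim_in T) \<sigma>) < \<infinity>"
    and z: "z = (rel_ent (app (tensor_map (id_map r) T) \<rho>) (app (tensor_map (id_map r) T) \<sigma>) -
         rel_ent (tr_snd r (dim_in T) \<rho>) (tr_snd r (dim_in T) \<sigma>)) /
      (rel_ent \<rho> \<sigma> - rel_ent (tr_snd r (dim_in T) \<rho>) (tr_snd r (dim_in T) \<sigma>))"
  obtain d where d: "rel_ent \<rho> \<sigma> = ereal d"
    using rel_ent_nonneg[of _ \<rho> \<sigma>] \<rho> \<sigma> fin by (cases "rel_ent \<rho> \<sigma>") auto
  obtain x y where xy: "rel_ent (app (tensor_map (id_map r) T) \<rho>) (app (tensor_map (id_map r) T) \<sigma>) = ereal x"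
    "rel_ent (tr_snd r (dim_in T) \<rho>) (tr_snd r (dim_in T) \<sigma>) = ereal y" "y \<le> x" "x \<le> d"
    using delta_reals[OF T \<rho> \<sigma> d] .
  have "y < d" using pos unfolding d xy(2) by simp
  then show "0 \<le> z \<and> z \<le> 1"
    unfolding z d xy(1,2) using xy(3,4) by (simp add: one_ereal_def divide_le_eq)
qed

lemma eta_Delta_D_bound:
  assumes T: "channel T" and \<rho>: "state (r * dim_in T) \<rho>" and \<sigma>: "state (r * dim_in T) \<sigma>"
    and d: "rel_ent \<rho> \<sigma> = ereal d" and e: "eta_Delta_D T = ereal e"
    and x: "rel_ent (app (tensor_map (id_map r) T) \<rho>) (app (tensor_map (id_map r) T) \<sigma>) = ereal x"
    and y: "rel_ent (tr_snd r (dim_in T) \<rho>) (tr_snd r (dim_in T) \<sigma>) = ereal y"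
  shows "x - y \<le> e * (d - y)"
proof (rule sup_ratio_bound[OF e[unfolded eta_Delta_D_def]])
  have "y \<le> x" "x \<le> d" using delta_reals[OF T \<rho> \<sigma> d] x y by (metis ereal.inject)+
  then show "x - y \<le> d - y" "0 \<le> d - y" by simp_all
  show "ereal (x - y) / ereal (d - y) \<in>
    {(rel_ent (app (tensor_map (id_map r) T) \<rho>) (app (tensor_map (id_map r) T) \<sigma>) -
         rel_ent (tr_snd r (dim_in T) \<rho>) (tr_snd r (dim_in T) \<sigma>)) /
      (rel_ent \<rho> \<sigma> - rel_ent (tr_snd r (dim_in T) \<rho>) (tr_snd r (dim_in T) \<sigma>))
      | r \<rho> \<sigma>. state (r * dim_in T) \<rho> \<and> state (r * dim_in T) \<sigma> \<and>
        0 < rel_ent \<rho> \<sigma> - rel_ent (tr_snd r (dim_in T) \<rho>) (tr_snd r (dim_in T) \<sigma>) \<and>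
        rel_ent \<rho> \<sigma> - rel_ent (tr_snd r (dim_in T) \<rho>) (tr_snd r (dim_in T) \<sigma>) < \<infinity>}"
    if "0 < d - y"
    using that \<rho> \<sigma> d x y
    by (intro CollectI exI[of _ r] exI[of _ \<rho>] exI[of _ \<sigma>]) simp
qed

lemma eta_D_unit:
  assumes T: "channel T"
  shows "\<exists>e. eta_D T = ereal e \<and> 0 \<le> e \<and> e \<le> 1"
  unfolding eta_D_def
proof (rule sup_ratio_unit, elim CollectE exE conjE)
  fix z \<rho> \<sigma>
  assume \<rho>: "state (dim_in T) \<rho>" and \<sigma>: "state (dim_in T) \<sigma>"
    and pos: "0 < rel_ent \<rho> \<sigma>" "rel_ent \<rho> \<sigma> < \<infinity>"
    and z: "z = rel_ent (app T \<rho>) (app T \<sigma>) / rel_ent \<rho> \<sigma>"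
  obtain d where d: "rel_ent \<rho> \<sigma> = ereal d" using pos by (cases "rel_ent \<rho> \<sigma>") auto
  obtain x where "rel_ent (app T \<rho>) (app T \<sigma>) = ereal x" "0 \<le> x" "x \<le> d"
    using rel_ent_real[OF channel_state[OF T \<rho>] channel_state[OF T \<sigma>]] rel_ent_channel_state[OF T \<rho> \<sigma>] d by metis
  then show "0 \<le> z \<and> z \<le> 1" using pos(1) unfolding z d by (simp add: one_ereal_def)
qed

lemma eta_D_bound:
  assumes T: "channel T" and \<rho>: "state (dim_in T) \<rho>" and \<sigma>: "state (dim_in T) \<sigma>"
    and d: "rel_ent \<rho> \<sigma> = ereal d" and e: "eta_D T = ereal e"
  shows "rel_ent (app T \<rho>) (app T \<sigma>) \<le> ereal (e * d)"
proof -
  obtain x where x: "rel_ent (app T \<rho>) (app T \<sigma>) = ereal x" "0 \<le> x" "x \<le> d"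
    using rel_ent_real[OF channel_state[OF T \<rho>] channel_state[OF T \<sigma>]] rel_ent_channel_state[OF T \<rho> \<sigma>] d by metis
  have "x \<le> e * d"
  proof (rule sup_ratio_bound[OF e[unfolded eta_D_def] x(3)])
    assume pos: "0 < d"
    then have "\<rho> \<noteq> \<sigma>" using rel_ent_self[OF state_psd[OF \<rho>]] d by auto
    with pos \<rho> \<sigma> d x(1) show "ereal x / ereal d \<in> {rel_ent (app T \<rho>) (app T \<sigma>) / rel_ent \<rho> \<sigma> | \<rho> \<sigma>.
       state (dim_in T) \<rho> \<and> state (dim_in T) \<sigma> \<and> \<rho> \<noteq> \<sigma> \<and> 0 < rel_ent \<rho> \<sigma> \<and> rel_ent \<rho> \<sigma> < \<infinity>}"
      by (intro CollectI exI[of _ \<rho>] exI[of _ \<sigma>]) simp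
  qed (use x in simp)
  then show ?thesis using x by simp
qed

section \<open>Mutual information and tensor products\<close>

lemma psd_factor:
  assumes "psd n A"
  obtains S where "S \<in> carrier_mat n n" "A = S * mat_adjoint S"
proof -
  obtain U d where U: "unitary_mat n U" and d: "\<And>i. i < n \<Longrightarrow> 0 \<le> d i" and A: "A = U * rdiag n d * mat_adjoint U"
    using psd_spectral[OF assms] by metis
  have Uc: "U \<in> carrier_mat n n" using U by (simp add: unitary_mat_def)
  note U' = mat_adjoint_carrier[OF Uc]
  note assoc = assoc_mult_mat[of _ n n _ n _ n] and car = mult_carrier_mat[of _ n n _ n] mat_diag_dim Uc U'
  let ?R = "rdiag n (\<lambda>i. sqrt (d i))"
  have R: "?R * ?R = rdiag n d"
    by (rule eq_matI) (auto simp: mat_diag_def d of_real_mult[symmetric] simp del: of_real_mult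
      simp: mat_diag_diag[unfolded mat_diag_def])
  have "(U * ?R) * mat_adjoint (U * ?R) = U * ((?R * ?R) * mat_adjoint U)"
    by (simp add: mat_adjoint_mult[OF Uc mat_diag_dim] assoc car del: mat_diag_diag)
  then have "A = (U * ?R) * mat_adjoint (U * ?R)" unfolding A R by (simp add: assoc car)
  moreover have "U * ?R \<in> carrier_mat n n" by (simp add: car)
  ultimately show thesis using that by blast
qed

lemma kron_carrier [simp]:
  "A \<in> carrier_mat c c \<Longrightarrow> B \<in> carrier_mat n n \<Longrightarrow> kron A B \<in> carrier_mat (c * n) (c * n)"
  by (auto simp: kron_def)

lemma kron_index:
  assumes "A \<in> carrier_mat c c" "B \<in> carrier_mat n n" "a < c" "b < c" "k < n" "l < n"
  shows "kron A B $$ (a * n + k, b * n + l) = A $$ (a, b) * B $$ (k, l)"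
  using assms pair_index_less by (simp add: kron_def)

lemma mult_adjoint_index:
  assumes "A \<in> carrier_mat n n" "i < n" "j < n"
  shows "(A * mat_adjoint A) $$ (i, j) = (\<Sum>x<n. A $$ (i, x) * cnj (A $$ (j, x)))"
  using assms by (simp add: mat_mult_index[OF assms(1) mat_adjoint_carrier[OF assms(1)]] del: index_mult_mat(1))

lemma psd_mult_adjoint:
  assumes "A \<in> carrier_mat n n"
  shows "psd n (A * mat_adjoint A)"
  using psd_conj[OF psd_one assms] assms by simp

text \<open>With factorisations \<open>A = S S*\<close> and \<open>B = R R*\<close>, the product is
  \<open>(S \<otimes> R) (S \<otimes> R)*\<close>.\<close>

lemma psd_kron:
  assumes "psd c A" "psd n B"
  shows "psd (c * n) (kron A B)"
proof -
  obtain S where S: "S \<in> carrier_mat c c" "A = S * mat_adjoint S" using psd_factor[OF assms(1)] .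
  obtain R where R: "R \<in> carrier_mat n n" "B = R * mat_adjoint R" using psd_factor[OF assms(2)] .
  note K = kron_carrier[OF S(1) R(1)]
  have "kron A B = kron S R * mat_adjoint (kron S R)"
  proof (rule eq_mat_pairI[of _ c n])
    show "kron A B \<in> carrier_mat (c * n) (c * n)" using assms by (simp add: psd_carrier)
    show "kron S R * mat_adjoint (kron S R) \<in> carrier_mat (c * n) (c * n)"
      using K mat_adjoint_carrier[OF K] by simp
    fix i j k l assume ij: "i < c" "j < c" "k < n" "l < n"
    have "(kron S R * mat_adjoint (kron S R)) $$ (i * n + k, j * n + l) =
        (\<Sum>x<c. \<Sum>y<n. (S $$ (i, x) * cnj (S $$ (j, x))) * (R $$ (k, y) * cnj (R $$ (l, y))))"
      using ij by (simp add: mult_adjoint_index[OF K] pair_index_less sum_pair_index kron_index[OF S(1) R(1)] mult_ac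
        del: index_mult_mat(1))
    also have "\<dots> = A $$ (i, j) * B $$ (k, l)"
      unfolding S(2) R(2) mult_adjoint_index[OF S(1) ij(1,2)] mult_adjoint_index[OF R(1) ij(3,4)]
      by (simp add: sum_product)
    finally show "kron A B $$ (i * n + k, j * n + l) = (kron S R * mat_adjoint (kron S R)) $$ (i * n + k, j * n + l)"
      using kron_index[OF psd_carrier[OF assms(1)] psd_carrier[OF assms(2)] ij] by simp
  qed
  then show ?thesis using psd_mult_adjoint[OF K] by simp
qed

lemma mtrace_kron:
  assumes "A \<in> carrier_mat c c" "B \<in> carrier_mat n n"
  shows "mtrace (kron A B) = mtrace A * mtrace B"
proof -
  have "mtrace (kron A B) = (\<Sum>a<c. \<Sum>k<n. A $$ (a, a) * B $$ (k, k))"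
    using kron_carrier[OF assms] by (simp add: mtrace_def sum_pair_index kron_index[OF assms])
  then show ?thesis using assms by (simp add: mtrace_def sum_product)
qed

lemma state_kron: "state c A \<Longrightarrow> state n B \<Longrightarrow> state (c * n) (kron A B)"
  using mtrace_kron[of A c B n] by (simp add: state_def psd_kron psd_carrier)

lemma tr_fst_eq_swap: "tr_fst c n X = tr_snd n c (app (swap_map c n) X)"
  by (rule eq_matI) (simp_all add: tr_fst_def tr_snd_def swap_map_index)

lemma state_tr_fst:
  assumes "state (c * n) \<rho>"
  shows "state n (tr_fst c n \<rho>)"
proof -
  have "channel (swap_map c n)" using state_factors_pos[OF assms] by (simp add: channel_swap_map)
  from channel_state[OF this, of \<rho>] assms show ?thesis
    unfolding tr_fst_eq_swap by (intro state_tr_snd) simp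
qed

section \<open>Partial traces and local channels\<close>

lemma tr_fst_id_tensor:
  assumes T: "linear_map T"
  shows "tr_fst c (dim_out T) (app (tensor_map (id_map c) T) X) = app T (tr_fst c (dim_in T) X)"
proof (rule eq_matI)
  let ?n = "dim_in T" and ?m = "dim_out T"
  have F: "tr_fst c ?n X \<in> carrier_mat ?n ?n" by (simp add: tr_fst_def)
  note A = app_carrier[OF T F]
  show "dim_row (tr_fst c ?m (app (tensor_map (id_map c) T) X)) = dim_row (app T (tr_fst c ?n X))"
    "dim_col (tr_fst c ?m (app (tensor_map (id_map c) T) X)) = dim_col (app T (tr_fst c ?n X))"
    using A by (simp_all add: tr_fst_def)
  fix p q assume "p < dim_row (app T (tr_fst c ?n X))" "q < dim_col (app T (tr_fst c ?n X))"
  then have pq: "p < ?m" "q < ?m" using A by auto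
  let ?t = "\<lambda>i k l. X $$ (i * ?n + k, i * ?n + l) * app T (mat_unit ?n k l) $$ (p, q)"
  have "tr_fst c ?m (app (tensor_map (id_map c) T) X) $$ (p, q) = (\<Sum>i<c. app T (block ?n X i i) $$ (p, q))"
    using pq by (simp add: tr_fst_def id_tensor_index[OF T])
  also have "\<dots> = (\<Sum>i<c. \<Sum>k<?n. \<Sum>l<?n. ?t i k l)"
    by (intro sum.cong refl) (simp add: linear_map_unit_expansion[OF T block_carrier pq])
  also have "\<dots> = (\<Sum>k<?n. \<Sum>i<c. \<Sum>l<?n. ?t i k l)" by (rule sum.swap)
  also have "\<dots> = (\<Sum>k<?n. \<Sum>l<?n. \<Sum>i<c. ?t i k l)"
    by (rule sum.cong[OF refl], rule sum.swap)
  also have "\<dots> = app T (tr_fst c ?n X) $$ (p, q)"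
    unfolding linear_map_unit_expansion[OF T F pq]
    by (intro sum.cong refl) (simp add: tr_fst_def sum_distrib_right)
  finally show "tr_fst c ?m (app (tensor_map (id_map c) T) X) $$ (p, q) = app T (tr_fst c ?n X) $$ (p, q)" .
qed

lemma triple_index: "(x * a + u) * b + k = x * (a * b) + (u * b + k)" for x a u b k :: nat
  by (simp add: algebra_simps)

text \<open>\<open>N\<close> commutes with discarding the other factor. Hence the reference part of
  the divergence after the first step is the divergence of \<open>N\<close> applied to the
  marginals.\<close>

lemma tr_snd_tensor_id:
  assumes N: "linear_map N"
  shows "tr_snd (r * dim_out N) b (app (tensor_map (id_map r) (tensor_map N (id_map b))) X) =
    app (tensor_map (id_map r) N) (tr_snd (r * dim_in N) b X)"
proof (rule eq_mat_pairI[of _ r "dim_out N"])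
  let ?a = "dim_in N" and ?m = "dim_out N"
  let ?W = "app (tensor_map (id_map r) (tensor_map N (id_map b))) X"
  show "tr_snd (r * ?m) b ?W \<in> carrier_mat (r * ?m) (r * ?m)" by (simp add: tr_snd_def)
  show "app (tensor_map (id_map r) N) (tr_snd (r * ?a) b X) \<in> carrier_mat (r * ?m) (r * ?m)"
    using tensor_map_carrier[of "id_map r" N] by simp
  fix x y p q assume xy: "x < r" "y < r" "p < ?m" "q < ?m"
  let ?t = "\<lambda>k i j. X $$ (x * (?a * b) + (i * b + k), y * (?a * b) + (j * b + k)) * app N (mat_unit ?a i j) $$ (p, q)"
  have W: "?W $$ ((x * ?m + p) * b + k, (y * ?m + q) * b + k) = (\<Sum>i<?a. \<Sum>j<?a. ?t k i j)" if k: "k < b" for k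
  proof -
    have "?W $$ ((x * ?m + p) * b + k, (y * ?m + q) * b + k) =
        ?W $$ (x * (?m * b) + (p * b + k), y * (?m * b) + (q * b + k))"
      by (simp add: algebra_simps)
    also have "\<dots> = app (tensor_map N (id_map b)) (block (?a * b) X x y) $$ (p * b + k, q * b + k)"
      using id_tensor_index[OF linear_tensor_map, of x r y "p * b + k" N "id_map b" "q * b + k" X] xy k
      by (simp add: pair_index_less)
    also have "\<dots> = (\<Sum>i<?a. \<Sum>j<?a. ?t k i j)"
      unfolding tensor_id_index[OF N xy(3,4) k k]
      using k by (subst linear_map_unit_expansion[OF N _ xy(3,4)]) (simp_all add: pair_index_less)
    finally show ?thesis .
  qed
  have "tr_snd (r * ?m) b ?W $$ (x * ?m + p, y * ?m + q) =
      (\<Sum>k<b. ?W $$ ((x * ?m + p) * b + k, (y * ?m + q) * b + k))"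
    unfolding tr_snd_def using xy by (simp add: pair_index_less)
  also have "\<dots> = (\<Sum>k<b. \<Sum>i<?a. \<Sum>j<?a. ?t k i j)"
    by (rule sum.cong[OF refl]) (simp only: lessThan_iff W)
  also have "\<dots> = (\<Sum>i<?a. \<Sum>k<b. \<Sum>j<?a. ?t k i j)" by (rule sum.swap)
  also have "\<dots> = (\<Sum>i<?a. \<Sum>j<?a. \<Sum>k<b. ?t k i j)"
    by (rule sum.cong[OF refl], rule sum.swap)
  also have "\<dots> = app N (block ?a (tr_snd (r * ?a) b X) x y) $$ (p, q)"
  proof -
    have "block ?a (tr_snd (r * ?a) b X) x y $$ (i, j) =
        (\<Sum>k<b. X $$ (x * (?a * b) + (i * b + k), y * (?a * b) + (j * b + k)))"
      if "i < ?a" "j < ?a" for i j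
      using that xy by (simp add: tr_snd_def pair_index_less triple_index)
    then show ?thesis
      unfolding linear_map_unit_expansion[OF N block_carrier xy(3,4)]
      by (intro sum.cong refl) (simp add: sum_distrib_right)
  qed
  also have "\<dots> = app (tensor_map (id_map r) N) (tr_snd (r * ?a) b X) $$ (x * ?m + p, y * ?m + q)"
    by (rule id_tensor_index[OF N xy, symmetric])
  finally show "tr_snd (r * ?m) b ?W $$ (x * ?m + p, y * ?m + q) =
      app (tensor_map (id_map r) N) (tr_snd (r * ?a) b X) $$ (x * ?m + p, y * ?m + q)" .
qed

lemma tr_snd_tr_snd: "tr_snd c a (tr_snd (c * a) b X) = tr_snd c (a * b) X"
  by (rule eq_matI) (simp_all add: tr_snd_def pair_index_less triple_index sum_pair_index)

lemma tr_fst_tr_snd: "tr_fst c a (tr_snd (c * a) b X) = tr_snd a b (tr_fst c (a * b) X)"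
proof (rule eq_matI)
  fix i j assume "i < dim_row (tr_snd a b (tr_fst c (a * b) X))" "j < dim_col (tr_snd a b (tr_fst c (a * b) X))"
  then have ij: "i < a" "j < a" by (auto simp: tr_snd_def)
  have "tr_fst c a (tr_snd (c * a) b X) $$ (i, j) =
      (\<Sum>x<c. \<Sum>k<b. X $$ (x * (a * b) + (i * b + k), x * (a * b) + (j * b + k)))"
    using ij by (simp add: tr_fst_def tr_snd_def pair_index_less triple_index)
  also have "\<dots> = (\<Sum>k<b. \<Sum>x<c. X $$ (x * (a * b) + (i * b + k), x * (a * b) + (j * b + k)))"
    by (rule sum.swap)
  also have "\<dots> = tr_snd a b (tr_fst c (a * b) X) $$ (i, j)"
    using ij by (simp add: tr_fst_def tr_snd_def pair_index_less)
  finally show "tr_fst c a (tr_snd (c * a) b X) $$ (i, j) = tr_snd a b (tr_fst c (a * b) X) $$ (i, j)" .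
qed (simp_all add: tr_fst_def tr_snd_def)

lemma tr_snd_kron:
  assumes A: "A \<in> carrier_mat c c" and B: "B \<in> carrier_mat (a * b) (a * b)"
  shows "tr_snd (c * a) b (kron A B) = kron A (tr_snd a b B)"
proof (rule eq_mat_pairI[of _ c a])
  have T: "tr_snd a b B \<in> carrier_mat a a" by (simp add: tr_snd_def)
  show "tr_snd (c * a) b (kron A B) \<in> carrier_mat (c * a) (c * a)" by (simp add: tr_snd_def)
  show "kron A (tr_snd a b B) \<in> carrier_mat (c * a) (c * a)" using A T by simp
  fix i j k l assume ij: "i < c" "j < c" "k < a" "l < a"
  show "tr_snd (c * a) b (kron A B) $$ (i * a + k, j * a + l) = kron A (tr_snd a b B) $$ (i * a + k, j * a + l)"
    unfolding kron_index[OF A T ij] unfolding tr_snd_def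
    using ij by (simp add: pair_index_less triple_index kron_index[OF A B] sum_distrib_left)
qed

section \<open>Mutual information as a relative entropy\<close>

definition marginal_product :: "nat \<Rightarrow> nat \<Rightarrow> complex mat \<Rightarrow> complex mat" where
  "marginal_product c n \<rho> = kron (tr_snd c n \<rho>) (tr_fst c n \<rho>)"

lemma mutual_info_eq: "mutual_info c n \<rho> = rel_ent \<rho> (marginal_product c n \<rho>)"
  by (simp add: mutual_info_def marginal_product_def)

lemma state_marginal_product: "state (c * n) \<rho> \<Longrightarrow> state (c * n) (marginal_product c n \<rho>)"
  by (simp add: marginal_product_def state_kron state_tr_snd state_tr_fst)

text \<open>Both arguments of the relative entropy defining mutual information pass through the same
  channel, so a local channel acts on mutual information as it does on a pair of states.\<close>

lemma marginal_product_id_tensor: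
  assumes T: "channel T"
  shows "marginal_product c (dim_out T) (app (tensor_map (id_map c) T) \<rho>) =
    app (tensor_map (id_map c) T) (marginal_product c (dim_in T) \<rho>)"
proof -
  have "linear_map (id_map c)" by (simp add: linear_map_def)
  from app_tensor_map_kron[OF this channelD(3)[OF T], of "tr_snd c (dim_in T) \<rho>" "tr_fst c (dim_in T) \<rho>"]
  show ?thesis
    by (simp add: marginal_product_def tr_snd_id_tensor[OF T] tr_fst_id_tensor[OF channelD(3)[OF T]],
        simp add: tr_snd_def tr_fst_def)
qed

lemma mutual_info_id_tensor:
  assumes "channel T" "state (c * dim_in T) \<rho>"
  shows "mutual_info c (dim_out T) (app (tensor_map (id_map c) T) \<rho>) \<le> mutual_info c (dim_in T) \<rho>"
  unfolding mutual_info_eq marginal_product_id_tensor[OF assms(1)]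
  using assms by (intro rel_ent_id_tensor state_marginal_product)

text \<open>Discarding part of the second system leaves a pair of the same kind, so
  \<open>eta_MI\<close> applies to the reduced pair.\<close>

lemma marginal_product_tr_snd:
  "tr_snd (c * a) b (marginal_product c (a * b) \<rho>) = marginal_product c a (tr_snd (c * a) b \<rho>)"
  unfolding marginal_product_def tr_snd_tr_snd tr_fst_tr_snd
  by (rule tr_snd_kron) (simp_all add: tr_snd_def tr_fst_def)

lemma mutual_info_real:
  assumes "state (c * n) \<rho>" "mutual_info c n \<rho> \<le> ereal d"
  obtains x where "mutual_info c n \<rho> = ereal x" "0 \<le> x" "x \<le> d"
  using rel_ent_real[OF assms(1) state_marginal_product[OF assms(1)]] assms(2)
  unfolding mutual_info_eq by metis

lemma eta_MI_unit:
  assumes T: "channel T"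
  shows "\<exists>e. eta_MI T = ereal e \<and> 0 \<le> e \<and> e \<le> 1"
  unfolding eta_MI_def
proof (rule sup_ratio_unit, elim CollectE exE conjE)
  fix z c \<rho>
  assume \<rho>: "state (c * dim_in T) \<rho>"
    and pos: "0 < mutual_info c (dim_in T) \<rho>" "mutual_info c (dim_in T) \<rho> < \<infinity>"
    and z: "z = mutual_info c (dim_out T) (app (tensor_map (id_map c) T) \<rho>) / mutual_info c (dim_in T) \<rho>"
  obtain d where d: "mutual_info c (dim_in T) \<rho> = ereal d"
    using pos by (cases "mutual_info c (dim_in T) \<rho>") auto
  obtain x where "mutual_info c (dim_out T) (app (tensor_map (id_map c) T) \<rho>) = ereal x" "0 \<le> x" "x \<le> d"
    using mutual_info_real[OF state_id_tensor[OF T \<rho>]] mutual_info_id_tensor[OF T \<rho>] d by metis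
  then show "0 \<le> z \<and> z \<le> 1" using pos(1) unfolding z d by (simp add: one_ereal_def)
qed

lemma eta_MI_bound:
  assumes T: "channel T" and \<rho>: "state (c * dim_in T) \<rho>"
    and d: "mutual_info c (dim_in T) \<rho> = ereal d" and e: "eta_MI T = ereal e"
  shows "mutual_info c (dim_out T) (app (tensor_map (id_map c) T) \<rho>) \<le> ereal (e * d)"
proof -
  obtain x where x: "mutual_info c (dim_out T) (app (tensor_map (id_map c) T) \<rho>) = ereal x" "0 \<le> x" "x \<le> d"
    using mutual_info_real[OF state_id_tensor[OF T \<rho>]] mutual_info_id_tensor[OF T \<rho>] d by metis
  have "x \<le> e * d"
  proof (rule sup_ratio_bound[OF e[unfolded eta_MI_def] x(3)])
    assume pos: "0 < d"
    with \<rho> d x(1) show "ereal x / ereal d \<in>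
      {mutual_info c (dim_out T) (app (tensor_map (id_map c) T) \<rho>) / mutual_info c (dim_in T) \<rho>
      | c \<rho>. state (c * dim_in T) \<rho> \<and>
        0 < mutual_info c (dim_in T) \<rho> \<and> mutual_info c (dim_in T) \<rho> < \<infinity>}"
      by (intro CollectI exI[of _ c] exI[of _ \<rho>]) simp
  qed (use x in simp)
  then show ?thesis using x by simp
qed

text \<open>The common core for both coefficients, which differ only in the bound for the marginal
  pair. That bound enters as \<open>marg\<close> for one given pair, because \<open>eta_MI\<close>
  controls only pairs made of a state and the product of its marginals.\<close>

lemma rel_ent_tensor_bound:
  assumes N: "channel N" and M: "channel M"
    and \<rho>: "state (r * (dim_in N * dim_in M)) \<rho>" and \<sigma>: "state (r * (dim_in N * dim_in M)) \<sigma>"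
    and d: "rel_ent \<rho> \<sigma> = ereal d" and \<delta>: "eta_Delta_D M = ereal \<delta>" and e: "0 \<le> e"
    and marg: "\<And>y. rel_ent (tr_snd (r * dim_in N) (dim_in M) \<rho>) (tr_snd (r * dim_in N) (dim_in M) \<sigma>) = ereal y \<Longrightarrow>
      rel_ent (app (tensor_map (id_map r) N) (tr_snd (r * dim_in N) (dim_in M) \<rho>))
        (app (tensor_map (id_map r) N) (tr_snd (r * dim_in N) (dim_in M) \<sigma>)) \<le> ereal (e * y)"
  shows "rel_ent (app (tensor_map (id_map r) (tensor_map N M)) \<rho>)
    (app (tensor_map (id_map r) (tensor_map N M)) \<sigma>) \<le> ereal ((\<delta> + e - \<delta> * e) * d)"
proof -
  let ?a = "dim_in N" and ?b = "dim_in M" and ?m = "dim_out N"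
  define \<rho>' \<sigma>' where "\<rho>' = app (tensor_map (id_map r) (tensor_map N (id_map ?b))) \<rho>"
    and "\<sigma>' = app (tensor_map (id_map r) (tensor_map N (id_map ?b))) \<sigma>"
  note linN = channelD(3)[OF N] and linM = channelD(3)[OF M]
  have P: "channel (tensor_map N (id_map ?b))" using channel_tensor_id[OF N] channelD(1)[OF M] by simp
  have s\<rho>: "state (r * ?m * ?b) \<rho>'" and s\<sigma>: "state (r * ?m * ?b) \<sigma>'"
    using state_id_tensor[OF P, of r] \<rho> \<sigma> by (simp_all add: \<rho>'_def \<sigma>'_def mult.assoc)
  \<comment> \<open>\<open>M\<close> acts last, with the reference enlarged by the output of
    \<open>N\<close> to dimension \<open>r * ?m\<close>.\<close>
  have out: "app (tensor_map (id_map r) (tensor_map N M)) X =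
      app (tensor_map (id_map (r * ?m)) M) (app (tensor_map (id_map r) (tensor_map N (id_map ?b))) X)" for X
    using id_tensor_comp[OF linear_tensor_map[of N "id_map ?b"] linear_tensor_map[of "id_map ?m" M]
        linear_tensor_map[of N M], of r X]
    by (simp add: tensor_map_factor[OF linN linM] id_tensor_assoc[OF linM])
  have "rel_ent \<rho>' \<sigma>' \<le> ereal d"
    using rel_ent_id_tensor[OF P, of r \<rho> \<sigma>] \<rho> \<sigma> d by (simp add: \<rho>'_def \<sigma>'_def)
  then obtain d' where d': "rel_ent \<rho>' \<sigma>' = ereal d'" "d' \<le> d"
    using rel_ent_real[OF s\<rho> s\<sigma>] by metis
  obtain x y where xy: "rel_ent (app (tensor_map (id_map (r * ?m)) M) \<rho>') (app (tensor_map (id_map (r * ?m)) M) \<sigma>') = ereal x"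
    "rel_ent (tr_snd (r * ?m) ?b \<rho>') (tr_snd (r * ?m) ?b \<sigma>') = ereal y"
    using delta_reals[OF M s\<rho> s\<sigma> d'(1)] by metis
  have A: "x - y \<le> \<delta> * (d' - y)"
    by (rule eta_Delta_D_bound[OF M s\<rho> s\<sigma> d'(1) \<delta> xy])
  have \<rho>b: "state (r * ?a * ?b) \<rho>" and \<sigma>b: "state (r * ?a * ?b) \<sigma>" using \<rho> \<sigma> by (simp_all add: mult.assoc)
  obtain d1 where d1: "rel_ent (tr_snd (r * ?a) ?b \<rho>) (tr_snd (r * ?a) ?b \<sigma>) = ereal d1" "d1 \<le> d"
    using rel_ent_real[OF state_tr_snd[OF \<rho>b] state_tr_snd[OF \<sigma>b]] rel_ent_tr_snd[OF \<rho>b \<sigma>b] d by metis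
  \<comment> \<open>\<open>y\<close> is taken after \<open>N\<close> on the marginals whose
    divergence before \<open>N\<close> is \<open>d1\<close>.\<close>
  have "ereal y \<le> ereal (e * d1)"
    using marg[OF d1(1)] xy(2) by (simp add: \<rho>'_def \<sigma>'_def tr_snd_tensor_id[OF linN])
  then have y: "y \<le> e * d" using mult_left_mono[OF d1(2) e] by simp
  \<comment> \<open>\<open>\<delta> \<le> 1\<close> keeps the coefficient of \<open>y\<close>
    nonnegative, so that an upper bound on \<open>y\<close> may be inserted below.\<close>
  obtain \<delta>' where "eta_Delta_D M = ereal \<delta>'" "0 \<le> \<delta>'" "\<delta>' \<le> 1" using eta_Delta_D_unit[OF M] by blast
  then have \<delta>01: "0 \<le> \<delta>" "\<delta> \<le> 1" using \<delta> by auto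
  have "x \<le> \<delta> * d' + (1 - \<delta>) * y" using A by (simp add: algebra_simps)
  also have "\<dots> \<le> \<delta> * d + (1 - \<delta>) * (e * d)"
    using \<delta>01 d'(2) y by (intro add_mono mult_left_mono) simp_all
  also have "\<dots> = (\<delta> + e - \<delta> * e) * d" by (simp add: algebra_simps)
  finally show ?thesis unfolding out \<rho>'_def[symmetric] \<sigma>'_def[symmetric] xy(1) by simp
qed

text \<open>Covers an empty set of ratios, whose supremum is 0 by convention.\<close>

lemma combined_nonneg:
  fixes \<delta> e :: real
  assumes "0 \<le> \<delta>" "\<delta> \<le> 1" "0 \<le> e"
  shows "0 \<le> \<delta> + e - \<delta> * e"
  using mult_right_mono[OF assms(2,3)] assms by simp

text \<open>The core bound with the trivial reference \<open>r = 1\<close>, so that the output of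
  \<open>N\<close> alone serves as the reference for \<open>M\<close>.\<close>

lemma eta_D_tensor:
  assumes N: "channel N" and M: "channel M"
    and \<delta>: "eta_Delta_D M = ereal \<delta>" "0 \<le> \<delta>" "\<delta> \<le> 1" and e: "eta_D N = ereal e" "0 \<le> e"
  shows "eta_D (tensor_map N M) \<le> ereal (\<delta> + e - \<delta> * e)"
  unfolding eta_D_def
proof (rule sup_ratio_le, goal_cases)
  case 1
  show ?case using combined_nonneg[OF \<delta>(2,3) e(2)] by simp
next
  case (2 z)
  then obtain \<rho> \<sigma> where \<rho>: "state (dim_in N * dim_in M) \<rho>" and \<sigma>: "state (dim_in N * dim_in M) \<sigma>"
    and pos: "0 < rel_ent \<rho> \<sigma>" "rel_ent \<rho> \<sigma> < \<infinity>"
    and z: "z = rel_ent (app (tensor_map N M) \<rho>) (app (tensor_map N M) \<sigma>) / rel_ent \<rho> \<sigma>" by auto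
  obtain d where d: "rel_ent \<rho> \<sigma> = ereal d" using pos by (cases "rel_ent \<rho> \<sigma>") auto
  have one: "app (tensor_map (id_map 1) (tensor_map N M)) X = app (tensor_map N M) X"
    if "state (dim_in N * dim_in M) X" for X
    using id_one_tensor[OF linear_tensor_map[of N M], of X] psd_carrier[OF state_psd[OF that]] by simp
  have oneN: "app (tensor_map (id_map 1) N) X = app N X" if "state (dim_in N) X" for X
    using id_one_tensor[OF channelD(3)[OF N] psd_carrier[OF state_psd[OF that]]] .
  have "rel_ent (app (tensor_map (id_map 1) (tensor_map N M)) \<rho>)
      (app (tensor_map (id_map 1) (tensor_map N M)) \<sigma>) \<le> ereal ((\<delta> + e - \<delta> * e) * d)"
  proof (rule rel_ent_tensor_bound[OF N M _ _ d \<delta>(1) e(2)])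
    fix y assume "rel_ent (tr_snd (1 * dim_in N) (dim_in M) \<rho>) (tr_snd (1 * dim_in N) (dim_in M) \<sigma>) = ereal y"
    then show "rel_ent (app (tensor_map (id_map 1) N) (tr_snd (1 * dim_in N) (dim_in M) \<rho>))
        (app (tensor_map (id_map 1) N) (tr_snd (1 * dim_in N) (dim_in M) \<sigma>)) \<le> ereal (e * y)"
      using eta_D_bound[OF N state_tr_snd[OF \<rho>] state_tr_snd[OF \<sigma>] _ e(1)]
      by (simp only: mult_1 oneN state_tr_snd[OF \<rho>] state_tr_snd[OF \<sigma>])
  qed (use \<rho> \<sigma> in simp_all)
  then have "rel_ent (app (tensor_map N M) \<rho>) (app (tensor_map N M) \<sigma>) \<le> ereal ((\<delta> + e - \<delta> * e) * d)"
    by (simp only: one[OF \<rho>] one[OF \<sigma>])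
  then show ?case unfolding z d using pos(1) d by (simp add: ereal_divide_le_pos mult.commute)
qed

text \<open>The core bound with \<open>C\<close> as reference and the product of the marginals as
  second argument. The pair left after discarding the input of \<open>M\<close> is again of this
  form, which supplies \<open>marg\<close>.\<close>

lemma eta_MI_tensor:
  assumes N: "channel N" and M: "channel M"
    and \<delta>: "eta_Delta_D M = ereal \<delta>" "0 \<le> \<delta>" "\<delta> \<le> 1" and e: "eta_MI N = ereal e" "0 \<le> e"
  shows "eta_MI (tensor_map N M) \<le> ereal (\<delta> + e - \<delta> * e)"
  unfolding eta_MI_def
proof (rule sup_ratio_le, goal_cases)
  case 1
  show ?case using combined_nonneg[OF \<delta>(2,3) e(2)] by simp
next
  case (2 z)
  let ?n = "dim_in N * dim_in M"
  note NM = channel_tensor_map[OF N M]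
  from 2 obtain c \<rho> where \<rho>: "state (c * ?n) \<rho>"
    and pos: "0 < mutual_info c ?n \<rho>" "mutual_info c ?n \<rho> < \<infinity>"
    and z: "z = mutual_info c (dim_out (tensor_map N M)) (app (tensor_map (id_map c) (tensor_map N M)) \<rho>)
      / mutual_info c ?n \<rho>" by auto
  obtain d where d: "mutual_info c ?n \<rho> = ereal d" using pos by (cases "mutual_info c ?n \<rho>") auto
  have \<rho>1: "state (c * dim_in N) (tr_snd (c * dim_in N) (dim_in M) \<rho>)"
    using \<rho> by (intro state_tr_snd) (simp add: mult.assoc)
  have "rel_ent (app (tensor_map (id_map c) (tensor_map N M)) \<rho>)
      (app (tensor_map (id_map c) (tensor_map N M)) (marginal_product c ?n \<rho>)) \<le> ereal ((\<delta> + e - \<delta> * e) * d)"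
  proof (rule rel_ent_tensor_bound[OF N M \<rho> state_marginal_product[OF \<rho>] d[unfolded mutual_info_eq] \<delta>(1) e(2)])
    fix y assume "rel_ent (tr_snd (c * dim_in N) (dim_in M) \<rho>)
        (tr_snd (c * dim_in N) (dim_in M) (marginal_product c ?n \<rho>)) = ereal y"
    then show "rel_ent (app (tensor_map (id_map c) N) (tr_snd (c * dim_in N) (dim_in M) \<rho>))
        (app (tensor_map (id_map c) N) (tr_snd (c * dim_in N) (dim_in M) (marginal_product c ?n \<rho>))) \<le> ereal (e * y)"
      using eta_MI_bound[OF N \<rho>1 _ e(1)]
      by (simp only: marginal_product_tr_snd mutual_info_eq marginal_product_id_tensor[OF N])
  qed
  then have "mutual_info c (dim_out (tensor_map N M)) (app (tensor_map (id_map c) (tensor_map N M)) \<rho>)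
      \<le> ereal ((\<delta> + e - \<delta> * e) * d)"
    using marginal_product_id_tensor[OF NM, of c \<rho>] by (simp only: mutual_info_eq tensor_map_dims)
  then show ?case unfolding z d using pos(1) d by (simp add: ereal_divide_le_pos mult.commute)
qed

section \<open>Exchanging the tensor factors\<close>

lemma eta_D_swap:
  assumes N: "channel N" and M: "channel M"
  shows "eta_D (tensor_map N M) \<le> eta_D (tensor_map M N)"
proof -
  note MN = channel_tensor_map[OF M N]
  obtain e where e: "eta_D (tensor_map M N) = ereal e" "0 \<le> e" "e \<le> 1" using eta_D_unit[OF MN] by blast
  have S: "channel (swap_map (dim_in N) (dim_in M))" "channel (swap_map (dim_out M) (dim_out N))"
    using channelD(1,2)[OF N] channelD(1,2)[OF M] by (simp_all add: channel_swap_map)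
  show ?thesis
    unfolding eta_D_def[of "tensor_map N M"] e(1)
  proof (rule sup_ratio_le, goal_cases)
    case (2 z)
    then obtain \<rho> \<sigma> where \<rho>: "state (dim_in N * dim_in M) \<rho>" and \<sigma>: "state (dim_in N * dim_in M) \<sigma>"
      and pos: "0 < rel_ent \<rho> \<sigma>" "rel_ent \<rho> \<sigma> < \<infinity>"
      and z: "z = rel_ent (app (tensor_map N M) \<rho>) (app (tensor_map N M) \<sigma>) / rel_ent \<rho> \<sigma>" by auto
    obtain d where d: "rel_ent \<rho> \<sigma> = ereal d" using pos by (cases "rel_ent \<rho> \<sigma>") auto
    define \<rho>' \<sigma>' where "\<rho>' = app (swap_map (dim_in N) (dim_in M)) \<rho>" and "\<sigma>' = app (swap_map (dim_in N) (dim_in M)) \<sigma>"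
    have s: "state (dim_in (tensor_map M N)) \<rho>'" "state (dim_in (tensor_map M N)) \<sigma>'"
      using channel_state[OF S(1)] \<rho> \<sigma> by (simp_all add: \<rho>'_def \<sigma>'_def)
    have "rel_ent \<rho>' \<sigma>' \<le> ereal d"
      using rel_ent_channel_state[OF S(1), of \<rho> \<sigma>] \<rho> \<sigma> d by (simp add: \<rho>'_def \<sigma>'_def)
    then obtain d' where d': "rel_ent \<rho>' \<sigma>' = ereal d'" "d' \<le> d" using rel_ent_real[OF s] by metis
    \<comment> \<open>Data processing for the output swap; the input swap has already given
      \<open>d' \<le> d\<close>.\<close>
    have "rel_ent (app (tensor_map N M) \<rho>) (app (tensor_map N M) \<sigma>) \<le>
        rel_ent (app (tensor_map M N) \<rho>') (app (tensor_map M N) \<sigma>')"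
      using rel_ent_channel_state[OF S(2)] channel_state[OF MN s(1)] channel_state[OF MN s(2)]
      unfolding tensor_map_swap[of N M] \<rho>'_def \<sigma>'_def by simp
    also have "\<dots> \<le> ereal (e * d')" by (rule eta_D_bound[OF MN s d'(1) e(1)])
    also have "\<dots> \<le> ereal (e * d)" using mult_left_mono[OF d'(2) e(2)] by simp
    finally show ?case unfolding z d using pos(1) d by (simp add: ereal_divide_le_pos mult.commute)
  qed (use e in simp)
qed

text \<open>The swaps exchange only the systems of the two channels while \<open>C\<close> stays in
  front, so the factorisation through the exchanged product has to be amplified by
  \<open>C\<close>.\<close>

lemma eta_MI_swap:
  assumes N: "channel N" and M: "channel M"
  shows "eta_MI (tensor_map N M) \<le> eta_MI (tensor_map M N)"
proof -
  note MN = channel_tensor_map[OF M N] and NM = channel_tensor_map[OF N M]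
  obtain e where e: "eta_MI (tensor_map M N) = ereal e" "0 \<le> e" "e \<le> 1" using eta_MI_unit[OF MN] by blast
  let ?S = "swap_map (dim_in N) (dim_in M)" and ?S' = "swap_map (dim_out M) (dim_out N)"
  have S: "channel ?S" "channel ?S'"
    using channelD(1,2)[OF N] channelD(1,2)[OF M] by (simp_all add: channel_swap_map)
  \<comment> \<open>The input swap followed by \<open>tensor_map M N\<close>, an intermediate map
    that lets the threefold composition be amplified in two steps.\<close>
  let ?R = "\<lparr>dim_in = dim_in N * dim_in M, dim_out = dim_out M * dim_out N,
     app = \<lambda>X. app (tensor_map M N) (app ?S X)\<rparr>"
  have linR: "linear_map ?R"
    using linear_swap_map[of "dim_in N" "dim_in M"] linear_tensor_map[of M N]
    unfolding linear_map_def by simp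
  have fact: "app (tensor_map (id_map c) (tensor_map N M)) X = app (tensor_map (id_map c) ?S')
      (app (tensor_map (id_map c) (tensor_map M N)) (app (tensor_map (id_map c) ?S) X))" for c X
  proof -
    have "app (tensor_map (id_map c) (tensor_map N M)) X = app (tensor_map (id_map c) ?S') (app (tensor_map (id_map c) ?R) X)"
      by (rule id_tensor_comp[OF linR linear_swap_map linear_tensor_map]) (simp_all add: tensor_map_swap[of N M])
    also have "app (tensor_map (id_map c) ?R) X =
        app (tensor_map (id_map c) (tensor_map M N)) (app (tensor_map (id_map c) ?S) X)"
      by (rule id_tensor_comp[OF linear_swap_map linear_tensor_map linR]) simp_all
    finally show ?thesis .
  qed
  show ?thesis
    unfolding eta_MI_def[of "tensor_map N M"] e(1)
  proof (rule sup_ratio_le, goal_cases)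
    case (2 z)
    let ?n = "dim_in N * dim_in M"
    from 2 obtain c \<rho> where \<rho>: "state (c * ?n) \<rho>"
      and pos: "0 < mutual_info c ?n \<rho>" "mutual_info c ?n \<rho> < \<infinity>"
      and z: "z = mutual_info c (dim_out N * dim_out M) (app (tensor_map (id_map c) (tensor_map N M)) \<rho>)
        / mutual_info c ?n \<rho>" by auto
    obtain d where d: "mutual_info c ?n \<rho> = ereal d" using pos by (cases "mutual_info c ?n \<rho>") auto
    define \<rho>' where "\<rho>' = app (tensor_map (id_map c) ?S) \<rho>"
    have s: "state (c * dim_in (tensor_map M N)) \<rho>'"
      using state_id_tensor[OF S(1), of c \<rho>] \<rho> by (simp add: \<rho>'_def)
    have "mutual_info c (dim_in (tensor_map M N)) \<rho>' \<le> ereal d"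
      using mutual_info_id_tensor[OF S(1), of c \<rho>] \<rho> d by (simp add: \<rho>'_def)
    then obtain d' where d': "mutual_info c (dim_in (tensor_map M N)) \<rho>' = ereal d'" "d' \<le> d"
      using mutual_info_real[OF s] by metis
    have "mutual_info c (dim_out N * dim_out M) (app (tensor_map (id_map c) (tensor_map N M)) \<rho>) \<le>
        mutual_info c (dim_out (tensor_map M N)) (app (tensor_map (id_map c) (tensor_map M N)) \<rho>')"
      using mutual_info_id_tensor[OF S(2), of c "app (tensor_map (id_map c) (tensor_map M N)) \<rho>'"]
        state_id_tensor[OF MN s]
      by (simp add: fact \<rho>'_def)
    also have "\<dots> \<le> ereal (e * d')" by (rule eta_MI_bound[OF MN s d'(1) e(1)])
    also have "\<dots> \<le> ereal (e * d)" using mult_left_mono[OF d'(2) e(2)] by simp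
    finally show ?case unfolding z d using pos(1) d by (simp add: ereal_divide_le_pos mult.commute)
  qed (use e in simp)
qed

theorem mainTheorem15:
  fixes N M :: qmap and eta :: "qmap \<Rightarrow> ereal"
  assumes "channel N" and "channel M"
    and "eta \<in> {eta_D, eta_MI}"
  shows "eta (tensor_map N M) \<le>
    min (eta M + eta_Delta_D N - eta M * eta_Delta_D N)
        (eta_Delta_D M + eta N - eta_Delta_D M * eta N)"
proof -
  \<comment> \<open>Finite values make the bound an inequality of reals embedded in
    \<open>ereal\<close>.\<close>
  have unit: "\<exists>e. eta T = ereal e \<and> 0 \<le> e" if "channel T" for T
    using assms(3) eta_D_unit[OF that] eta_MI_unit[OF that] by (metis empty_iff insert_iff)
  \<comment> \<open>For the given pair this is the second argument of the minimum, for the exchanged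
    pair the first.\<close>
  have one_sided: "eta (tensor_map S T) \<le> eta_Delta_D T + eta S - eta_Delta_D T * eta S"
    if S: "channel S" and T: "channel T" for S T
  proof -
    obtain e where e: "eta S = ereal e" "0 \<le> e" using unit[OF S] by blast
    obtain \<delta> where \<delta>: "eta_Delta_D T = ereal \<delta>" "0 \<le> \<delta>" "\<delta> \<le> 1" using eta_Delta_D_unit[OF T] by blast
    have "eta (tensor_map S T) \<le> ereal (\<delta> + e - \<delta> * e)"
      using assms(3) e eta_D_tensor[OF S T \<delta>] eta_MI_tensor[OF S T \<delta>] by auto
    then show ?thesis by (simp add: e(1) \<delta>(1))
  qed
  have swap: "eta (tensor_map N M) \<le> eta (tensor_map M N)"
    using assms eta_D_swap eta_MI_swap by blast
  have "eta_Delta_D N + eta M - eta_Delta_D N * eta M = eta M + eta_Delta_D N - eta M * eta_Delta_D N"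
    by (simp add: add.commute mult.commute)
  then have "eta (tensor_map N M) \<le> eta M + eta_Delta_D N - eta M * eta_Delta_D N"
    using order_trans[OF swap one_sided[OF assms(2,1)]] by simp
  then show ?thesis using one_sided[OF assms(1,2)] by simp
qed

end
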